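(* Let $\mu=\sum_{\alpha\in A}w_\alpha\delta_{\xi_\alpha}$ be a discrete random probability measure on the unit ball of a separable Hilbert space that satisfies the Ghirlanda-Guerra identities. Then for any $t\in\mathbb{R}$, any $n\geq 2$ and any bounded (measurable) function $f$ of the overlaps $(R_{\ell,\ell'})_{\ell,\ell'\leq n}$ on $n$ configurations, we have $$\mathbb{E}\langle f\rangle_t=\mathbb{E}\langle f\rangle .$$
   Context: Let $A$ be a countable index set and $B$ the unit ball of a separable (real) Hilbert space $H$ with scalar product denoted by "$\cdot$". Let $\mu=\sum_{\alpha\in A}w_\alpha\delta_{\xi_\alpha}$ be a random probability measure on $B$, with random points $\xi_\alpha\in B$ and random weights $w_\alpha\geq 0$, $\sum_{\alpha\in A} w_\alpha=1$. The points $\xi_\alpha$ carrying positive weight are almost surely pairwise distinct, so that these indices correspond to the atoms of $\mu$. Indices $\alpha\in A$ are called configurations. For a function $f=f(\alpha^1,\ldots,\alpha^n)$ of $n$ configurations, write $$\langle f\rangle=\sum_{\alpha^1,\ldots,\alpha^n\in A}w_{\alpha^1}\cdots w_{\alpha^n}f(\alpha^1,\ldots,\alpha^n).$$ The overlaps are $R_{\ell,\ell'}=\xi_{\alpha^\ell}\cdot\xi_{\alpha^{\ell'}}$. A function of the overlaps on $n$ configurations is a function of $(\alpha^1,\ldots,\alpha^n)$ that depends on them only through $(R_{\ell,\ell'})_{\ell,\ell'\leq n}$. The random measure $\mu$ satisfies the Ghirlanda-Guerra identities if for any $n\geq 2$, any bounded measurable function $f$ of the overlaps $(R_{\ell,\ell'})_{\ell,\ell'\leq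 n}$, and any integer $p\geq 1$, $$\mathbb{E}\langle fR_{1,n+1}^p\rangle=\frac1n\,\mathbb{E}\langle f\rangle\,\mathbb{E}\langle R_{1,2}^p\rangle+\frac1n\sum_{\ell=2}^n\mathbb{E}\langle fR_{1,\ell}^p\rangle .$$ Let $(\varepsilon_\alpha)_{\alpha\in A}$ be independent symmetric Bernoulli random variables (values $\pm1$ with probability $1/2$ each), independent of the randomness of $\mu$. For $t\in\mathbb{R}$ define $$w_{\alpha,t}=\frac{w_\alpha\exp(t\varepsilon_\alpha)}{\sum_{\gamma\in A}w_\gamma\exp(t\varepsilon_\gamma)},\qquad \mu_t=\sum_{\alpha\in A}w_{\alpha,t}\delta_{\xi_\alpha},$$ $$\langle f\rangle_t=\sum_{\alpha^1,\ldots,\alpha^n\in A}w_{\alpha^1,t}\cdots w_{\alpha^n,t}f(\alpha^1,\ldots,\alpha^n).$$ The expectation $\mathbb{E}$ is over all randomness (of $\mu$ and of $(\varepsilon_\alpha)$). *)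

theory Defs
  imports "HOL-Probability.Probability"
begin

locale discrete_random_measure = prob_space M
  for M :: "'o measure" +
  fixes A :: "'a set"
    and w :: "'a \<Rightarrow> 'o \<Rightarrow> real"
    and \<xi> :: "'a \<Rightarrow> 'o \<Rightarrow> 'h :: {real_inner, banach, second_countable_topology}"
  assumes countable_index: "countable A"
    and weight_measurable: "\<And>\<alpha>. \<alpha> \<in> A \<Longrightarrow> random_variable borel (w \<alpha>)"
    and point_measurable: "\<And>\<alpha>. \<alpha> \<in> A \<Longrightarrow> random_variable borel (\<xi> \<alpha>)"
    and point_in_ball: "\<And>\<alpha> \<omega>. \<alpha> \<in> A \<Longrightarrow> \<omega> \<in> space M \<Longrightarrow> \<xi> \<alpha> \<omega> \<in> cball 0 1"
    and weight_nonneg: "\<And>\<alpha> \<omega>. \<alpha> \<in> A \<Longrightarrow> \<omega> \<in> space M \<Longrightarrow> 0 \<le> w \<alpha> \<omega>"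
    and weight_total: "\<And>\<omega>. \<omega> \<in> space M \<Longrightarrow> ((\<lambda>\<alpha>. w \<alpha> \<omega>) has_sum 1) A"
    and atoms_distinct: "AE \<omega> in M. inj_on (\<lambda>\<alpha>. \<xi> \<alpha> \<omega>) {\<alpha> \<in> A. 0 < w \<alpha> \<omega>}"

text \<open>An \<open>n\<close>-tuple of configurations is an extensional function on \<open>{1..n}\<close>. The averages and
  overlaps below are taken for one realisation of the weights and points.\<close>

definition config_avg :: "'a set \<Rightarrow> ('a \<Rightarrow> real) \<Rightarrow> nat \<Rightarrow> ((nat \<Rightarrow> 'a) \<Rightarrow> real) \<Rightarrow> real" where
  "config_avg A v n g = (\<Sum>\<^sub>\<infinity>\<sigma>\<in>{1..n} \<rightarrow>\<^sub>E A. (\<Prod>i\<in>{1..n}. v (\<sigma> i)) * g \<sigma>)"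

definition overlap :: "('a \<Rightarrow> 'h :: real_inner) \<Rightarrow> (nat \<Rightarrow> 'a) \<Rightarrow> nat \<Rightarrow> nat \<Rightarrow> real" where
  "overlap x \<sigma> l l' = x (\<sigma> l) \<bullet> x (\<sigma> l')"

definition overlap_array ::
  "nat \<Rightarrow> ('a \<Rightarrow> 'h :: real_inner) \<Rightarrow> (nat \<Rightarrow> 'a) \<Rightarrow> nat \<times> nat \<Rightarrow> real" where
  "overlap_array n x \<sigma> = restrict (\<lambda>(l, l'). overlap x \<sigma> l l') ({1..n} \<times> {1..n})"

abbreviation overlap_space :: "nat \<Rightarrow> (nat \<times> nat \<Rightarrow> real) measure" where
  "overlap_space n \<equiv> PiM ({1..n} \<times> {1..n}) (\<lambda>_. borel)"

definition bounded_measurable_overlap_fun :: "nat \<Rightarrow> ((nat \<times> nat \<Rightarrow> real) \<Rightarrow> real) \<Rightarrow> bool" where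
  "bounded_measurable_overlap_fun n F \<longleftrightarrow>
     F \<in> borel_measurable (overlap_space n) \<and> bounded (F ` space (overlap_space n))"

definition ghirlanda_guerra ::
  "'o measure \<Rightarrow> 'a set \<Rightarrow> ('a \<Rightarrow> 'o \<Rightarrow> real) \<Rightarrow> ('a \<Rightarrow> 'o \<Rightarrow> 'h :: real_inner) \<Rightarrow> bool" where
  "ghirlanda_guerra M A w \<xi> \<longleftrightarrow>
    (\<forall>n F p. 2 \<le> n \<longrightarrow> bounded_measurable_overlap_fun n F \<longrightarrow> 1 \<le> p \<longrightarrow>
      (let x = (\<lambda>\<omega> \<alpha>. \<xi> \<alpha> \<omega>);
           E = (\<lambda>k g. \<integral>\<omega>. config_avg A (\<lambda>\<alpha>. w \<alpha> \<omega>) k (g \<omega>) \<partial>M);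
           f = (\<lambda>\<omega> \<sigma>. F (overlap_array n (x \<omega>) \<sigma>))
       in E (n + 1) (\<lambda>\<omega> \<sigma>. f \<omega> \<sigma> * overlap (x \<omega>) \<sigma> 1 (n + 1) ^ p) =
            1 / real n * E n f * E 2 (\<lambda>\<omega> \<sigma>. overlap (x \<omega>) \<sigma> 1 2 ^ p)
            + 1 / real n * (\<Sum>l = 2..n. E n (\<lambda>\<omega> \<sigma>. f \<omega> \<sigma> * overlap (x \<omega>) \<sigma> 1 l ^ p))))"

definition tilted_weight ::
  "'a set \<Rightarrow> ('a \<Rightarrow> 'o \<Rightarrow> real) \<Rightarrow> ('a \<Rightarrow> 'o \<Rightarrow> real) \<Rightarrow> real \<Rightarrow> 'a \<Rightarrow> 'o \<Rightarrow> real" where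
  "tilted_weight A w \<epsilon> t \<alpha> \<omega> =
     w \<alpha> \<omega> * exp (t * \<epsilon> \<alpha> \<omega>) / (\<Sum>\<^sub>\<infinity>\<gamma>\<in>A. w \<gamma> \<omega> * exp (t * \<epsilon> \<gamma> \<omega>))"

end

theory Submission
  imports Defs
begin

text \<open>Put \<open>x = tanh t\<close> and \<open>X = \<Sum>\<^sub>\<alpha> w\<^sub>\<alpha> \<epsilon>\<^sub>\<alpha>\<close>. As \<open>exp (t \<epsilon>) = cosh t (1 + x \<epsilon>)\<close> for \<open>\<epsilon> = \<plusminus>1\<close>, the tilted weights are
  \<open>w\<^sub>\<alpha> (1 + x \<epsilon>\<^sub>\<alpha>) / (1 + x X)\<close>, and \<open>\<bar>x X\<bar> < 1\<close>. Expanding \<open>(1 + x X)\<close> to the power \<open>-n\<close> binomially, with \<open>k\<close> extra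
  replicas for the power \<open>X\<^sup>k\<close>, writes the tilted average of \<open>f\<close> as a power series in \<open>x\<close> whose coefficients
  are combinations of averages of \<open>f\<close> times products of signs over sets \<open>J\<close> of replicas. Averaging the
  signs out leaves \<open>f\<close> on the event that no configuration occurs an odd number of times in \<open>J\<close>.

  The Ghirlanda-Guerra identities make \<open>R\<^sub>1\<^sub>,\<^sub>1\<close> independent of \<open>R\<^sub>1\<^sub>,\<^sub>2\<close>, which forces the self-overlap
  to be a constant \<open>q\<close>; hence two replicas coincide exactly when their overlap is \<open>q\<close>, and the identities for the
  indicator of \<open>q\<close> give the conditional probability that a new replica repeats an old one. Let \<open>C\<^sub>m(s)\<close> be
  the \<open>m\<close>-th coefficient of the series with the event replaced by "exactly \<open>s\<close> configurations occur an odd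
  number of times". Adding one replica at a time yields \<open>m C\<^sub>m = (m - 2) C\<^sub>m\<^sub>-\<^sub>2 - L C\<^sub>m\<^sub>-\<^sub>1\<close> with
  a linear operator \<open>L\<close> that kills \<open>C\<^sub>0\<close>, because \<open>C\<^sub>0\<close> is supported at \<open>s = 0\<close>. So \<open>C\<^sub>m = 0\<close> for all \<open>m \<ge> 1\<close>.\<close>

section \<open>Averages over replicas\<close>

text \<open>The event s = 0 that the signs leave behind does not satisfy a closed recursion: one
  more replica changes the parity of one configuration and moves s to s - 1 or s + 1, so all s are
  carried along. By the identities a new replica repeats the j-th one as if it were chosen uniformly
  among the N present replicas, up to a correction proportional to 1 - c, where c is the probability
  that two replicas coincide. Summed over the configurations of odd multiplicity, this correction
  acquires the factors s - 1 and s + 1; it is the operator L, and at the only nonzero entry of C_0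
  its factor is 0. The extra replicas are weighted by the coefficients of the power -n, whose
  consecutive ratio is -(n + k)/(k + 1), and n + k is exactly the number N of replicas present when
  the next one is added. For this reason m C_m, with m written as k plus the size of the chosen
  subset of the first n replicas, simplifies: the terms that enlarge the subset cancel, and those
  that shrink it or remove an extra replica combine to a multiple of the coefficient two orders
  below.\<close>

abbreviation overlap_fun :: "nat \<Rightarrow> ((nat \<times> nat \<Rightarrow> real) \<Rightarrow> real) \<Rightarrow> bool" where
  "overlap_fun \<equiv> bounded_measurable_overlap_fun"

abbreviation abs_summable :: "('a \<Rightarrow> real) \<Rightarrow> 'a set \<Rightarrow> bool" where
  "abs_summable \<equiv> Infinite_Set_Sum.abs_summable_on"

abbreviation tuples :: "'a set \<Rightarrow> nat \<Rightarrow> (nat \<Rightarrow> 'a) set" where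
  "tuples A K \<equiv> {1..K} \<rightarrow>\<^sub>E A"

definition weight_pmf :: "'a set \<Rightarrow> ('a \<Rightarrow> real) \<Rightarrow> 'a pmf" where
  "weight_pmf A v = embed_pmf (\<lambda>a. if a \<in> A then v a else 0)"

lemma pmf_weight_pmf:
  assumes nn: "\<And>a. a \<in> A \<Longrightarrow> 0 \<le> v a" and sm: "(v has_sum 1) A"
  shows "pmf (weight_pmf A v) a = (if a \<in> A then v a else 0)"
  unfolding weight_pmf_def
proof (rule pmf_embed_pmf)
  show "0 \<le> (if x \<in> A then v x else 0)" for x using nn by simp
  have "v summable_on A" using sm by (rule has_sum_imp_summable)
  moreover have "(\<lambda>a. norm (v a)) summable_on A \<longleftrightarrow> v summable_on A"
    by (rule summable_on_cong) (use nn in auto)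
  ultimately have "(\<lambda>a. norm (v a)) summable_on A" by simp
  then have abs: "abs_summable v A"
    using abs_summable_equivalent[of v A] by simp
  have "(\<integral>\<^sup>+x. ennreal (if x \<in> A then v x else 0) \<partial>count_space UNIV) = (\<integral>\<^sup>+x. ennreal (v x) \<partial>count_space A)"
    by (subst nn_integral_count_space_indicator[of A]) (auto intro!: nn_integral_cong simp: indicator_def)
  also have "\<dots> = ennreal (infsetsum v A)"
    using abs nn by (rule nn_integral_conv_infsetsum)
  also have "infsetsum v A = 1"
    using infsetsum_infsum[OF abs] sm by (simp add: infsumI)
  finally show "(\<integral>\<^sup>+x. ennreal (if x \<in> A then v x else 0) \<partial>count_space UNIV) = 1" by simp
qed

text \<open>The default \<open>undefined\<close> makes the samples extensional on
  \<open>{1..K}\<close>, the form that \<open>config_avg\<close> sums over; replicas become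
  independent draws from one mass function.\<close>

definition config_pmf :: "'a set \<Rightarrow> ('a \<Rightarrow> real) \<Rightarrow> nat \<Rightarrow> (nat \<Rightarrow> 'a) pmf" where
  "config_pmf A v K = Pi_pmf {1..K} undefined (\<lambda>_. weight_pmf A v)"

text \<open>Off the tuples the mass vanishes for one of two reasons: an entry outside
  \<open>A\<close> has weight zero, or a value outside \<open>{1..K}\<close> differs from the
  default.\<close>

lemma pmf_config_pmf:
  fixes v :: "'a \<Rightarrow> real" and K :: nat
  assumes "\<And>a. a \<in> A \<Longrightarrow> 0 \<le> v a" and "(v has_sum 1) A"
  shows "pmf (config_pmf A v K) r = (if r \<in> tuples A K then \<Prod>i\<in>{1..K}. v (r i) else 0)"
proof (cases "r \<in> tuples A K")
  case True
  have "pmf (config_pmf A v K) r = (\<Prod>i\<in>{1..K}. pmf (weight_pmf A v) (r i))"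
    unfolding config_pmf_def using True by (intro pmf_Pi') auto
  also have "\<dots> = (\<Prod>i\<in>{1..K}. v (r i))"
    using True by (intro prod.cong) (auto simp: pmf_weight_pmf[OF assms])
  finally show ?thesis using True by simp
next
  case False
  show ?thesis
  proof (cases "\<forall>x. x \<notin> {1..K} \<longrightarrow> r x = undefined")
    case True
    then obtain i where "i \<in> {1..K}" "r i \<notin> A" using False by (auto simp: PiE_iff extensional_def)
    then have "(\<Prod>i\<in>{1..K}. pmf (weight_pmf A v) (r i)) = 0"
      by (intro prod_zero) (auto simp: pmf_weight_pmf[OF assms])
    then show ?thesis using False True unfolding config_pmf_def by (subst pmf_Pi) auto
  next
    case F2: False
    then have "pmf (config_pmf A v K) r = 0"
      unfolding config_pmf_def by (intro pmf_Pi_outside) auto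
    then show ?thesis using False by (simp only: if_False)
  qed
qed

lemma config_avg_summable:
  fixes v :: "'a \<Rightarrow> real" and K :: nat
  assumes "\<And>a. a \<in> A \<Longrightarrow> 0 \<le> v a" and "(v has_sum 1) A"
    and "\<And>r. r \<in> tuples A K \<Longrightarrow> \<bar>g r\<bar> \<le> B"
  shows "abs_summable (\<lambda>r. (\<Prod>i\<in>{1..K}. v (r i)) * g r) (tuples A K)"
proof (rule abs_summable_on_comparison_test)
  show "abs_summable (\<lambda>r. B * pmf (config_pmf A v K) r) (tuples A K)"
    by (intro abs_summable_on_cmult_right pmf_abs_summable)
  fix r assume s: "r \<in> tuples A K"
  have "norm ((\<Prod>i\<in>{1..K}. v (r i)) * g r) = pmf (config_pmf A v K) r * \<bar>g r\<bar>"
  proof -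
    have "pmf (config_pmf A v K) r = (\<Prod>i\<in>{1..K}. v (r i))"
      using s by (simp add: pmf_config_pmf[OF assms(1,2)])
    moreover have "0 \<le> (\<Prod>i\<in>{1..K}. v (r i))"
      by (rule prod_nonneg) (use s assms(1) in \<open>auto simp: PiE_iff\<close>)
    ultimately show ?thesis by (simp add: abs_mult)
  qed
  also have "\<dots> \<le> pmf (config_pmf A v K) r * B"
    by (intro mult_left_mono assms(3) s) simp
  also have "\<dots> \<le> norm (B * pmf (config_pmf A v K) r)" by (simp add: mult.commute)
  finally show "norm ((\<Prod>i\<in>{1..K}. v (r i)) * g r) \<le> norm (B * pmf (config_pmf A v K) r)" .
qed

lemma config_avg_eq_integral_count_space:
  fixes v :: "'a \<Rightarrow> real" and K :: nat
  assumes "\<And>a. a \<in> A \<Longrightarrow> 0 \<le> v a" and "(v has_sum 1) A"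
    and "\<And>r. r \<in> tuples A K \<Longrightarrow> \<bar>g r\<bar> \<le> B"
  shows "config_avg A v K g = (\<integral>r. (\<Prod>i\<in>{1..K}. v (r i)) * g r \<partial>count_space (tuples A K))"
  unfolding config_avg_def infsetsum_def[symmetric]
  by (rule infsetsum_infsum[OF config_avg_summable[OF assms], symmetric])

text \<open>Boundedness of \<open>g\<close> makes the sum absolutely convergent; as an expectation
  it inherits marginals, linearity and norm bounds.\<close>

lemma config_avg_eq_expectation:
  fixes v :: "'a \<Rightarrow> real" and K :: nat
  assumes "\<And>a. a \<in> A \<Longrightarrow> 0 \<le> v a" and "(v has_sum 1) A"
    and "\<And>r. r \<in> tuples A K \<Longrightarrow> \<bar>g r\<bar> \<le> B"
  shows "config_avg A v K g = measure_pmf.expectation (config_pmf A v K) g"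
proof -
  have "measure_pmf.expectation (config_pmf A v K) g = infsetsum (\<lambda>r. pmf (config_pmf A v K) r * g r) UNIV"
    by (rule pmf_expectation_eq_infsetsum)
  also have "\<dots> = infsetsum (\<lambda>r. (\<Prod>i\<in>{1..K}. v (r i)) * g r) (tuples A K)"
    by (rule infsetsum_cong_neutral) (auto simp: pmf_config_pmf[OF assms(1,2)])
  also have "\<dots> = config_avg A v K g"
    unfolding config_avg_def by (rule infsetsum_infsum[OF config_avg_summable[OF assms]])
  finally show ?thesis by simp
qed

lemma set_config_pmf:
  fixes v :: "'a \<Rightarrow> real" and K :: nat
  assumes "\<And>a. a \<in> A \<Longrightarrow> 0 \<le> v a" and "(v has_sum 1) A"
  shows "set_pmf (config_pmf A v K) \<subseteq> tuples A K"
  by (auto simp: set_pmf_eq pmf_config_pmf[OF assms] split: if_splits)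

section \<open>Relabelling and forgetting replicas\<close>

definition reindex :: "(nat \<Rightarrow> nat) \<Rightarrow> nat \<Rightarrow> (nat \<Rightarrow> 'a) \<Rightarrow> nat \<Rightarrow> 'a" where
  "reindex \<pi> K r = restrict (\<lambda>i. r (\<pi> i)) {1..K}"

lemma reindex_apply [simp]: "i \<in> {1..K} \<Longrightarrow> reindex \<pi> K r i = r (\<pi> i)"
  by (simp add: reindex_def)

lemma reindex_in: "r \<in> tuples A L \<Longrightarrow> \<pi> ` {1..K} \<subseteq> {1..L} \<Longrightarrow> reindex \<pi> K r \<in> tuples A K"
  unfolding reindex_def by (auto simp: PiE_iff image_subset_iff)

text \<open>Distinct coordinates of an independent identically distributed family form such a family
  again.\<close>

lemma config_pmf_reindex:
  assumes "inj_on \<pi> {1..K}" "\<pi> ` {1..K} \<subseteq> {1..L}"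
  shows "map_pmf (reindex \<pi> K) (config_pmf A v L) = config_pmf A v K"
proof -
  \<comment> \<open>Indices outside \<open>{1..K}\<close> go to \<open>Suc L\<close>, which is not
    in the image of \<open>\<pi>\<close>, so composing with \<open>h\<close> reads off the default
    value there.\<close>
  define h where "h i = (if i \<in> {1..K} then \<pi> i else Suc L)" for i
  have bij: "bij_betw h {1..K} (\<pi> ` {1..K})"
    by (rule bij_betw_cong[THEN iffD1, OF _ inj_on_imp_bij_betw[OF assms(1)]]) (simp add: h_def)
  have "config_pmf A v K = map_pmf (\<lambda>g. g \<circ> h) (Pi_pmf (\<pi> ` {1..K}) undefined (\<lambda>_. weight_pmf A v))"
    unfolding config_pmf_def
  proof (rule Pi_pmf_bij_betw[OF _ bij])
    show "h x \<notin> \<pi> ` {1..K}" if "x \<notin> {1..K}" for x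
    proof -
      have "h x = Suc L" using that unfolding h_def by (simp only: if_False)
      moreover have "Suc L \<notin> \<pi> ` {1..K}" using assms(2) by (meson atLeastAtMost_iff not_less_eq_eq order_refl subset_iff)
      ultimately show ?thesis by simp
    qed
  qed simp
  also have "Pi_pmf (\<pi> ` {1..K}) undefined (\<lambda>_. weight_pmf A v) =
     map_pmf (\<lambda>f x. if x \<in> \<pi> ` {1..K} then f x else undefined) (config_pmf A v L)"
    unfolding config_pmf_def by (rule Pi_pmf_subset) (use assms in auto)
  also have "map_pmf (\<lambda>g. g \<circ> h) \<dots> = map_pmf (reindex \<pi> K) (config_pmf A v L)"
    unfolding map_pmf_comp
    by (rule map_pmf_cong[OF refl]) (use assms in \<open>auto simp: h_def reindex_def fun_eq_iff\<close>)
  finally show ?thesis by simp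
qed

lemma config_avg_reindex:
  assumes v: "\<And>a. a \<in> A \<Longrightarrow> 0 \<le> v a" "(v has_sum 1) A"
    and B: "\<And>r. r \<in> tuples A K \<Longrightarrow> \<bar>g r\<bar> \<le> B"
    and pi: "inj_on \<pi> {1..K}" "\<pi> ` {1..K} \<subseteq> {1..L}"
  shows "config_avg A v L (\<lambda>r. g (reindex \<pi> K r)) = config_avg A v K g"
proof -
  have "config_avg A v L (\<lambda>r. g (reindex \<pi> K r)) = measure_pmf.expectation (config_pmf A v L) (\<lambda>r. g (reindex \<pi> K r))"
    by (rule config_avg_eq_expectation[OF v, where B=B], assumption, rule B, erule reindex_in, rule pi(2))
  also have "\<dots> = measure_pmf.expectation (map_pmf (reindex \<pi> K) (config_pmf A v L)) g" by simp
  also have "\<dots> = config_avg A v K g"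
    unfolding config_pmf_reindex[OF pi] by (rule config_avg_eq_expectation[OF v B, symmetric])
  finally show ?thesis .
qed

declare One_nat_def [simp del]

section \<open>The joint law of the random measure and its replicas\<close>

context discrete_random_measure begin

abbreviation configs :: "nat \<Rightarrow> (nat \<Rightarrow> 'a) set" where
  "configs K \<equiv> tuples A K"

abbreviation weights :: "nat \<Rightarrow> (nat \<Rightarrow> 'a) \<Rightarrow> 'o \<Rightarrow> real" where
  "weights K r \<omega> \<equiv> \<Prod>i\<in>{1..K}. w (r i) \<omega>"

text \<open>Tuples with a vanishing weight are null for the replica measure, and the distinctness of
  points is only available at positive weight; almost sure statements are therefore restricted to
  tuples of positive weight.\<close>

abbreviation AE_config :: "nat \<Rightarrow> ('o \<Rightarrow> (nat \<Rightarrow> 'a) \<Rightarrow> bool) \<Rightarrow> bool" where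
  "AE_config K P \<equiv> AE \<omega> in M. \<forall>r\<in>configs K. (\<forall>i\<in>{1..K}. 0 < w (r i) \<omega>) \<longrightarrow> P \<omega> r"

abbreviation gibbs :: "'o \<Rightarrow> nat \<Rightarrow> ((nat \<Rightarrow> 'a) \<Rightarrow> real) \<Rightarrow> real" where
  "gibbs \<omega> \<equiv> config_avg A (\<lambda>\<alpha>. w \<alpha> \<omega>)"

abbreviation base :: "nat \<Rightarrow> ('o \<times> (nat \<Rightarrow> 'a)) measure" where
  "base K \<equiv> M \<Otimes>\<^sub>M count_space (configs K)"

abbreviation self :: "'a \<Rightarrow> 'o \<Rightarrow> real" where
  "self \<alpha> \<omega> \<equiv> \<xi> \<alpha> \<omega> \<bullet> \<xi> \<alpha> \<omega>"

abbreviation AE_atom :: "('a \<Rightarrow> 'o \<Rightarrow> bool) \<Rightarrow> bool" where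
  "AE_atom P \<equiv> AE \<omega> in M. \<forall>\<alpha>\<in>A. 0 < w \<alpha> \<omega> \<longrightarrow> P \<alpha> \<omega>"

text \<open>The law of the random measure together with K replicas drawn from it, so that the nested
  average E<g> becomes a single integral.\<close>

definition replicas :: "nat \<Rightarrow> ('o \<times> (nat \<Rightarrow> 'a)) measure" where
  "replicas K = density (base K) (\<lambda>z. ennreal (weights K (snd z) (fst z)))"

text \<open>Measurability is asked for each fixed tuple only: there are countably many tuples, so
  joint measurability follows.\<close>

definition observable :: "nat \<Rightarrow> ('o \<Rightarrow> (nat \<Rightarrow> 'a) \<Rightarrow> real) \<Rightarrow> bool" where
  "observable K g \<longleftrightarrow> (\<forall>r\<in>configs K. (\<lambda>\<omega>. g \<omega> r) \<in> borel_measurable M) \<and>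
     (\<exists>B. \<forall>\<omega>\<in>space M. \<forall>r\<in>configs K. \<bar>g \<omega> r\<bar> \<le> B)"

definition EE :: "nat \<Rightarrow> ('o \<Rightarrow> (nat \<Rightarrow> 'a) \<Rightarrow> real) \<Rightarrow> real" where
  "EE K g = (\<integral>z. g (fst z) (snd z) \<partial>replicas K)"

lemma countable_configs: "countable (configs K)"
  by (intro countable_PiE countable_index) auto

sublocale pair: pair_sigma_finite M "count_space (configs K)" for K
  by (intro pair_sigma_finite.intro sigma_finite_measure_count_space_countable countable_configs
      sigma_finite_measure_axioms)

lemma weight_prod_measurable:
  "r \<in> configs K \<Longrightarrow> (\<lambda>\<omega>. weights K r \<omega>) \<in> borel_measurable M"
  by (intro borel_measurable_prod weight_measurable) (auto simp: PiE_iff)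

lemma weight_prod_nonneg:
  "\<omega> \<in> space M \<Longrightarrow> r \<in> configs K \<Longrightarrow> 0 \<le> weights K r \<omega>"
  by (intro prod_nonneg weight_nonneg) (auto simp: PiE_iff)

lemma measurable_pair_count:
  assumes "\<And>r. r \<in> configs K \<Longrightarrow> (\<lambda>\<omega>. g \<omega> r) \<in> measurable M N"
  shows "(\<lambda>z. g (fst z) (snd z)) \<in> measurable (base K) N"
  by (rule measurable_compose_countable'[where f="\<lambda>r z. g (fst z) r" and g=snd and I="configs K"])
     (use assms countable_configs in \<open>auto intro: measurable_compose[OF measurable_fst]\<close>)

lemma sets_replicas [simp, measurable_cong]:
  "sets (replicas K) = sets (base K)"
  by (simp add: replicas_def)

lemma space_replicas [simp]: "space (replicas K) = space M \<times> configs K"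
  by (simp add: replicas_def space_pair_measure)

lemma weight_prod_measurable_pair:
  "(\<lambda>z. weights K (snd z) (fst z)) \<in> borel_measurable (base K)"
  by (rule measurable_pair_count[where g="\<lambda>\<omega> r. \<Prod>i\<in>{1..K}. w (r i) \<omega>"]) (rule weight_prod_measurable)

lemma prob_space_replicas: "prob_space (replicas K)"
proof
  have "emeasure (replicas K) (space (replicas K)) =
      (\<integral>\<^sup>+z. ennreal (weights K (snd z) (fst z)) \<partial>(base K))"
    unfolding replicas_def using weight_prod_measurable_pair
    by (subst emeasure_density) (auto intro!: nn_integral_cong simp: space_pair_measure indicator_def)
  also have "\<dots> = (\<integral>\<^sup>+\<omega>. (\<integral>\<^sup>+r. ennreal (weights K r \<omega>) \<partial>count_space (configs K)) \<partial>M)"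
    using weight_prod_measurable_pair by (subst pair.M2.nn_integral_fst[symmetric]) auto
  also have "\<dots> = (\<integral>\<^sup>+\<omega>. 1 \<partial>M)"
  proof (rule nn_integral_cong)
    fix \<omega> assume o: "\<omega> \<in> space M"
    let ?v = "\<lambda>\<alpha>. w \<alpha> \<omega>"
    have v: "\<And>a. a \<in> A \<Longrightarrow> 0 \<le> ?v a" "(?v has_sum 1) A"
      using weight_nonneg weight_total o by auto
    have "(\<integral>\<^sup>+r. ennreal (weights K r \<omega>) \<partial>count_space (configs K)) =
      (\<integral>\<^sup>+r. ennreal (pmf (config_pmf A ?v K) r) \<partial>count_space (configs K))"
      by (rule nn_integral_cong) (simp add: pmf_config_pmf[OF v])
    also have "\<dots> = emeasure (measure_pmf (config_pmf A ?v K)) (configs K)" by (rule nn_integral_pmf)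
    also have "\<dots> = 1"
      using set_config_pmf[OF v, of K] by (subst measure_pmf.emeasure_eq_1_AE) (auto simp: AE_measure_pmf_iff)
    finally show "(\<integral>\<^sup>+r. ennreal (weights K r \<omega>) \<partial>count_space (configs K)) = 1" .
  qed
  also have "\<dots> = 1" by (simp add: emeasure_space_1)
  finally show "emeasure (replicas K) (space (replicas K)) = 1" .
qed

sublocale rep: prob_space "replicas K" for K by (rule prob_space_replicas)

lemma measurable_replicas:
  assumes "observable K g"
  shows "(\<lambda>z. g (fst z) (snd z)) \<in> borel_measurable (replicas K)"
  using measurable_pair_count[of K g borel] assms
  by (auto simp: observable_def cong: measurable_cong_sets)

lemma measurable_observable:
  assumes "observable K g"
  shows "(\<lambda>z. g (fst z) (snd z)) \<in> borel_measurable (base K)"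
  using measurable_replicas[OF assms] by (simp cong: measurable_cong_sets)

lemma integrable_replicas:
  assumes "observable K g"
  shows "integrable (replicas K) (\<lambda>z. g (fst z) (snd z))"
proof -
  obtain B where "\<forall>\<omega>\<in>space M. \<forall>r\<in>configs K. \<bar>g \<omega> r\<bar> \<le> B"
    using assms by (auto simp: observable_def)
  then show ?thesis
    by (intro rep.integrable_const_bound[where B=B] AE_I2 measurable_replicas assms) auto
qed

lemma integrable_weighted:
  assumes "observable K g"
  shows "integrable (base K)
    (\<lambda>z. weights K (snd z) (fst z) * g (fst z) (snd z))"
proof -
  have "integrable (density (base K) (\<lambda>z. ennreal (weights K (snd z) (fst z)))) (\<lambda>z. g (fst z) (snd z))"
    using integrable_replicas[OF assms] by (simp add: replicas_def)
  then show ?thesis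
    using measurable_observable[OF assms] weight_prod_measurable_pair weight_prod_nonneg
    by (subst (asm) integrable_density) (auto intro!: AE_I2 simp: space_pair_measure)
qed

lemma EE_weighted:
  assumes "observable K g"
  shows "EE K g = (\<integral>z. weights K (snd z) (fst z) * g (fst z) (snd z) \<partial>(base K))"
  unfolding EE_def replicas_def
  using measurable_observable[OF assms] weight_prod_measurable_pair weight_prod_nonneg
  by (subst integral_density) (auto intro!: AE_I2 simp: space_pair_measure)

lemma EE_eq_config_avg:
  assumes g: "observable K g"
  shows "EE K g = (\<integral>\<omega>. gibbs \<omega> K (g \<omega>) \<partial>M)"
proof -
  obtain B where B: "\<And>\<omega> r. \<omega> \<in> space M \<Longrightarrow> r \<in> configs K \<Longrightarrow> \<bar>g \<omega> r\<bar> \<le> B"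
    using g unfolding observable_def by meson
  have "EE K g = (\<integral>\<omega>. (\<integral>r. weights K r \<omega> * g \<omega> r \<partial>count_space (configs K)) \<partial>M)"
    unfolding EE_weighted[OF g] using pair.integral_fst'[OF integrable_weighted[OF g]] by simp
  also have "\<dots> = (\<integral>\<omega>. gibbs \<omega> K (g \<omega>) \<partial>M)"
    by (intro Bochner_Integration.integral_cong refl config_avg_eq_integral_count_space[symmetric, where B=B])
       (use weight_nonneg weight_total B in auto)
  finally show ?thesis .
qed

lemma config_avg_measurable:
  assumes g: "observable K g"
  shows "(\<lambda>\<omega>. gibbs \<omega> K (g \<omega>)) \<in> borel_measurable M"
proof -
  obtain B where B: "\<And>\<omega> r. \<omega> \<in> space M \<Longrightarrow> r \<in> configs K \<Longrightarrow> \<bar>g \<omega> r\<bar> \<le> B"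
    using g unfolding observable_def by meson
  have "(\<lambda>\<omega>. (\<integral>r. weights K r \<omega> * g \<omega> r \<partial>count_space (configs K))) \<in> borel_measurable M"
    using pair.integrable_fst'[OF integrable_weighted[OF g]] by (simp add: borel_measurable_integrable)
  moreover have "gibbs \<omega> K (g \<omega>) = (\<integral>r. weights K r \<omega> * g \<omega> r \<partial>count_space (configs K))"
    if "\<omega> \<in> space M" for \<omega>
    by (rule config_avg_eq_integral_count_space[where B=B]) (use that weight_nonneg weight_total B in auto)
  ultimately show ?thesis by (simp cong: measurable_cong)
qed

lemma EE_swap:
  assumes g: "observable K g"
  shows "EE K g = (\<integral>r. (\<integral>\<omega>. weights K r \<omega> * g \<omega> r \<partial>M) \<partial>count_space (configs K))"
  unfolding EE_weighted[OF g]
  using pair.integral_snd[of K "\<lambda>\<omega> r. weights K r \<omega> * g \<omega> r"] integrable_weighted[OF g]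
  by (simp add: case_prod_beta')

lemma observable_reindex:
  assumes g: "observable K g" and pi: "\<pi> ` {1..K} \<subseteq> {1..L}"
  shows "observable L (\<lambda>\<omega> r. g \<omega> (reindex \<pi> K r))"
proof -
  obtain B where B: "\<And>\<omega> r. \<omega> \<in> space M \<Longrightarrow> r \<in> configs K \<Longrightarrow> \<bar>g \<omega> r\<bar> \<le> B"
    using g unfolding observable_def by meson
  have "\<bar>g \<omega> (reindex \<pi> K r)\<bar> \<le> B" if "\<omega> \<in> space M" "r \<in> configs L" for \<omega> r
    by (rule B[OF that(1) reindex_in[OF that(2) pi]])
  moreover have "(\<lambda>\<omega>. g \<omega> (reindex \<pi> K r)) \<in> borel_measurable M" if "r \<in> configs L" for r
    using g reindex_in[OF that pi] by (simp add: observable_def)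
  ultimately show ?thesis unfolding observable_def by meson
qed

text \<open>Replicas are exchangeable and consistent: neither permuting them nor drawing more of
  them than \<open>g\<close> uses changes the mean. Every relabelling of replicas below rests on
  this.\<close>

lemma EE_reindex:
  assumes g: "observable K g" and pi: "inj_on \<pi> {1..K}" "\<pi> ` {1..K} \<subseteq> {1..L}"
  shows "EE L (\<lambda>\<omega> r. g \<omega> (reindex \<pi> K r)) = EE K g"
proof -
  obtain B where B: "\<And>\<omega> r. \<omega> \<in> space M \<Longrightarrow> r \<in> configs K \<Longrightarrow> \<bar>g \<omega> r\<bar> \<le> B"
    using g unfolding observable_def by meson
  note gL = observable_reindex[OF g pi(2)]
  have "gibbs \<omega> L (\<lambda>r. g \<omega> (reindex \<pi> K r)) = gibbs \<omega> K (g \<omega>)"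
    if "\<omega> \<in> space M" for \<omega>
    by (rule config_avg_reindex[where B=B, OF _ _ _ pi]) (use that weight_nonneg weight_total B in auto)
  then show ?thesis
    unfolding EE_eq_config_avg[OF g] EE_eq_config_avg[OF gL]
    by (intro Bochner_Integration.integral_cong refl) simp
qed

lemma observable_const [simp]: "observable K (\<lambda>\<omega> r. c)"
  unfolding observable_def by auto

lemma observable_add:
  assumes f: "observable K f" and g: "observable K g"
  shows "observable K (\<lambda>\<omega> r. f \<omega> r + g \<omega> r)"
  unfolding observable_def
proof (intro conjI ballI)
  show "(\<lambda>\<omega>. f \<omega> r + g \<omega> r) \<in> borel_measurable M" if "r \<in> configs K" for r
    using f g that by (intro borel_measurable_add) (simp_all add: observable_def)
  obtain B1 where B1: "\<And>\<omega> r. \<omega> \<in> space M \<Longrightarrow> r \<in> configs K \<Longrightarrow> \<bar>f \<omega> r\<bar> \<le> B1"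
    using f unfolding observable_def by meson
  obtain B2 where B2: "\<And>\<omega> r. \<omega> \<in> space M \<Longrightarrow> r \<in> configs K \<Longrightarrow> \<bar>g \<omega> r\<bar> \<le> B2"
    using g unfolding observable_def by meson
  show "\<exists>B. \<forall>\<omega>\<in>space M. \<forall>r\<in>configs K. \<bar>f \<omega> r + g \<omega> r\<bar> \<le> B"
    by (rule exI[of _ "B1 + B2"]) (intro ballI order_trans[OF abs_triangle_ineq] add_mono B1 B2)
qed

lemma observable_mult:
  assumes f: "observable K f" and g: "observable K g"
  shows "observable K (\<lambda>\<omega> r. f \<omega> r * g \<omega> r)"
  unfolding observable_def
proof (intro conjI ballI)
  show "(\<lambda>\<omega>. f \<omega> r * g \<omega> r) \<in> borel_measurable M" if "r \<in> configs K" for r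
    using f g that by (intro borel_measurable_times) (simp_all add: observable_def)
  obtain B1 where B1: "\<And>\<omega> r. \<omega> \<in> space M \<Longrightarrow> r \<in> configs K \<Longrightarrow> \<bar>f \<omega> r\<bar> \<le> B1"
    using f unfolding observable_def by meson
  obtain B2 where B2: "\<And>\<omega> r. \<omega> \<in> space M \<Longrightarrow> r \<in> configs K \<Longrightarrow> \<bar>g \<omega> r\<bar> \<le> B2"
    using g unfolding observable_def by meson
  have "\<bar>f \<omega> r * g \<omega> r\<bar> \<le> \<bar>B1\<bar> * \<bar>B2\<bar>" if "\<omega> \<in> space M" "r \<in> configs K" for \<omega> r
    unfolding abs_mult using B1[OF that] B2[OF that] by (intro mult_mono) auto
  then show "\<exists>B. \<forall>\<omega>\<in>space M. \<forall>r\<in>configs K. \<bar>f \<omega> r * g \<omega> r\<bar> \<le> B" by meson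
qed

lemma observable_sum:
  assumes "\<And>i. i \<in> I \<Longrightarrow> observable K (f i)"
  shows "observable K (\<lambda>\<omega> r. \<Sum>i\<in>I. f i \<omega> r)"
  using assms by (induction I rule: infinite_finite_induct) (auto intro: observable_add)

lemma observable_power:
  assumes "observable K f"
  shows "observable K (\<lambda>\<omega> r. f \<omega> r ^ p)"
  using assms by (induction p) (auto intro: observable_mult)

lemma EE_const [simp]: "EE K (\<lambda>\<omega> r. c) = c"
  unfolding EE_def by (simp add: rep.prob_space[simplified])

lemma EE_add:
  assumes "observable K f" "observable K g"
  shows "EE K (\<lambda>\<omega> r. f \<omega> r + g \<omega> r) = EE K f + EE K g"
  unfolding EE_def using assms by (intro Bochner_Integration.integral_add integrable_replicas)

lemma EE_sum:
  assumes "\<And>i. i \<in> I \<Longrightarrow> observable K (f i)"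
  shows "EE K (\<lambda>\<omega> r. \<Sum>i\<in>I. f i \<omega> r) = (\<Sum>i\<in>I. EE K (f i))"
  unfolding EE_def using assms by (intro Bochner_Integration.integral_sum integrable_replicas)

lemma EE_cmult: "EE K (\<lambda>\<omega> r. c * f \<omega> r) = c * EE K f"
  unfolding EE_def by simp

lemma EE_cong:
  assumes "\<And>\<omega> r. \<omega> \<in> space M \<Longrightarrow> r \<in> configs K \<Longrightarrow> f \<omega> r = g \<omega> r"
  shows "EE K f = EE K g"
  unfolding EE_def using assms by (intro Bochner_Integration.integral_cong refl) auto

lemma EE_mono:
  assumes "observable K f" "observable K g"
    and "\<And>\<omega> r. \<omega> \<in> space M \<Longrightarrow> r \<in> configs K \<Longrightarrow> f \<omega> r \<le> g \<omega> r"
  shows "EE K f \<le> EE K g"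
  unfolding EE_def by (rule integral_mono) (use assms integrable_replicas in auto)

lemma AE_replicasI:
  assumes P: "AE_config K P"
    and meas: "{z \<in> space (replicas K). P (fst z) (snd z)} \<in> sets (replicas K)"
  shows "AE z in replicas K. P (fst z) (snd z)"
proof -
  let ?N = "base K"
  have m: "{z \<in> space ?N. P (fst z) (snd z)} \<in> sets ?N"
    using meas by (simp add: space_pair_measure)
  have w0: "{z \<in> space ?N. \<not> 0 < ennreal (weights K (snd z) (fst z))} \<in> sets ?N"
    using weight_prod_measurable_pair by measurable
  have "AE z in ?N. 0 < ennreal (weights K (snd z) (fst z)) \<longrightarrow> P (fst z) (snd z)"
  proof (rule pair.AE_pair_measure)
    have "{z \<in> space ?N. 0 < ennreal (weights K (snd z) (fst z)) \<longrightarrow> P (fst z) (snd z)} =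
      {z \<in> space ?N. \<not> 0 < ennreal (weights K (snd z) (fst z))} \<union> {z \<in> space ?N. P (fst z) (snd z)}" by auto
    then show "{z \<in> space ?N. 0 < ennreal (weights K (snd z) (fst z)) \<longrightarrow> P (fst z) (snd z)} \<in> sets ?N"
      using sets.Un[OF w0 m] by simp
    show "AE x in M. AE y in count_space (configs K). 0 < ennreal (\<Prod>i\<in>{1..K}. w (snd (x, y) i) (fst (x, y))) \<longrightarrow> P (fst (x, y)) (snd (x, y))"
      using P AE_space
    proof eventually_elim
      case (elim \<omega>)
      have "P \<omega> r" if s: "r \<in> configs K" and pos: "0 < weights K r \<omega>" for r
      proof -
        have "0 < w (r i) \<omega>" if i: "i \<in> {1..K}" for i
        proof -
          have "w (r i) \<omega> \<noteq> 0"
          proof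
            assume "w (r i) \<omega> = 0"
            then have "weights K r \<omega> = 0" by (intro prod_zero bexI[OF _ i]) auto
            then show False using pos by linarith
          qed
          moreover have "0 \<le> w (r i) \<omega>" using i s elim(2) by (intro weight_nonneg) (auto simp: PiE_iff)
          ultimately show ?thesis by simp
        qed
        then show ?thesis using elim(1) s by blast
      qed
      then show ?case by (auto simp: AE_count_space)
    qed
  qed
  then show ?thesis
    unfolding replicas_def using weight_prod_measurable_pair
    by (subst AE_density) auto
qed

lemma abs_overlap_le:
  assumes "\<omega> \<in> space M" "r i \<in> A" "r j \<in> A"
  shows "\<bar>overlap (\<lambda>\<alpha>. \<xi> \<alpha> \<omega>) r i j\<bar> \<le> 1"
proof -
  have "norm (\<xi> (r i) \<omega>) \<le> 1" "norm (\<xi> (r j) \<omega>) \<le> 1"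
    using point_in_ball assms by auto
  then have "norm (\<xi> (r i) \<omega>) * norm (\<xi> (r j) \<omega>) \<le> 1"
    by (simp add: mult_le_one)
  then show ?thesis
    unfolding overlap_def using Cauchy_Schwarz_ineq2 order_trans by blast
qed

lemma overlap_measurable:
  assumes "r i \<in> A" "r j \<in> A"
  shows "(\<lambda>\<omega>. overlap (\<lambda>\<alpha>. \<xi> \<alpha> \<omega>) r i j) \<in> borel_measurable M"
  unfolding overlap_def using point_measurable assms by (intro borel_measurable_inner) auto

lemma observable_compose_R:
  assumes "i \<in> {1..K}" "j \<in> {1..K}" and \<phi>: "\<phi> \<in> borel_measurable borel"
    and B: "\<And>x. \<bar>x\<bar> \<le> 1 \<Longrightarrow> \<bar>\<phi> x\<bar> \<le> B"
  shows "observable K (\<lambda>\<omega> r. \<phi> (overlap (\<lambda>\<alpha>. \<xi> \<alpha> \<omega>) r i j))"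
  unfolding observable_def
proof (intro conjI ballI exI)
  fix r assume s: "r \<in> configs K"
  then have ij: "r i \<in> A" "r j \<in> A" using assms(1,2) by (auto simp: PiE_iff)
  show "(\<lambda>\<omega>. \<phi> (overlap (\<lambda>\<alpha>. \<xi> \<alpha> \<omega>) r i j)) \<in> borel_measurable M"
    by (rule measurable_compose[OF overlap_measurable[OF ij] \<phi>])
  show "\<bar>\<phi> (overlap (\<lambda>\<alpha>. \<xi> \<alpha> \<omega>) r i j)\<bar> \<le> B" if "\<omega> \<in> space M" for \<omega>
    by (intro B abs_overlap_le that ij)
qed

lemma observable_overlap:
  assumes "i \<in> {1..K}" "j \<in> {1..K}"
  shows "observable K (\<lambda>\<omega> r. overlap (\<lambda>\<alpha>. \<xi> \<alpha> \<omega>) r i j)"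
  using observable_compose_R[OF assms, of "\<lambda>x. x" 1] by simp

lemma overlap_array_measurable:
  assumes "r \<in> configs K" "n \<le> K"
  shows "(\<lambda>\<omega>. overlap_array n (\<lambda>\<alpha>. \<xi> \<alpha> \<omega>) r) \<in> measurable M (overlap_space n)"
proof -
  have "(\<lambda>\<omega>. overlap (\<lambda>\<alpha>. \<xi> \<alpha> \<omega>) r (fst p) (snd p)) \<in> borel_measurable M"
    if "p \<in> {1..n} \<times> {1..n}" for p
    by (rule overlap_measurable) (use that assms in \<open>auto simp: PiE_iff\<close>)
  then show ?thesis
    unfolding overlap_array_def case_prod_beta' by (rule measurable_restrict)
qed

lemma overlap_array_in_space: "overlap_array n x r \<in> space (overlap_space n)"
  by (simp add: overlap_array_def space_PiM)

lemma observable_ov: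
  assumes F: "overlap_fun n F" and n: "n \<le> K"
  shows "observable K (\<lambda>\<omega> r. F (overlap_array n (\<lambda>\<alpha>. \<xi> \<alpha> \<omega>) r))"
proof -
  have "bounded (F ` space (overlap_space n))" using F by (simp add: bounded_measurable_overlap_fun_def)
  then obtain B where B: "\<And>a. a \<in> space (overlap_space n) \<Longrightarrow> \<bar>F a\<bar> \<le> B"
    unfolding bounded_iff by auto
  show ?thesis
    unfolding observable_def
  proof (intro conjI ballI exI)
    show "(\<lambda>\<omega>. F (overlap_array n (\<lambda>\<alpha>. \<xi> \<alpha> \<omega>) r)) \<in> borel_measurable M" if "r \<in> configs K" for r
      using F by (intro measurable_compose[OF overlap_array_measurable[OF that n]])
        (simp add: bounded_measurable_overlap_fun_def)
    show "\<bar>F (overlap_array n (\<lambda>\<alpha>. \<xi> \<alpha> \<omega>) r)\<bar> \<le> B" for \<omega> r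
      by (rule B[OF overlap_array_in_space])
  qed
qed

lemma observable_restrict:
  assumes "observable K g" "K \<le> L"
  shows "observable L (\<lambda>\<omega> r. g \<omega> (reindex id K r))"
  by (rule observable_reindex) (use assms in auto)

lemma EE_restrict:
  assumes "observable K g" "K \<le> L"
  shows "EE L (\<lambda>\<omega> r. g \<omega> (reindex id K r)) = EE K g"
  by (rule EE_reindex) (use assms in auto)

lemma AE_replicas_iff:
  assumes meas: "{z \<in> space (replicas K). P (fst z) (snd z)} \<in> sets (replicas K)"
  shows "(AE z in replicas K. P (fst z) (snd z)) \<longleftrightarrow> AE_config K P"
proof
  assume "AE z in replicas K. P (fst z) (snd z)"
  then have "AE z in base K. 0 < ennreal (weights K (snd z) (fst z)) \<longrightarrow> P (fst z) (snd z)"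
    unfolding replicas_def using weight_prod_measurable_pair by (subst (asm) AE_density) auto
  from pair.AE_pair[OF this]
  show "AE_config K P"
  proof eventually_elim
    case (elim \<omega>)
    show ?case
    proof (intro ballI impI)
      fix r assume s: "r \<in> configs K" and pos: "\<forall>i\<in>{1..K}. 0 < w (r i) \<omega>"
      have "0 < weights K r \<omega>" by (rule prod_pos) (use pos in blast)
      then show "P \<omega> r" using elim s by (simp add: AE_count_space)
    qed
  qed
qed (rule AE_replicasI[OF _ meas])

end

section \<open>Constancy of the self-overlap\<close>

locale gg_random_measure = discrete_random_measure M A w \<xi>
  for M :: "'o measure" and A :: "'a set" and w :: "'a \<Rightarrow> 'o \<Rightarrow> real"
    and \<xi> :: "'a \<Rightarrow> 'o \<Rightarrow> 'h :: {real_inner, banach, second_countable_topology}" +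
  assumes gg: "ghirlanda_guerra M A w \<xi>"
begin

abbreviation R :: "'o \<Rightarrow> (nat \<Rightarrow> 'a) \<Rightarrow> nat \<Rightarrow> nat \<Rightarrow> real" where
  "R \<omega> r i j \<equiv> overlap (\<lambda>\<alpha>. \<xi> \<alpha> \<omega>) r i j"

abbreviation ov :: "nat \<Rightarrow> ((nat \<times> nat \<Rightarrow> real) \<Rightarrow> real) \<Rightarrow> 'o \<Rightarrow> (nat \<Rightarrow> 'a) \<Rightarrow> real" where
  "ov n F \<omega> r \<equiv> F (overlap_array n (\<lambda>\<alpha>. \<xi> \<alpha> \<omega>) r)"

abbreviation gg_lhs :: "(real \<Rightarrow> real) \<Rightarrow> nat \<Rightarrow> ((nat \<times> nat \<Rightarrow> real) \<Rightarrow> real) \<Rightarrow> real" where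
  "gg_lhs \<phi> n F \<equiv> EE (n + 1) (\<lambda>\<omega> r. ov n F \<omega> r * \<phi> (R \<omega> r 1 (n + 1)))"

abbreviation gg_rhs :: "(real \<Rightarrow> real) \<Rightarrow> nat \<Rightarrow> ((nat \<times> nat \<Rightarrow> real) \<Rightarrow> real) \<Rightarrow> real" where
  "gg_rhs \<phi> n F \<equiv> 1 / real n * EE n (ov n F) * EE 2 (\<lambda>\<omega> r. \<phi> (R \<omega> r 1 2))
     + 1 / real n * (\<Sum>l = 2..n. EE n (\<lambda>\<omega> r. ov n F \<omega> r * \<phi> (R \<omega> r 1 l)))"

text \<open>The identities with the power replaced by a test function. They will be extended from
  powers to polynomials and on to bounded pointwise limits, the goal being the indicator of a
  point.\<close>

definition gg_for :: "(real \<Rightarrow> real) \<Rightarrow> bool" where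
  "gg_for \<phi> \<longleftrightarrow> (\<forall>n F. 2 \<le> n \<longrightarrow> overlap_fun n F \<longrightarrow>
     gg_lhs \<phi> n F = gg_rhs \<phi> n F)"

lemma ov_restrict:
  assumes "n \<le> K"
  shows "ov n F \<omega> (reindex id K r) = ov n F \<omega> r"
proof -
  have "overlap_array n (\<lambda>\<alpha>. \<xi> \<alpha> \<omega>) (reindex id K r) = overlap_array n (\<lambda>\<alpha>. \<xi> \<alpha> \<omega>) r"
    using assms by (auto simp: overlap_array_def overlap_def reindex_def restrict_def fun_eq_iff)
  then show ?thesis by simp
qed

lemma EE_ov_mono:
  assumes "overlap_fun n F" "n \<le> K"
  shows "EE K (ov n F) = EE n (ov n F)"
  using EE_restrict[OF observable_ov[OF assms(1) order_refl] assms(2)]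
  by (simp add: ov_restrict)

lemma observable_R_power:
  assumes "i \<in> {1..K}" "j \<in> {1..K}"
  shows "observable K (\<lambda>\<omega> r. R \<omega> r i j ^ p)"
  by (intro observable_power observable_overlap assms)

lemma gg_for_power: "gg_for (\<lambda>x. x ^ p)"
  unfolding gg_for_def
proof (intro allI impI)
  fix n :: nat and F assume n: "2 \<le> n" and F: "overlap_fun n F"
  show "gg_lhs (\<lambda>x. x ^ p) n F = gg_rhs (\<lambda>x. x ^ p) n F"
  proof (cases "p = 0")
    case True
    \<comment> \<open>The assumed identities start at p = 1, but polynomials have constant terms.
      For p = 0 both sides are the mean of f, as 1/n + (n - 1)/n = 1.\<close>
    have "real (Suc n - 2) = real n - 1" using n by simp
    then show ?thesis
      using n EE_ov_mono[OF F, of "n + 1"] True by (simp add: field_simps)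
  next
    case False
    note E = EE_eq_config_avg
    have F': "observable K (ov n F)" if "n \<le> K" for K
      by (rule observable_ov[OF F that])
    have 1: "observable (n + 1) (\<lambda>\<omega> r. ov n F \<omega> r * R \<omega> r 1 (n + 1) ^ p)"
      by (intro observable_mult F' observable_R_power) auto
    have 2: "observable 2 (\<lambda>\<omega> r. R \<omega> r 1 2 ^ p)"
      by (intro observable_R_power) auto
    have 3: "observable n (\<lambda>\<omega> r. ov n F \<omega> r * R \<omega> r 1 l ^ p)" if "l \<in> {2..n}" for l
      by (intro observable_mult F' observable_R_power) (use n that in auto)
    have 4: "(\<Sum>l = 2..n. EE n (\<lambda>\<omega> r. ov n F \<omega> r * R \<omega> r 1 l ^ p)) =
      (\<Sum>l = 2..n. \<integral>\<omega>. gibbs \<omega> n (\<lambda>r. ov n F \<omega> r * R \<omega> r 1 l ^ p) \<partial>M)"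
      by (rule sum.cong[OF refl]) (simp add: E[OF 3])
    have "1 \<le> p" using False by simp
    then show ?thesis
      unfolding 4 E[OF 1] E[OF 2] E[OF F'[OF order_refl]]
      using gg n F unfolding ghirlanda_guerra_def Let_def by blast
  qed
qed

lemma EE_mult_poly:
  assumes g: "observable K g" and ij: "i \<in> {1..K}" "j \<in> {1..K}"
  shows "EE K (\<lambda>\<omega> r. g \<omega> r * poly P (R \<omega> r i j)) = (\<Sum>p\<le>degree P. coeff P p * EE K (\<lambda>\<omega> r. g \<omega> r * R \<omega> r i j ^ p))"
proof -
  have "EE K (\<lambda>\<omega> r. g \<omega> r * poly P (R \<omega> r i j)) =
    EE K (\<lambda>\<omega> r. \<Sum>p\<le>degree P. coeff P p * (g \<omega> r * R \<omega> r i j ^ p))"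
    by (rule EE_cong) (simp add: poly_altdef sum_distrib_left mult.left_commute)
  also have "\<dots> = (\<Sum>p\<le>degree P. EE K (\<lambda>\<omega> r. coeff P p * (g \<omega> r * R \<omega> r i j ^ p)))"
    by (intro EE_sum observable_mult observable_const g observable_R_power ij)
  also have "\<dots> = (\<Sum>p\<le>degree P. coeff P p * EE K (\<lambda>\<omega> r. g \<omega> r * R \<omega> r i j ^ p))"
    by (simp only: EE_cmult)
  finally show ?thesis .
qed

lemma gg_for_poly: "gg_for (poly P)"
  unfolding gg_for_def
proof (intro allI impI)
  fix n :: nat and F assume n: "2 \<le> n" and F: "overlap_fun n F"
  have F': "observable K (ov n F)" if "n \<le> K" for K
    by (rule observable_ov[OF F that])
  let ?c = "coeff P" and ?D = "{..degree P}"
  have 1: "gg_lhs (poly P) n F =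
    (\<Sum>p\<in>?D. ?c p * gg_lhs (\<lambda>x. x ^ p) n F)"
    by (intro EE_mult_poly F') auto
  have 2: "EE 2 (\<lambda>\<omega> r. poly P (R \<omega> r 1 2)) = (\<Sum>p\<in>?D. ?c p * EE 2 (\<lambda>\<omega> r. R \<omega> r 1 2 ^ p))"
    using EE_mult_poly[of 2 "\<lambda>_ _. 1" 1 2 P] by simp
  have 3: "(\<Sum>l = 2..n. EE n (\<lambda>\<omega> r. ov n F \<omega> r * poly P (R \<omega> r 1 l))) =
    (\<Sum>p\<in>?D. ?c p * (\<Sum>l = 2..n. EE n (\<lambda>\<omega> r. ov n F \<omega> r * R \<omega> r 1 l ^ p)))"
  proof -
    have "(\<Sum>l = 2..n. EE n (\<lambda>\<omega> r. ov n F \<omega> r * poly P (R \<omega> r 1 l))) =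
      (\<Sum>l = 2..n. \<Sum>p\<in>?D. ?c p * EE n (\<lambda>\<omega> r. ov n F \<omega> r * R \<omega> r 1 l ^ p))"
      by (intro sum.cong refl EE_mult_poly F') auto
    then show ?thesis by (simp add: sum.swap[of _ ?D] sum_distrib_left)
  qed
  have 4: "gg_lhs (\<lambda>x. x ^ p) n F = gg_rhs (\<lambda>x. x ^ p) n F" for p
    using gg_for_power[of p] n F unfolding gg_for_def by blast
  show "gg_lhs (poly P) n F = gg_rhs (poly P) n F"
    unfolding 1 2 3 4 by (simp add: sum_distrib_left sum.distrib algebra_simps)
qed

text \<open>For n = 2 and a function of R(1,1) alone, the identity expresses the mean of
  \<psi>(R(1,1)) \<phi>(R(1,3)) as half the product of means plus half the mean of \<psi>(R(1,1))
  \<phi>(R(1,2)). Relabelling replica 3 as 2 identifies the two joint means, and the equation is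
  solved for them.\<close>

lemma self_overlap_indep:
  assumes \<phi>: "gg_for \<phi>" "\<phi> \<in> borel_measurable borel" "\<And>x. \<bar>x\<bar> \<le> 1 \<Longrightarrow> \<bar>\<phi> x\<bar> \<le> B"
    and \<psi>: "\<psi> \<in> borel_measurable borel" "\<And>x. \<bar>\<psi> x\<bar> \<le> C"
  shows "EE 2 (\<lambda>\<omega> r. \<psi> (R \<omega> r 1 1) * \<phi> (R \<omega> r 1 2)) =
    EE 2 (\<lambda>\<omega> r. \<psi> (R \<omega> r 1 1)) * EE 2 (\<lambda>\<omega> r. \<phi> (R \<omega> r 1 2))"
proof -
  define F where "F a = \<psi> (a (1, 1))" for a :: "nat \<times> nat \<Rightarrow> real"
  have F: "overlap_fun 2 F"
    unfolding bounded_measurable_overlap_fun_def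
  proof
    show "F \<in> borel_measurable (overlap_space 2)"
      unfolding F_def by (rule measurable_compose[OF _ \<psi>(1)], rule measurable_component_singleton) auto
    show "bounded (F ` space (overlap_space 2))"
      unfolding bounded_iff F_def using \<psi>(2) by auto
  qed
  have Fa: "ov 2 F \<omega> r = \<psi> (R \<omega> r 1 1)" for \<omega> r
    by (simp add: F_def overlap_array_def)
  have b: "observable 2 (\<lambda>\<omega> r. \<psi> (R \<omega> r 1 1) * \<phi> (R \<omega> r 1 2))"
    by (intro observable_mult observable_compose_R[where B=C]
        observable_compose_R[where B=B]) (use \<phi> \<psi> in auto)
  let ?\<pi> = "\<lambda>i::nat. if i = 1 then 1 else 3::nat"
  have pi: "inj_on ?\<pi> {1..2}" "?\<pi> ` {1..2} \<subseteq> {1..3}" by (auto simp: inj_on_def)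
  have "EE 3 (\<lambda>\<omega> r. \<psi> (R \<omega> r 1 1) * \<phi> (R \<omega> r 1 3)) = EE 2 (\<lambda>\<omega> r. \<psi> (R \<omega> r 1 1) * \<phi> (R \<omega> r 1 2))"
    using EE_reindex[OF b pi] by (simp add: overlap_def)
  moreover have "EE (2 + 1) (\<lambda>\<omega> r. ov 2 F \<omega> r * \<phi> (R \<omega> r 1 (2 + 1))) =
       1 / real 2 * EE 2 (ov 2 F) * EE 2 (\<lambda>\<omega> r. \<phi> (R \<omega> r 1 2))
       + 1 / real 2 * (\<Sum>l = 2..2. EE 2 (\<lambda>\<omega> r. ov 2 F \<omega> r * \<phi> (R \<omega> r 1 l)))"
    using \<phi>(1) F unfolding gg_for_def by blast
  ultimately show ?thesis unfolding Fa by simp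
qed

end

context discrete_random_measure begin

lemma EE_mono_AE:
  assumes f: "observable K f" and g: "observable K g"
    and le: "AE_config K (\<lambda>\<omega> r. f \<omega> r \<le> g \<omega> r)"
  shows "EE K f \<le> EE K g"
  unfolding EE_def
proof (rule integral_mono_AE)
  show "AE z in replicas K. f (fst z) (snd z) \<le> g (fst z) (snd z)"
    by (rule AE_replicasI[OF le], rule borel_measurable_le)
       (use measurable_replicas f g in auto)
qed (use integrable_replicas f g in auto)

lemma EE_cong_pos:
  assumes f: "observable K f" and g: "observable K g"
    and eq: "AE_config K (\<lambda>\<omega> r. f \<omega> r = g \<omega> r)"
  shows "EE K f = EE K g"
proof (rule antisym)
  show "EE K f \<le> EE K g" by (rule EE_mono_AE[OF f g]) (use eq in eventually_elim, simp)
  show "EE K g \<le> EE K f" by (rule EE_mono_AE[OF g f]) (use eq in eventually_elim, simp)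
qed

lemma EE_nonneg:
  assumes "\<And>\<omega> r. \<omega> \<in> space M \<Longrightarrow> r \<in> configs K \<Longrightarrow> 0 \<le> g \<omega> r"
  shows "0 \<le> EE K g"
  unfolding EE_def by (rule integral_nonneg_AE, rule AE_I2) (use assms in auto)

lemma EE_eq_0:
  assumes g: "observable K g"
    and nn: "\<And>\<omega> r. \<omega> \<in> space M \<Longrightarrow> r \<in> configs K \<Longrightarrow> 0 \<le> g \<omega> r"
    and z: "EE K g = 0"
  shows "AE_config K (\<lambda>\<omega> r. g \<omega> r = 0)"
proof -
  have "AE z in replicas K. g (fst z) (snd z) = 0"
    using z unfolding EE_def
    by (subst (asm) integral_nonneg_eq_0_iff_AE[OF integrable_replicas[OF g]]) (use nn in \<open>auto intro!: AE_I2\<close>)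
  moreover have "{z \<in> space (replicas K). g (fst z) (snd z) = 0} \<in> sets (replicas K)"
    by (rule borel_measurable_eq[OF measurable_replicas[OF g] borel_measurable_const])
  ultimately show ?thesis by (subst (asm) AE_replicas_iff) auto
qed

text \<open>At every atom the pair of two equal configurations has positive weight, so what holds
  almost surely for two replicas holds for both sitting at the same atom; this transfers information
  to the self-overlap.\<close>

lemma EE_eq_0_diagonal:
  assumes "observable 2 g"
    and "\<And>\<omega> r. \<omega> \<in> space M \<Longrightarrow> r \<in> configs 2 \<Longrightarrow> 0 \<le> g \<omega> r"
    and "EE 2 g = 0"
  shows "AE_atom (\<lambda>\<alpha> \<omega>. g \<omega> (\<lambda>i\<in>{1..2}. \<alpha>) = 0)"
proof -
  have "AE_config 2 (\<lambda>\<omega> r. g \<omega> r = 0)"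
    by (rule EE_eq_0) (fact assms)+
  then show ?thesis
  proof eventually_elim
    case (elim \<omega>)
    show ?case
    proof (intro ballI impI)
      fix \<alpha> assume a: "\<alpha> \<in> A" "0 < w \<alpha> \<omega>"
      have "(\<lambda>i\<in>{1..2::nat}. \<alpha>) \<in> configs 2" using a by simp
      moreover have "\<forall>i\<in>{1..2::nat}. 0 < w ((\<lambda>i\<in>{1..2}. \<alpha>) i) \<omega>" using a by simp
      ultimately show "g \<omega> (\<lambda>i\<in>{1..2}. \<alpha>) = 0" using elim by blast
    qed
  qed
qed

lemma ex_positive_weight:
  assumes "\<omega> \<in> space M"
  shows "\<exists>\<alpha>\<in>A. 0 < w \<alpha> \<omega>"
proof (rule ccontr)
  assume "\<not> ?thesis"
  then have "w \<alpha> \<omega> = 0" if "\<alpha> \<in> A" for \<alpha> using weight_nonneg[OF that assms] that by force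
  then have "((\<lambda>\<alpha>. w \<alpha> \<omega>) has_sum 0) A" by (intro has_sum_0) auto
  then show False using has_sum_unique[OF weight_total[OF assms]] by fastforce
qed

end

context gg_random_measure begin

text \<open>If \<open>R\<^sub>1\<^sub>,\<^sub>1 \<le> a < q\<close> had positive probability, then on this event \<open>R\<^sub>1\<^sub>,\<^sub>2\<close> would be at most
  \<open>sqrt (a q) < q\<close> by Cauchy-Schwarz; but \<open>R\<^sub>1\<^sub>,\<^sub>2\<close> is independent of the event, and it is close to \<open>q\<close> with
  positive probability because both replicas may sit at the same atom. Independence is available for
  polynomials only, so the comparison is made through large powers of \<open>(1 + R\<^sub>1\<^sub>,\<^sub>2) / 2\<close>.\<close>

lemma self_overlap_lower:
  assumes up: "AE_atom (\<lambda>\<alpha> \<omega>. self \<alpha> \<omega> \<le> q)"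
    and lub: "\<And>x. AE_atom (\<lambda>\<alpha> \<omega>. self \<alpha> \<omega> \<le> x) \<Longrightarrow> q \<le> x"
    and a: "a < q"
  shows "AE_atom (\<lambda>\<alpha> \<omega>. a < self \<alpha> \<omega>)"
proof (cases "a < 0")
  case True
  then show ?thesis by (intro AE_I2 ballI impI) (metis inner_ge_zero less_le_trans)
next
  case False
  define m1 where "m1 = sqrt (a * q)"
  have m1: "0 \<le> m1" "m1 < q"
  proof -
    show "0 \<le> m1" using False a by (simp add: m1_def)
    have "a * q < q * q" using False a by (intro mult_strict_right_mono) auto
    then have "sqrt (a * q) < sqrt (q * q)" by (rule real_sqrt_less_mono)
    moreover have "sqrt (q * q) = q" using False a by simp
    ultimately show "m1 < q" by (simp add: m1_def)
  qed
  \<comment> \<open>A level strictly between \<open>m1\<close> and \<open>q\<close>: exceeding it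
    has positive probability, while it keeps a distance from the Cauchy-Schwarz bound
    \<open>m1\<close>.\<close>
  define m2 where "m2 = (m1 + q) / 2"
  have m2: "m1 < m2" "m2 < q" "0 < m2" using m1 by (auto simp: m2_def)
  define \<psi> :: "real \<Rightarrow> real" where "\<psi> = indicator {..a}"
  define B where "B = EE 2 (\<lambda>\<omega> r. \<psi> (R \<omega> r 1 1))"
  define p where "p = EE 2 (\<lambda>\<omega> r. indicator {m2<..} (R \<omega> r 1 2))"
  have psi_m: "\<psi> \<in> borel_measurable borel" by (simp add: \<psi>_def)
  have psi_nn: "0 \<le> \<psi> x" "\<bar>\<psi> x\<bar> \<le> 1" for x by (auto simp: \<psi>_def indicator_def)
  have bpsi: "observable 2 (\<lambda>\<omega> r. \<psi> (R \<omega> r 1 1))"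
    by (rule observable_compose_R[where B=1, OF _ _ psi_m]) (use psi_nn in auto)
  have bp: "observable 2 (\<lambda>\<omega> r. indicator {m2<..} (R \<omega> r 1 2))"
    by (rule observable_compose_R[where B=1]) (auto simp: indicator_def)
  have "0 \<le> p" unfolding p_def by (rule EE_nonneg) simp
  have "p \<noteq> 0"
  proof
    assume "p = 0"
    \<comment> \<open>On the diagonal pairs, \<open>p = 0\<close> would make \<open>m2\<close> an
      almost sure bound for the self-overlap, against the minimality of \<open>q\<close>.\<close>
    then have "AE_atom (\<lambda>\<alpha> \<omega>. (indicator {m2<..} (R \<omega> (\<lambda>i\<in>{1..2}. \<alpha>) 1 2) :: real) = 0)"
      unfolding p_def by (intro EE_eq_0_diagonal[OF bp]) auto
    then have "AE_atom (\<lambda>\<alpha> \<omega>. self \<alpha> \<omega> \<le> m2)"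
      by eventually_elim (auto simp: overlap_def indicator_def not_less split: if_splits)
    from lub[OF this] show False using m2 by simp
  qed
  then have p: "0 < p" using \<open>0 \<le> p\<close> by simp
  have B: "B = 0"
  proof (rule ccontr)
    assume "B \<noteq> 0"
    moreover have "0 \<le> B" unfolding B_def by (rule EE_nonneg) (rule psi_nn)
    ultimately have Bpos: "0 < B" by simp
    \<comment> \<open>The mean of the k-th power of (1 + R(1,2))/2 is at least p ((1 + m2)/2)^k and,
      by independence, at most ((1 + m1)/2)^k; \<open>\<rho>\<close> is the ratio of the two bases,
      and its powers tend to 0 below the fixed p > 0.\<close>
    define \<rho> where "\<rho> = (1 + m1) / (1 + m2)"
    have rho: "0 \<le> \<rho>" "\<rho> < 1" using m1 m2 by (auto simp: \<rho>_def field_simps)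
    have "p \<le> \<rho> ^ k" for k
    proof -
      \<comment> \<open>The increasing map (1 + x)/2 sends [-1, 1] into [0, 1], so its powers are
        nonnegative, bounded by 1 and monotone in the overlap, whatever the parity of k.\<close>
      let ?\<phi> = "poly ([:1/2, 1/2::real:] ^ k)"
      have phi: "?\<phi> x = ((1 + x) / 2) ^ k" for x by (simp add: poly_power field_simps)
      have phi_b: "0 \<le> ?\<phi> x" "?\<phi> x \<le> 1" if "\<bar>x\<bar> \<le> 1" for x
        unfolding phi using that by (auto intro!: power_le_one zero_le_power)
      have phi_m: "?\<phi> \<in> borel_measurable borel"
        by (intro borel_measurable_continuous_onI continuous_intros)
      have bphi: "observable 2 (\<lambda>\<omega> r. ?\<phi> (R \<omega> r 1 2))"
        by (rule observable_compose_R[where B=1, OF _ _ phi_m]) (use phi_b in auto)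
      have "p * ((1 + m2) / 2) ^ k = EE 2 (\<lambda>\<omega> r. ((1 + m2) / 2) ^ k * indicator {m2<..} (R \<omega> r 1 2))"
        unfolding p_def EE_cmult by simp
      also have "\<dots> \<le> EE 2 (\<lambda>\<omega> r. ?\<phi> (R \<omega> r 1 2))"
      proof (rule EE_mono[OF observable_mult[OF observable_const bp] bphi])
        fix \<omega> r assume "\<omega> \<in> space M" "r \<in> configs 2"
        then have "\<bar>R \<omega> r 1 2\<bar> \<le> 1" by (intro abs_overlap_le) (auto simp: PiE_iff)
        then show "((1 + m2) / 2) ^ k * indicator {m2<..} (R \<omega> r 1 2) \<le> ?\<phi> (R \<omega> r 1 2)"
          using m2 phi_b unfolding phi by (auto simp: indicator_def intro!: power_mono)
      qed
      finally have 1: "p * ((1 + m2) / 2) ^ k \<le> EE 2 (\<lambda>\<omega> r. ?\<phi> (R \<omega> r 1 2))" .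
      have "B * EE 2 (\<lambda>\<omega> r. ?\<phi> (R \<omega> r 1 2)) = EE 2 (\<lambda>\<omega> r. \<psi> (R \<omega> r 1 1) * ?\<phi> (R \<omega> r 1 2))"
        unfolding B_def
        by (rule self_overlap_indep[OF gg_for_poly phi_m, symmetric, where B=1, OF _ psi_m, where C=1])
           (use phi_b psi_nn in auto)
      also have "\<dots> \<le> EE 2 (\<lambda>\<omega> r. ((1 + m1) / 2) ^ k * \<psi> (R \<omega> r 1 1))"
      proof (rule EE_mono_AE[OF observable_mult[OF bpsi bphi] observable_mult[OF observable_const bpsi]])
        show "AE_config 2 (\<lambda>\<omega> r. \<psi> (R \<omega> r 1 1) * ?\<phi> (R \<omega> r 1 2) \<le> ((1 + m1) / 2) ^ k * \<psi> (R \<omega> r 1 1))"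
          using up AE_space
        proof eventually_elim
          case (elim \<omega>)
          show ?case
          proof (intro ballI impI)
            fix r assume s: "r \<in> configs 2" and pos: "\<forall>i\<in>{1..2}. 0 < w (r i) \<omega>"
            have sA: "r 1 \<in> A" "r 2 \<in> A" using s by (auto simp: PiE_iff)
            have r22: "R \<omega> r 2 2 \<le> q" using elim(1) sA pos by (simp add: overlap_def)
            have abs: "\<bar>R \<omega> r 1 2\<bar> \<le> 1" by (rule abs_overlap_le[OF elim(2) sA])
            show "\<psi> (R \<omega> r 1 1) * ?\<phi> (R \<omega> r 1 2) \<le> ((1 + m1) / 2) ^ k * \<psi> (R \<omega> r 1 1)"
            proof (cases "R \<omega> r 1 1 \<le> a")
              case True
              have "(R \<omega> r 1 2)\<^sup>2 \<le> R \<omega> r 1 1 * R \<omega> r 2 2"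
                unfolding overlap_def by (rule Cauchy_Schwarz_ineq)
              also have "\<dots> \<le> a * q"
                using True r22 False by (intro mult_mono) (auto simp: overlap_def)
              finally have "R \<omega> r 1 2 \<le> m1" unfolding m1_def by (rule real_le_rsqrt)
              then have "?\<phi> (R \<omega> r 1 2) \<le> ((1 + m1) / 2) ^ k"
                unfolding phi using abs by (intro power_mono) auto
              then show ?thesis using True by (simp add: \<psi>_def)
            qed (simp add: \<psi>_def)
          qed
        qed
      qed
      also have "\<dots> = B * ((1 + m1) / 2) ^ k" unfolding B_def EE_cmult by simp
      finally have "EE 2 (\<lambda>\<omega> r. ?\<phi> (R \<omega> r 1 2)) \<le> ((1 + m1) / 2) ^ k" using Bpos by simp
      with 1 have "p * ((1 + m2) / 2) ^ k \<le> ((1 + m1) / 2) ^ k" by linarith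
      then show "p \<le> \<rho> ^ k"
        unfolding \<rho>_def using m2 by (simp add: power_divide field_simps)
    qed
    moreover obtain k where "\<rho> ^ k < p" using real_arch_pow_inv[OF p rho(2)] by blast
    ultimately show False by (meson not_less)
  qed
  have "AE_atom (\<lambda>\<alpha> \<omega>. \<psi> (R \<omega> (\<lambda>i\<in>{1..2}. \<alpha>) 1 1) = 0)"
    by (rule EE_eq_0_diagonal[OF bpsi psi_nn(1)]) (use B in \<open>simp add: B_def\<close>)
  then show ?thesis
    by eventually_elim (auto simp: overlap_def \<psi>_def indicator_def not_le split: if_splits)
qed

text \<open>\<open>q\<close> is the essential supremum of the self-overlap over all atoms. The
  infimum of the upper bounds is approached from above, and values below it are excluded, along the
  levels 1/(k + 1); a countable family of levels keeps the exceptional set null.\<close>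

lemma self_overlap_const:
  "\<exists>q. 0 \<le> q \<and> q \<le> 1 \<and> AE_atom (\<lambda>\<alpha> \<omega>. self \<alpha> \<omega> = q)"
proof -
  define bd where "bd x \<longleftrightarrow> AE_atom (\<lambda>\<alpha> \<omega>. self \<alpha> \<omega> \<le> x)" for x
  define q where "q = Inf {x. bd x}"
  have bd1: "bd 1"
    unfolding bd_def
  proof (intro AE_I2 ballI impI)
    fix \<omega> \<alpha> assume "\<omega> \<in> space M" "\<alpha> \<in> A"
    then show "self \<alpha> \<omega> \<le> 1"
      using abs_overlap_le[of \<omega> "\<lambda>_. \<alpha>" 1 1] by (simp add: overlap_def)
  qed
  \<comment> \<open>Every realisation has an atom, so a bound for the squared norms of atoms cannot
    be negative.\<close>
  have bd0: "0 \<le> x" if "bd x" for x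
  proof -
    have "AE \<omega> in M. 0 \<le> x"
      using that[unfolded bd_def] AE_space
    proof eventually_elim
      case (elim \<omega>)
      then obtain \<alpha> where "\<alpha> \<in> A" "0 < w \<alpha> \<omega>" using ex_positive_weight by blast
      then have "self \<alpha> \<omega> \<le> x" using elim by blast
      then show ?case using inner_ge_zero order_trans by blast
    qed
    then show ?thesis by simp
  qed
  have bdb: "bdd_below {x. bd x}" using bd0 by (intro bdd_belowI[of _ 0]) auto
  have lub: "q \<le> x" if "bd x" for x unfolding q_def by (rule cInf_lower[OF _ bdb]) (use that in auto)
  have arch: "x \<le> y" if "\<And>k. x \<le> y + inverse (real (Suc k))" for x y :: real
  proof (rule ccontr)
    assume "\<not> x \<le> y"
    then obtain k where "inverse (real (Suc k)) < x - y" using reals_Archimedean[of "x - y"] by auto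
    with that[of k] show False by linarith
  qed
  have "bd (q + inverse (real (Suc k)))" for k
  proof -
    have "Inf {x. bd x} < q + inverse (real (Suc k))" unfolding q_def by simp
    then obtain u where u: "bd u" "u < q + inverse (real (Suc k))"
      using cInf_lessD[of "{x. bd x}"] bd1 by auto
    from u(1) show ?thesis unfolding bd_def by eventually_elim (use u(2) in force)
  qed
  then have "AE \<omega> in M. \<forall>k. \<forall>\<alpha>\<in>A. 0 < w \<alpha> \<omega> \<longrightarrow> self \<alpha> \<omega> \<le> q + inverse (real (Suc k))"
    unfolding bd_def by (simp add: AE_all_countable)
  then have up: "AE_atom (\<lambda>\<alpha> \<omega>. self \<alpha> \<omega> \<le> q)"
    by eventually_elim (rule ballI, rule impI, rule arch, simp)
  have "AE_atom (\<lambda>\<alpha> \<omega>. q - inverse (real (Suc k)) < self \<alpha> \<omega>)" for k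
    by (rule self_overlap_lower[OF up]) (use lub[unfolded bd_def] in auto)
  then have "AE \<omega> in M. \<forall>k. \<forall>\<alpha>\<in>A. 0 < w \<alpha> \<omega> \<longrightarrow> q - inverse (real (Suc k)) < self \<alpha> \<omega>"
    by (simp add: AE_all_countable)
  with up have "AE_atom (\<lambda>\<alpha> \<omega>. self \<alpha> \<omega> = q)"
  proof eventually_elim
    case (elim \<omega>)
    show ?case
    proof (intro ballI impI antisym)
      fix \<alpha> assume a: "\<alpha> \<in> A" "0 < w \<alpha> \<omega>"
      show "self \<alpha> \<omega> \<le> q" using elim(1) a by blast
      have "q - inverse (real (Suc k)) < self \<alpha> \<omega>" for k using elim(2) a by blast
      then have "q \<le> self \<alpha> \<omega> + inverse (real (Suc k))" for k
        by (simp add: diff_less_eq less_imp_le)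
      then show "q \<le> self \<alpha> \<omega>" by (rule arch)
    qed
  qed
  moreover have "0 \<le> q" using bd0 up unfolding bd_def by blast
  moreover have "q \<le> 1" by (rule lub[OF bd1])
  ultimately show ?thesis by blast
qed

text \<open>The test function is only evaluated at overlaps in [-1, 1], so bounded pointwise
  convergence on that interval passes through all expectations by dominated convergence.\<close>

lemma gg_for_limit:
  assumes gg: "\<And>k. gg_for (\<phi> k)"
    and m: "\<And>k. \<phi> k \<in> borel_measurable borel" "\<psi> \<in> borel_measurable borel"
    and b: "\<And>k x. \<bar>x\<bar> \<le> 1 \<Longrightarrow> \<bar>\<phi> k x\<bar> \<le> 1" "\<And>x. \<bar>x\<bar> \<le> 1 \<Longrightarrow> \<bar>\<psi> x\<bar> \<le> 1"
    and lim: "\<And>x. \<bar>x\<bar> \<le> 1 \<Longrightarrow> (\<lambda>k. \<phi> k x) \<longlonglongrightarrow> \<psi> x"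
  shows "gg_for \<psi>"
  unfolding gg_for_def
proof (intro allI impI)
  fix n :: nat and F assume n: "2 \<le> n" and F: "overlap_fun n F"
  have conv: "(\<lambda>k. EE K (\<lambda>\<omega> r. g \<omega> r * \<phi> k (R \<omega> r i j))) \<longlonglongrightarrow> EE K (\<lambda>\<omega> r. g \<omega> r * \<psi> (R \<omega> r i j))"
    if g: "observable K g" and ij: "i \<in> {1..K}" "j \<in> {1..K}" for K g i j
    unfolding EE_def
  proof (rule integral_dominated_convergence)
    have bk: "observable K (\<lambda>\<omega> r. g \<omega> r * \<phi> k (R \<omega> r i j))" for k
      by (rule observable_mult[OF g observable_compose_R[where B=1, OF ij m(1) b(1)]])
    have bpsi: "observable K (\<lambda>\<omega> r. g \<omega> r * \<psi> (R \<omega> r i j))"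
      by (rule observable_mult[OF g observable_compose_R[where B=1, OF ij m(2) b(2)]])
    show "(\<lambda>z. g (fst z) (snd z) * \<psi> (R (fst z) (snd z) i j)) \<in> borel_measurable (replicas K)"
      by (rule measurable_replicas[OF bpsi])
    show "(\<lambda>z. g (fst z) (snd z) * \<phi> k (R (fst z) (snd z) i j)) \<in> borel_measurable (replicas K)" for k
      by (rule measurable_replicas[OF bk])
    show "integrable (replicas K) (\<lambda>z. \<bar>g (fst z) (snd z)\<bar>)"
      by (intro integrable_abs integrable_replicas g)
    have R1: "\<bar>R (fst z) (snd z) i j\<bar> \<le> 1" if "z \<in> space (replicas K)" for z
      using that ij by (intro abs_overlap_le) (auto simp: PiE_iff)
    show "AE z in replicas K. (\<lambda>k. g (fst z) (snd z) * \<phi> k (R (fst z) (snd z) i j))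
       \<longlonglongrightarrow> g (fst z) (snd z) * \<psi> (R (fst z) (snd z) i j)"
      by (intro AE_I2 tendsto_mult tendsto_const lim R1)
    show "AE z in replicas K. norm (g (fst z) (snd z) * \<phi> k (R (fst z) (snd z) i j)) \<le> \<bar>g (fst z) (snd z)\<bar>" for k
    proof (rule AE_I2)
      fix z assume "z \<in> space (replicas K)"
      then show "norm (g (fst z) (snd z) * \<phi> k (R (fst z) (snd z) i j)) \<le> \<bar>g (fst z) (snd z)\<bar>"
        using mult_left_mono[OF b(1)[OF R1], of z "\<bar>g (fst z) (snd z)\<bar>" k] by (simp add: abs_mult)
    qed
  qed
  have F': "observable K (ov n F)" if "n \<le> K" for K
    by (rule observable_ov[OF F that])
  have 1: "(\<lambda>k. gg_lhs (\<phi> k) n F) \<longlonglongrightarrow>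
     gg_lhs \<psi> n F"
    by (intro conv F') auto
  have 2: "(\<lambda>k. EE 2 (\<lambda>\<omega> r. \<phi> k (R \<omega> r 1 2))) \<longlonglongrightarrow> EE 2 (\<lambda>\<omega> r. \<psi> (R \<omega> r 1 2))"
    using conv[of 2 "\<lambda>_ _. 1" 1 2] by simp
  have 3: "(\<lambda>k. EE n (\<lambda>\<omega> r. ov n F \<omega> r * \<phi> k (R \<omega> r 1 l))) \<longlonglongrightarrow>
     EE n (\<lambda>\<omega> r. ov n F \<omega> r * \<psi> (R \<omega> r 1 l))" if "l \<in> {2..n}" for l
    by (intro conv F') (use that in auto)
  have "(\<lambda>k. gg_lhs (\<phi> k) n F) \<longlonglongrightarrow>
       gg_rhs \<psi> n F"
  proof -
    have "gg_lhs (\<phi> k) n F = gg_rhs (\<phi> k) n F" for k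
      using gg[of k] n F unfolding gg_for_def by blast
    moreover have "(\<lambda>k. gg_rhs (\<phi> k) n F) \<longlonglongrightarrow>
       gg_rhs \<psi> n F"
      by (intro tendsto_add tendsto_mult tendsto_const tendsto_sum 2 3)
    ultimately show ?thesis by simp
  qed
  from LIMSEQ_unique[OF 1 this]
  show "gg_lhs \<psi> n F = gg_rhs \<psi> n F" .
qed

lemma gg_for_point:
  assumes q: "0 \<le> q" "q \<le> 1"
  shows "gg_for (\<lambda>x. of_bool (x = q))"
proof (rule gg_for_limit)
  \<comment> \<open>For x and q in the given ranges |x - q| \<le> 2, so 1 - (x - q)^2/4 lies in
    [0, 1] and equals 1 only at x = q; its powers converge to the indicator of q.\<close>
  let ?P = "1 - smult (1/4) ([:-q, 1:] ^ 2) :: real poly"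
  have P: "poly (?P ^ k) x = (1 - (x - q)\<^sup>2 / 4) ^ k" for k x
    by (simp add: poly_power)
  have base: "0 \<le> 1 - (x - q)\<^sup>2 / 4" "1 - (x - q)\<^sup>2 / 4 \<le> 1" if "\<bar>x\<bar> \<le> 1" for x
  proof -
    have "\<bar>x - q\<bar> \<le> 2" using that q by linarith
    then have "(x - q)\<^sup>2 \<le> 2\<^sup>2" by (metis abs_le_square_iff abs_numeral)
    then show "0 \<le> 1 - (x - q)\<^sup>2 / 4" by simp
  qed simp
  show "gg_for (poly (?P ^ k))" for k by (rule gg_for_poly)
  show "poly (?P ^ k) \<in> borel_measurable borel" for k
    by (intro borel_measurable_continuous_onI continuous_intros)
  show "(\<lambda>x. of_bool (x = q) :: real) \<in> borel_measurable borel" by measurable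
  show "\<bar>poly (?P ^ k) x\<bar> \<le> 1" if "\<bar>x\<bar> \<le> 1" for k x
    unfolding P using base[OF that] by (simp add: power_le_one)
  show "\<bar>of_bool (x = q) :: real\<bar> \<le> 1" for x by simp
  show "(\<lambda>k. poly (?P ^ k) x) \<longlonglongrightarrow> of_bool (x = q)" if "\<bar>x\<bar> \<le> 1" for x
  proof (cases "x = q")
    case False
    then have "1 - (x - q)\<^sup>2 / 4 < 1" by simp
    then show ?thesis unfolding P using base[OF that] False by (auto intro!: LIMSEQ_power_zero)
  qed (simp add: P)
qed

end

section \<open>Ghirlanda-Guerra identities for coincidences of replicas\<close>

definition pattern :: "nat \<Rightarrow> (nat \<Rightarrow> 'a) \<Rightarrow> (nat \<times> nat) set" where
  "pattern N r = {(i, j). i \<in> {1..N} \<and> j \<in> {1..N} \<and> r i = r j}"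

lemma pattern_subset: "pattern N r \<in> Pow ({1..N} \<times> {1..N})"
  by (auto simp: pattern_def)

definition pattern_fun :: "'a set \<Rightarrow> nat \<Rightarrow> ((nat \<Rightarrow> 'a) \<Rightarrow> real) \<Rightarrow> bool" where
  "pattern_fun A N h \<longleftrightarrow> (\<forall>r\<in>tuples A N. \<forall>\<tau>\<in>tuples A N. pattern N r = pattern N \<tau> \<longrightarrow> h r = h \<tau>)"

text \<open>A representative is chosen for each pattern. As there are finitely many patterns, the
  factor \<open>G\<close> makes such functions bounded, and measurable as functions of the
  overlaps.\<close>

lemma pattern_fun_factor:
  assumes "pattern_fun A N h"
  obtains G where "\<And>r. r \<in> tuples A N \<Longrightarrow> h r = G (pattern N r)"
proof -
  define G where "G P = h (SOME \<tau>. \<tau> \<in> tuples A N \<and> pattern N \<tau> = P)" for P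
  have "h r = G (pattern N r)" if s: "r \<in> tuples A N" for r
  proof -
    let ?Q = "\<lambda>\<tau>. \<tau> \<in> tuples A N \<and> pattern N \<tau> = pattern N r"
    have "?Q (SOME \<tau>. ?Q \<tau>)" by (rule someI[of ?Q r]) (use s in simp)
    then show ?thesis
      using assms s unfolding pattern_fun_def G_def by blast
  qed
  then show ?thesis by (rule that)
qed

lemma overlap_fun_mult:
  assumes "overlap_fun n F" "overlap_fun n G"
  shows "overlap_fun n (\<lambda>a. F a * G a)"
  unfolding bounded_measurable_overlap_fun_def
proof
  show "(\<lambda>a. F a * G a) \<in> borel_measurable (overlap_space n)"
    using assms by (intro borel_measurable_times) (simp_all add: bounded_measurable_overlap_fun_def)
  from assms obtain B C where "\<forall>a\<in>space (overlap_space n). \<bar>F a\<bar> \<le> B" "\<forall>a\<in>space (overlap_space n). \<bar>G a\<bar> \<le> C"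
    unfolding bounded_measurable_overlap_fun_def bounded_iff by auto
  then have "\<forall>a\<in>space (overlap_space n). \<bar>F a * G a\<bar> \<le> \<bar>B\<bar> * \<bar>C\<bar>"
    unfolding abs_mult by (intro ballI mult_mono) (force intro: order_trans)+
  then show "bounded ((\<lambda>a. F a * G a) ` space (overlap_space n))"
    unfolding bounded_iff by auto
qed

lemma overlap_fun_compose:
  assumes F: "overlap_fun n F"
    and T: "T \<in> measurable (overlap_space N) (overlap_space n)"
  shows "overlap_fun N (\<lambda>a. F (T a))"
proof -
  have "(\<lambda>a. F (T a)) ` space (overlap_space N) \<subseteq> F ` space (overlap_space n)"
    using measurable_space[OF T] by blast
  moreover have "(\<lambda>a. F (T a)) \<in> borel_measurable (overlap_space N)"
    by (rule measurable_compose[OF T]) (use F in \<open>simp add: bounded_measurable_overlap_fun_def\<close>)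
  ultimately show ?thesis
    using F unfolding bounded_measurable_overlap_fun_def by (meson bounded_subset)
qed

context gg_random_measure begin

text \<open>Since coincidence of replicas is almost surely a function of their overlap, functions of the
  coincidence pattern qualify as functions of the overlaps only up to null sets.\<close>

definition ov_observable :: "nat \<Rightarrow> ('o \<Rightarrow> (nat \<Rightarrow> 'a) \<Rightarrow> real) \<Rightarrow> bool" where
  "ov_observable N g \<longleftrightarrow> observable N g \<and>
    (\<exists>\<Phi>. overlap_fun N \<Phi> \<and>
      (AE_config N (\<lambda>\<omega> r. g \<omega> r = ov N \<Phi> \<omega> r)))"

lemma ov_observable_mult:
  assumes f: "ov_observable N f" and g: "ov_observable N g"
  shows "ov_observable N (\<lambda>\<omega> r. f \<omega> r * g \<omega> r)"
proof -
  obtain F where F: "overlap_fun N F"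
    "AE_config N (\<lambda>\<omega> r. f \<omega> r = ov N F \<omega> r)"
    using f unfolding ov_observable_def by blast
  obtain G where G: "overlap_fun N G"
    "AE_config N (\<lambda>\<omega> r. g \<omega> r = ov N G \<omega> r)"
    using g unfolding ov_observable_def by blast
  have "AE_config N (\<lambda>\<omega> r. f \<omega> r * g \<omega> r = ov N (\<lambda>a. F a * G a) \<omega> r)"
    using F(2) G(2) by eventually_elim simp
  then show ?thesis
    using overlap_fun_mult[OF F(1) G(1)] f g
    unfolding ov_observable_def by (blast intro: observable_mult)
qed

lemma ov_observable_ov:
  assumes F: "overlap_fun n F" and n: "n \<le> N"
  shows "ov_observable N (ov n F)"
proof -
  define T where "T a = restrict a ({1..n} \<times> {1..n})" for a :: "nat \<times> nat \<Rightarrow> real"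
  have "T \<in> measurable (overlap_space N) (overlap_space n)"
    unfolding T_def by (rule measurable_restrict_subset) (use n in auto)
  then have "overlap_fun N (\<lambda>a. F (T a))"
    by (rule overlap_fun_compose[OF F])
  moreover have "T (overlap_array N x r) = overlap_array n x r" for x :: "'a \<Rightarrow> 'h" and r
    using n by (auto simp: T_def overlap_array_def restrict_def fun_eq_iff)
  ultimately show ?thesis
    unfolding ov_observable_def
    by (intro conjI observable_ov[OF F n] exI[of _ "\<lambda>a. F (T a)"]) auto
qed

text \<open>If two atoms have squared norm q and inner product q, their squared distance is q - 2q +
  q = 0; distinct configurations of positive weight have distinct points.\<close>

lemma coincide_iff_overlap:
  obtains q where "0 \<le> q" "q \<le> 1"
    "AE \<omega> in M. \<forall>\<alpha>\<in>A. \<forall>\<beta>\<in>A. 0 < w \<alpha> \<omega> \<longrightarrow> 0 < w \<beta> \<omega> \<longrightarrow> (\<xi> \<alpha> \<omega> \<bullet> \<xi> \<beta> \<omega> = q \<longleftrightarrow> \<alpha> = \<beta>)"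
proof -
  from self_overlap_const obtain q where q: "0 \<le> q" "q \<le> 1"
    and const: "AE_atom (\<lambda>\<alpha> \<omega>. self \<alpha> \<omega> = q)" by blast
  from const atoms_distinct
  have "AE \<omega> in M. \<forall>\<alpha>\<in>A. \<forall>\<beta>\<in>A. 0 < w \<alpha> \<omega> \<longrightarrow> 0 < w \<beta> \<omega> \<longrightarrow> (\<xi> \<alpha> \<omega> \<bullet> \<xi> \<beta> \<omega> = q \<longleftrightarrow> \<alpha> = \<beta>)"
  proof eventually_elim
    case (elim \<omega>)
    show ?case
    proof (intro ballI impI iffI)
      fix \<alpha> \<beta> assume ab: "\<alpha> \<in> A" "\<beta> \<in> A" "0 < w \<alpha> \<omega>" "0 < w \<beta> \<omega>"
      have aa: "self \<alpha> \<omega> = q" "\<xi> \<beta> \<omega> \<bullet> \<xi> \<beta> \<omega> = q" using elim(1) ab by auto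
      { assume "\<xi> \<alpha> \<omega> \<bullet> \<xi> \<beta> \<omega> = q"
        then have "(\<xi> \<alpha> \<omega> - \<xi> \<beta> \<omega>) \<bullet> (\<xi> \<alpha> \<omega> - \<xi> \<beta> \<omega>) = 0"
          using aa by (simp add: inner_diff_left inner_diff_right inner_commute)
        then have "\<xi> \<alpha> \<omega> = \<xi> \<beta> \<omega>" by simp
        then show "\<alpha> = \<beta>" using inj_onD[OF elim(2), of \<alpha> \<beta>] ab by simp }
      { assume "\<alpha> = \<beta>" then show "\<xi> \<alpha> \<omega> \<bullet> \<xi> \<beta> \<omega> = q" using aa by simp }
    qed
  qed
  with q show ?thesis by (rule that)
qed

lemma observable_pattern_fun:
  assumes "pattern_fun A N h"
  shows "observable N (\<lambda>\<omega> r. h r)"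
proof -
  obtain G where G: "\<And>r. r \<in> configs N \<Longrightarrow> h r = G (pattern N r)"
    by (rule pattern_fun_factor[OF assms]) blast
  define B where "B = Max ((\<lambda>P. \<bar>G P\<bar>) ` Pow ({1..N} \<times> {1..N}))"
  have "\<bar>h r\<bar> \<le> B" if "r \<in> configs N" for r
  proof -
    have "\<bar>G P\<bar> \<le> B" if "P \<in> Pow ({1..N} \<times> {1..N})" for P
      unfolding B_def using that by (intro Max_ge) simp_all
    from this[OF pattern_subset] show ?thesis unfolding G[OF that] .
  qed
  then show ?thesis unfolding observable_def by auto
qed

text \<open>The set of index pairs whose overlap equals q is almost surely the coincidence pattern.
  The map \<open>T\<close> extracting this set from an overlap array has finitely many values, and
  each is taken on a measurable set.\<close>

lemma ov_observable_pattern_fun: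
  assumes h: "pattern_fun A N h"
  shows "ov_observable N (\<lambda>\<omega> r. h r)"
proof -
  obtain G where G: "\<And>r. r \<in> configs N \<Longrightarrow> h r = G (pattern N r)"
    by (rule pattern_fun_factor[OF h]) blast
  obtain q where q: "AE \<omega> in M. \<forall>\<alpha>\<in>A. \<forall>\<beta>\<in>A. 0 < w \<alpha> \<omega> \<longrightarrow> 0 < w \<beta> \<omega> \<longrightarrow> (\<xi> \<alpha> \<omega> \<bullet> \<xi> \<beta> \<omega> = q \<longleftrightarrow> \<alpha> = \<beta>)"
    by (rule coincide_iff_overlap)
  let ?I = "{1..N} \<times> {1..N}"
  define T where "T a = {p \<in> ?I. a p = q}" for a :: "nat \<times> nat \<Rightarrow> real"
  have "T \<in> measurable (overlap_space N) (count_space (Pow ?I))"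
  proof (subst measurable_count_space_eq2, simp, intro conjI ballI)
    show "T \<in> space (overlap_space N) \<rightarrow> Pow ?I" by (auto simp: T_def)
    fix S assume S: "S \<in> Pow ?I"
    have "T -` {S} \<inter> space (overlap_space N) = {a \<in> space (overlap_space N). \<forall>p\<in>?I. (a p = q) = (p \<in> S)}"
    proof -
      have "T a = S \<longleftrightarrow> (\<forall>p\<in>?I. (a p = q) = (p \<in> S))" for a
        using S unfolding T_def by blast
      then show ?thesis by blast
    qed
    also have "\<dots> \<in> sets (overlap_space N)"
    proof (rule sets.sets_Collect_finite_All)
      fix p assume p: "p \<in> ?I"
      have m: "(\<lambda>a. a p) \<in> measurable (overlap_space N) borel"
        using p by (rule measurable_component_singleton)
      show "{a \<in> space (overlap_space N). (a p = q) = (p \<in> S)} \<in> sets (overlap_space N)"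
        using m by measurable
    qed auto
    finally show "T -` {S} \<inter> space (overlap_space N) \<in> sets (overlap_space N)" .
  qed
  then have "(\<lambda>a. G (T a)) \<in> borel_measurable (overlap_space N)"
    by (rule measurable_compose) simp
  moreover have "(\<lambda>a. G (T a)) ` space (overlap_space N) \<subseteq> G ` Pow ?I"
    by (auto simp: T_def)
  then have "bounded ((\<lambda>a. G (T a)) ` space (overlap_space N))"
    by (rule bounded_subset[rotated]) (intro finite_imp_bounded finite_imageI, simp)
  ultimately have bm: "overlap_fun N (\<lambda>a. G (T a))"
    unfolding bounded_measurable_overlap_fun_def by simp
  have "AE_config N (\<lambda>\<omega> r. h r = ov N (\<lambda>a. G (T a)) \<omega> r)"
    using q
  proof eventually_elim
    case (elim \<omega>)
    show ?case
    proof (intro ballI impI)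
      fix r assume s: "r \<in> configs N" and pos: "\<forall>i\<in>{1..N}. 0 < w (r i) \<omega>"
      have iff: "R \<omega> r i j = q \<longleftrightarrow> r i = r j" if "i \<in> {1..N}" "j \<in> {1..N}" for i j
        using elim s pos that unfolding overlap_def by (simp add: PiE_iff)
      have "T (overlap_array N (\<lambda>\<alpha>. \<xi> \<alpha> \<omega>) r) = {(i, j). i \<in> {1..N} \<and> j \<in> {1..N} \<and> R \<omega> r i j = q}"
        by (auto simp: T_def overlap_array_def)
      also have "\<dots> = pattern N r"
        unfolding pattern_def
      proof (rule Collect_cong)
        fix p show "(case p of (i, j) \<Rightarrow> i \<in> {1..N} \<and> j \<in> {1..N} \<and> R \<omega> r i j = q) =
          (case p of (i, j) \<Rightarrow> i \<in> {1..N} \<and> j \<in> {1..N} \<and> r i = r j)"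
          by (cases p) (simp only: prod.case iff cong: conj_cong)
      qed
      finally have "T (overlap_array N (\<lambda>\<alpha>. \<xi> \<alpha> \<omega>) r) = pattern N r" .
      then show "h r = ov N (\<lambda>a. G (T a)) \<omega> r" using G[OF s] by simp
    qed
  qed
  then show ?thesis
    unfolding ov_observable_def using bm observable_pattern_fun[OF h] by blast
qed

lemma ov_observable_reindex:
  assumes g: "ov_observable N g" and pi: "\<pi> ` {1..N} \<subseteq> {1..N}"
  shows "ov_observable N (\<lambda>\<omega> r. g \<omega> (reindex \<pi> N r))"
proof -
  obtain F where F: "overlap_fun N F"
    "AE_config N (\<lambda>\<omega> r. g \<omega> r = ov N F \<omega> r)"
    using g unfolding ov_observable_def by blast
  define T where "T a = (\<lambda>p\<in>{1..N} \<times> {1..N}. a (\<pi> (fst p), \<pi> (snd p)))" for a :: "nat \<times> nat \<Rightarrow> real"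
  have "T \<in> measurable (overlap_space N) (overlap_space N)"
    unfolding T_def
    by (intro measurable_restrict measurable_component_singleton) (use pi in auto)
  then have bm: "overlap_fun N (\<lambda>a. F (T a))"
    by (rule overlap_fun_compose[OF F(1)])
  have T: "T (overlap_array N x r) = overlap_array N x (reindex \<pi> N r)" for x :: "'a \<Rightarrow> 'h" and r
  proof
    fix p show "T (overlap_array N x r) p = overlap_array N x (reindex \<pi> N r) p"
      using pi by (cases p) (auto simp: T_def overlap_array_def overlap_def image_subset_iff)
  qed
  have "AE_config N (\<lambda>\<omega> r. g \<omega> (reindex \<pi> N r) = ov N (\<lambda>a. F (T a)) \<omega> r)"
    using F(2)
  proof eventually_elim
    case (elim \<omega>)
    show ?case
    proof (intro ballI impI)
      fix r assume s: "r \<in> configs N" and pos: "\<forall>i\<in>{1..N}. 0 < w (r i) \<omega>"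
      have "\<forall>i\<in>{1..N}. 0 < w (reindex \<pi> N r i) \<omega>" using pos pi by (auto simp: image_subset_iff)
      then show "g \<omega> (reindex \<pi> N r) = ov N (\<lambda>a. F (T a)) \<omega> r"
        unfolding T using elim reindex_in[OF s pi] by blast
    qed
  qed
  then show ?thesis
    using bm observable_reindex[of N g \<pi> N] g pi unfolding ov_observable_def by blast
qed

definition coincidence :: real where
  "coincidence = EE 2 (\<lambda>\<omega> r. of_bool (r 1 = r 2))"

lemma observable_coincide: "observable N (\<lambda>\<omega> r. of_bool (r i = r j))"
  unfolding observable_def by (auto intro!: exI[of _ 1])

text \<open>On tuples of positive weight, coincidence and overlap q are the same event, so every
  expectation can be rewritten in terms of overlaps, where the identity for the indicator of q
  applies.\<close>

lemma gg_coincide_first: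
  assumes g: "ov_observable N g" and N: "2 \<le> N"
  shows "EE (N + 1) (\<lambda>\<omega> r. g \<omega> (reindex id N r) * of_bool (r 1 = r (N + 1))) =
    1 / real N * EE N g * coincidence + 1 / real N * (\<Sum>l = 2..N. EE N (\<lambda>\<omega> r. g \<omega> r * of_bool (r 1 = r l)))"
proof -
  obtain F where F: "overlap_fun N F"
    and gF: "AE_config N (\<lambda>\<omega> r. g \<omega> r = ov N F \<omega> r)"
    using g unfolding ov_observable_def by blast
  have bg: "observable N g" using g unfolding ov_observable_def by blast
  obtain q where q: "0 \<le> q" "q \<le> 1"
    "AE \<omega> in M. \<forall>\<alpha>\<in>A. \<forall>\<beta>\<in>A. 0 < w \<alpha> \<omega> \<longrightarrow> 0 < w \<beta> \<omega> \<longrightarrow> (\<xi> \<alpha> \<omega> \<bullet> \<xi> \<beta> \<omega> = q \<longleftrightarrow> \<alpha> = \<beta>)"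
    by (rule coincide_iff_overlap)
  let ?\<delta> = "\<lambda>x. of_bool (x = q) :: real"
  have b\<delta>: "observable K (\<lambda>\<omega> r. ?\<delta> (R \<omega> r i j))" if "i \<in> {1..K}" "j \<in> {1..K}" for K i j
    by (rule observable_compose_R[where B=1, OF that]) auto
  have bF: "observable K (ov N F)" if "N \<le> K" for K
    by (rule observable_ov[OF F that])
  have gid: "observable K (\<lambda>\<omega> r. g \<omega> (reindex id N r))" if "N \<le> K" for K
    by (rule observable_restrict[OF bg that])
  have key: "EE K (\<lambda>\<omega> r. g \<omega> (reindex id N r) * of_bool (r i = r j)) =
      EE K (\<lambda>\<omega> r. ov N F \<omega> r * ?\<delta> (R \<omega> r i j))"
    if K: "N \<le> K" and ij: "i \<in> {1..K}" "j \<in> {1..K}" for K i j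
  proof (rule EE_cong_pos)
    show "observable K (\<lambda>\<omega> r. g \<omega> (reindex id N r) * of_bool (r i = r j))"
      by (rule observable_mult[OF gid[OF K] observable_coincide])
    show "observable K (\<lambda>\<omega> r. ov N F \<omega> r * ?\<delta> (R \<omega> r i j))"
      by (rule observable_mult[OF bF[OF K] b\<delta>[OF ij]])
    show "AE_config K (\<lambda>\<omega> r. g \<omega> (reindex id N r) * of_bool (r i = r j) = ov N F \<omega> r * ?\<delta> (R \<omega> r i j))"
      using gF q(3)
    proof eventually_elim
      case (elim \<omega>)
      show ?case
      proof (intro ballI impI)
        fix r assume s: "r \<in> configs K" and pos: "\<forall>i\<in>{1..K}. 0 < w (r i) \<omega>"
        have "reindex id N r \<in> configs N" by (rule reindex_in[OF s]) (use K in auto)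
        moreover have "\<forall>i\<in>{1..N}. 0 < w (reindex id N r i) \<omega>" using pos K by auto
        ultimately have "g \<omega> (reindex id N r) = ov N F \<omega> r"
          using elim(1) ov_restrict[of N N F \<omega> r] by fastforce
        moreover have "R \<omega> r i j = q \<longleftrightarrow> r i = r j"
          using elim(2) s pos ij unfolding overlap_def by (simp add: PiE_iff)
        ultimately show "g \<omega> (reindex id N r) * of_bool (r i = r j) = ov N F \<omega> r * ?\<delta> (R \<omega> r i j)"
          by simp
      qed
    qed
  qed
  have id: "reindex id N r = r" if "r \<in> configs N" for r
    using that by (auto simp: reindex_def PiE_iff restrict_def extensional_def fun_eq_iff)
  have 1: "EE N (\<lambda>\<omega> r. g \<omega> r * of_bool (r i = r j)) = EE N (\<lambda>\<omega> r. ov N F \<omega> r * ?\<delta> (R \<omega> r i j))"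
    if "i \<in> {1..N}" "j \<in> {1..N}" for i j
  proof -
    have "EE N (\<lambda>\<omega> r. g \<omega> r * of_bool (r i = r j)) = EE N (\<lambda>\<omega> r. g \<omega> (reindex id N r) * of_bool (r i = r j))"
      by (rule EE_cong) (simp add: id)
    then show ?thesis using key[OF order_refl that] by simp
  qed
  have 2: "EE N g = EE N (ov N F)"
    by (rule EE_cong_pos[OF bg bF[OF order_refl] gF])
  have 3: "coincidence = EE 2 (\<lambda>\<omega> r. ?\<delta> (R \<omega> r 1 2))"
    unfolding coincidence_def
  proof (rule EE_cong_pos[OF observable_coincide b\<delta>])
    show "AE_config 2 (\<lambda>\<omega> r. of_bool (r 1 = r 2) = ?\<delta> (R \<omega> r 1 2))"
      using q(3)
    proof eventually_elim
      case (elim \<omega>)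
      show ?case
      proof (intro ballI impI)
        fix r assume s: "r \<in> configs 2" and pos: "\<forall>i\<in>{1..2}. 0 < w (r i) \<omega>"
        have "r 1 \<in> A" "r 2 \<in> A" using s by (auto simp: PiE_iff)
        moreover have "0 < w (r 1) \<omega>" "0 < w (r 2) \<omega>" using pos by auto
        ultimately have "R \<omega> r 1 2 = q \<longleftrightarrow> r 1 = r 2"
          using elim unfolding overlap_def by blast
        then show "of_bool (r 1 = r 2) = ?\<delta> (R \<omega> r 1 2)" by simp
      qed
    qed
  qed auto
  have 4: "(\<Sum>l = 2..N. EE N (\<lambda>\<omega> r. g \<omega> r * of_bool (r 1 = r l))) =
     (\<Sum>l = 2..N. EE N (\<lambda>\<omega> r. ov N F \<omega> r * ?\<delta> (R \<omega> r 1 l)))"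
    by (rule sum.cong[OF refl 1]) (use N in auto)
  have 5: "EE (N + 1) (\<lambda>\<omega> r. g \<omega> (reindex id N r) * of_bool (r 1 = r (N + 1))) =
    EE (N + 1) (\<lambda>\<omega> r. ov N F \<omega> r * ?\<delta> (R \<omega> r 1 (N + 1)))"
    by (rule key) auto
  show ?thesis
    unfolding 2 3 4 5 using gg_for_point[OF q(1,2)] N F unfolding gg_for_def by blast
qed

text \<open>Exchanging replicas 1 and j moves the identity to the j-th replica. The sum is completed
  by the term l = j, which is \<open>EE N g\<close>; subtracting it again turns the term with factor
  \<open>coincidence\<close> into one with factor \<open>coincidence - 1\<close>.\<close>

lemma gg_coincide:
  assumes g: "ov_observable N g" and N: "2 \<le> N" and j: "j \<in> {1..N}"
  shows "real N * EE (N + 1) (\<lambda>\<omega> r. g \<omega> (reindex id N r) * of_bool (r j = r (N + 1))) =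
    (\<Sum>l = 1..N. EE N (\<lambda>\<omega> r. g \<omega> r * of_bool (r j = r l))) - (1 - coincidence) * EE N g"
proof -
  define \<tau> where "\<tau> = Transposition.transpose 1 j"
  have bg: "observable N g" using g unfolding ov_observable_def by blast
  have \<tau>_in: "\<tau> i \<in> {1..N}" if "i \<in> {1..N}" for i
    using that j by (auto simp: \<tau>_def Transposition.transpose_def)
  have \<tau>_fix: "\<tau> (N + 1) = N + 1" using j by (auto simp: \<tau>_def Transposition.transpose_def)
  have \<tau>1: "\<tau> 1 = j" "\<tau> j = 1" by (auto simp: \<tau>_def)
  have inj: "inj_on \<tau> S" for S unfolding \<tau>_def by (rule inj_on_subset[OF inj_transpose]) simp
  have img: "\<tau> ` {1..N} \<subseteq> {1..N}" using \<tau>_in by blast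
  have img': "\<tau> ` {1..N + 1} \<subseteq> {1..N + 1}"
  proof -
    have "{1..N + 1} = insert (N + 1) {1..N}" by auto
    then show ?thesis using img \<tau>_fix by auto
  qed
  let ?g = "\<lambda>\<omega> r. g \<omega> (reindex \<tau> N r)"
  have g': "ov_observable N ?g" by (rule ov_observable_reindex[OF g img])
  have 1: "EE (N + 1) (\<lambda>\<omega> r. ?g \<omega> (reindex id N r) * of_bool (r 1 = r (N + 1))) =
    EE (N + 1) (\<lambda>\<omega> r. g \<omega> (reindex id N r) * of_bool (r j = r (N + 1)))"
  proof -
    let ?G = "\<lambda>\<omega> r. g \<omega> (reindex id N r) * of_bool (r j = r (N + 1))"
    have b: "observable (N + 1) ?G"
      by (intro observable_mult observable_restrict bg observable_coincide) simp
    have e: "?G \<omega> (reindex \<tau> (N + 1) r) = ?g \<omega> (reindex id N r) * of_bool (r 1 = r (N + 1))" for \<omega> r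
    proof -
      have "reindex id N (reindex \<tau> (N + 1) r) = reindex \<tau> N (reindex id N r)"
        using \<tau>_in by (auto simp: reindex_def restrict_def fun_eq_iff)
      moreover have "reindex \<tau> (N + 1) r j = r 1" "reindex \<tau> (N + 1) r (N + 1) = r (N + 1)"
        using j \<tau>1 \<tau>_fix by auto
      ultimately show ?thesis by simp
    qed
    show ?thesis using EE_reindex[OF b inj img'] unfolding e .
  qed
  have 2: "EE N ?g = EE N g" by (rule EE_reindex[OF bg inj img])
  have 3: "EE N (\<lambda>\<omega> r. ?g \<omega> r * of_bool (r 1 = r l)) = EE N (\<lambda>\<omega> r. g \<omega> r * of_bool (r j = r (\<tau> l)))"
    if l: "l \<in> {1..N}" for l
  proof -
    let ?G = "\<lambda>\<omega> r. g \<omega> r * of_bool (r j = r (\<tau> l))"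
    have b: "observable N ?G"
      by (intro observable_mult bg observable_coincide)
    have "\<tau> (\<tau> l) = l" by (simp add: \<tau>_def)
    then have e: "?G \<omega> (reindex \<tau> N r) = ?g \<omega> r * of_bool (r 1 = r l)" for \<omega> r
      using j \<tau>_in[OF l] \<tau>1 by simp
    show ?thesis using EE_reindex[OF b inj img] unfolding e .
  qed
  have 4: "(\<Sum>l = 2..N. EE N (\<lambda>\<omega> r. ?g \<omega> r * of_bool (r 1 = r l))) =
    (\<Sum>l = 1..N. EE N (\<lambda>\<omega> r. g \<omega> r * of_bool (r j = r l))) - EE N g"
  proof -
    have split: "{1..N} = insert 1 {2..N}" using N by auto
    have "(\<Sum>l = 1..N. EE N (\<lambda>\<omega> r. g \<omega> r * of_bool (r j = r l))) =
      (\<Sum>l\<in>\<tau> ` {1..N}. EE N (\<lambda>\<omega> r. g \<omega> r * of_bool (r j = r l)))"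
      using endo_inj_surj[OF _ img inj] by simp
    also have "\<dots> = (\<Sum>l = 1..N. EE N (\<lambda>\<omega> r. g \<omega> r * of_bool (r j = r (\<tau> l))))"
      by (simp add: sum.reindex[OF inj])
    also have "\<dots> = (\<Sum>l = 1..N. EE N (\<lambda>\<omega> r. ?g \<omega> r * of_bool (r 1 = r l)))"
      by (rule sum.cong[OF refl 3[symmetric]])
    also have "\<dots> = EE N g + (\<Sum>l = 2..N. EE N (\<lambda>\<omega> r. ?g \<omega> r * of_bool (r 1 = r l)))"
      unfolding split using 2 by simp
    finally show ?thesis by simp
  qed
  show ?thesis
    using gg_coincide_first[OF g' N] N unfolding 1 2 4 by (simp add: field_simps)
qed

end

section \<open>Adding replicas one at a time\<close>

definition subsets :: "nat \<Rightarrow> nat \<Rightarrow> nat set set" where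
  "subsets n j = {S. S \<subseteq> {1..n} \<and> card S = j}"

lemma finite_subsets [simp]: "finite (subsets n j)"
  unfolding subsets_def by (rule finite_subset[of _ "Pow {1..n}"]) auto

lemma subsets_0 [simp]: "subsets n 0 = {{}}"
proof -
  have "S = {}" if "S \<subseteq> {1..n}" "card S = 0" for S :: "nat set"
    using that finite_subset[OF that(1)] by simp
  then show ?thesis unfolding subsets_def by auto
qed

text \<open>Removing the marked element, and putting it back, matches sets with a marked member to
  smaller sets with a marked non-member.\<close>

lemma sum_subsets_pairs:
  fixes H :: "nat set \<Rightarrow> nat \<Rightarrow> 'b :: comm_monoid_add"
  shows "(\<Sum>S\<in>subsets n (Suc i). \<Sum>l\<in>S. H S l) =
    (\<Sum>T\<in>subsets n i. \<Sum>l\<in>{1..n} - T. H (insert l T) l)"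
proof -
  let ?i = "\<lambda>(T, l). (insert l T, l)" and ?j = "\<lambda>(S, l). (S - {l}, l)"
  have fin: "finite S" if "S \<in> subsets n j" for S j
    using that finite_subset[of S "{1..n}"] by (auto simp: subsets_def)
  have "(\<Sum>S\<in>subsets n (Suc i). \<Sum>l\<in>S. H S l) =
    (\<Sum>(S, l)\<in>Sigma (subsets n (Suc i)) (\<lambda>S. S). H S l)"
    by (rule sum.Sigma) (use fin in auto)
  also have "\<dots> = (\<Sum>(T, l)\<in>Sigma (subsets n i) (\<lambda>T. {1..n} - T). H (insert l T) l)"
  proof (rule sum.reindex_bij_witness[where i="?i" and j="?j"])
    fix x assume x: "x \<in> Sigma (subsets n (Suc i)) (\<lambda>S. S)"
    then obtain S l where xe: "x = (S, l)" and S: "S \<in> subsets n (Suc i)" and l: "l \<in> S" by auto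
    have "S - {l} \<in> subsets n i" using S l fin[OF S] by (auto simp: subsets_def)
    moreover have "l \<in> {1..n} - (S - {l})" using S l unfolding subsets_def by blast
    ultimately show "?j x \<in> Sigma (subsets n i) (\<lambda>T. {1..n} - T)"
      by (simp add: xe)
    show "?i (?j x) = x"
      using l by (simp add: xe insert_absorb)
    show "(case ?j x of (T, l) \<Rightarrow> H (insert l T) l) = (case x of (S, l) \<Rightarrow> H S l)"
      using l by (simp add: xe insert_absorb)
  next
    fix x assume x: "x \<in> Sigma (subsets n i) (\<lambda>T. {1..n} - T)"
    then obtain T l where xe: "x = (T, l)" and T: "T \<in> subsets n i" and l: "l \<in> {1..n}" "l \<notin> T" by auto
    have "insert l T \<in> subsets n (Suc i)" using T l fin[OF T] by (auto simp: subsets_def)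
    then show "?i x \<in> Sigma (subsets n (Suc i)) (\<lambda>S. S)"
      by (simp add: xe)
    show "?j (?i x) = x"
      using l by (simp add: xe)
  qed
  also have "\<dots> = (\<Sum>T\<in>subsets n i. \<Sum>l\<in>{1..n} - T. H (insert l T) l)"
    by (rule sum.Sigma[symmetric]) (use fin in auto)
  finally show ?thesis .
qed

text \<open>A set of size j + 1 is reached once for each of its members.\<close>

lemma sum_subsets_insert:
  fixes G :: "nat set \<Rightarrow> real"
  shows "(\<Sum>S\<in>subsets n j. \<Sum>l\<in>{1..n} - S. G (insert l S)) = (real j + 1) * (\<Sum>S\<in>subsets n (Suc j). G S)"
proof -
  have "(\<Sum>S\<in>subsets n j. \<Sum>l\<in>{1..n} - S. G (insert l S)) = (\<Sum>S\<in>subsets n (Suc j). \<Sum>l\<in>S. G S)"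
    by (rule sum_subsets_pairs[symmetric])
  also have "\<dots> = (\<Sum>S\<in>subsets n (Suc j). (real j + 1) * G S)"
    by (rule sum.cong) (auto simp: subsets_def)
  finally show ?thesis by (simp add: sum_distrib_left)
qed

text \<open>A set of size j is reached once for each of the n - j indices outside it.\<close>

lemma sum_subsets_remove:
  fixes G :: "nat set \<Rightarrow> real"
  shows "(\<Sum>S\<in>subsets n (Suc j). \<Sum>l\<in>S. G (S - {l})) = (real n - real j) * (\<Sum>S\<in>subsets n j. G S)"
proof -
  have "(\<Sum>S\<in>subsets n (Suc j). \<Sum>l\<in>S. G (S - {l})) =
    (\<Sum>S\<in>subsets n j. \<Sum>l\<in>{1..n} - S. G (insert l S - {l}))"
    by (rule sum_subsets_pairs)
  also have "\<dots> = (\<Sum>S\<in>subsets n j. (real n - real j) * G S)"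
  proof (rule sum.cong[OF refl])
    fix S assume S: "S \<in> subsets n j"
    then have S': "S \<subseteq> {1..n}" "card S = j" by (auto simp: subsets_def)
    have "(\<Sum>l\<in>{1..n} - S. G (insert l S - {l})) = (\<Sum>l\<in>{1..n} - S. G S)"
      by (rule sum.cong) auto
    moreover have "real (card ({1..n} - S)) = real n - real j"
    proof -
      have "card ({1..n} - S) = n - j" using card_Diff_subset[of S "{1..n}"] S' finite_subset[OF S'(1)] by simp
      moreover have "j \<le> n" using card_mono[of "{1..n}" S] S' by simp
      ultimately show ?thesis by simp
    qed
    ultimately show "(\<Sum>l\<in>{1..n} - S. G (insert l S - {l})) = (real n - real j) * G S" by simp
  qed
  finally show ?thesis by (simp add: sum_distrib_left)
qed

text \<open>As signs square to one, this is how the index set of a product of signs changes when the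
  sign of replica l is multiplied in.\<close>

definition toggle :: "'b \<Rightarrow> 'b set \<Rightarrow> 'b set" where
  "toggle l J = (if l \<in> J then J - {l} else insert l J)"

text \<open>\<open>Q s J\<close> stands for the expectation of an observable of the first \<open>n\<close> replicas on the event that
  exactly \<open>s\<close> configurations occur an odd number of times among the replicas in \<open>J\<close>, and \<open>c\<close> for the
  probability that two replicas coincide.\<close>

locale replica_recursion =
  fixes n :: nat and c :: real and Q :: "int \<Rightarrow> nat set \<Rightarrow> real"
  assumes add_replica: "\<And>N J s. n \<le> N \<Longrightarrow> J \<subseteq> {1..N} \<Longrightarrow>
      real N * Q s (insert (N + 1) J) = (\<Sum>l = 1..N. Q s (toggle l J))
        + (1 - c) * (of_int (s - 1) * Q (s - 1) J - of_int (s + 1) * Q (s + 1) J)"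
    and exchange: "\<And>S k l s. S \<subseteq> {1..n} \<Longrightarrow> l \<in> {n + 1..n + Suc k} \<Longrightarrow>
      Q s (S \<union> ({n + 1..n + Suc k} - {l})) = Q s (S \<union> {n + 1..n + k})"
    and Q_empty: "\<And>s. s \<noteq> 0 \<Longrightarrow> Q s {} = 0"
begin

section \<open>The recursion for the coefficients and their vanishing\<close>

definition q :: "int \<Rightarrow> nat \<Rightarrow> nat \<Rightarrow> real" where
  "q s j k = (\<Sum>S\<in>subsets n j. Q s (S \<union> {n + 1..n + k}))"

text \<open>The share of those l that leave S, with none for empty S; n - i counts the sets S from
  which a given set of size i is obtained.\<close>

definition lowered :: "int \<Rightarrow> nat \<Rightarrow> nat \<Rightarrow> real" where
  "lowered s j k = (case j of 0 \<Rightarrow> 0 | Suc i \<Rightarrow> (real n - real i) * q s i k)"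

text \<open>The share of the extra replicas that leave; by \<open>exchange\<close> it does not
  matter which of them goes, hence the multiplicity i + 1.\<close>

definition dropped :: "int \<Rightarrow> nat \<Rightarrow> nat \<Rightarrow> real" where
  "dropped s j k = (case k of 0 \<Rightarrow> 0 | Suc i \<Rightarrow> (real i + 1) * q s j i)"

text \<open>\<open>add_replica\<close> with N = n + k is summed over S. The toggled replica lies in
  S, among the first n but outside S, or among the k extra ones; these cases give the first three
  terms.\<close>

lemma q_rec:
  "(real n + real k) * q s j (Suc k) = lowered s j k + (real j + 1) * q s (Suc j) k + dropped s j k
     + (1 - c) * (of_int (s - 1) * q (s - 1) j k - of_int (s + 1) * q (s + 1) j k)"
proof -
  let ?E = "{n + 1..n + k}"
  have one: "(real n + real k) * Q s (S \<union> {n + 1..n + Suc k}) =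
     (\<Sum>l\<in>S. Q s (S - {l} \<union> ?E)) + (\<Sum>l\<in>{1..n} - S. Q s (insert l S \<union> ?E))
      + (\<Sum>l\<in>?E. Q s (S \<union> (?E - {l})))
      + (1 - c) * (of_int (s - 1) * Q (s - 1) (S \<union> ?E) - of_int (s + 1) * Q (s + 1) (S \<union> ?E))"
    if S: "S \<in> subsets n j" for S
  proof -
    have S1: "S \<subseteq> {1..n}" using S by (simp add: subsets_def)
    have finS: "finite S" using S1 finite_subset by blast
    have J: "S \<union> ?E \<subseteq> {1..n + k}" using S1 by force
    have ins: "insert (n + k + 1) (S \<union> ?E) = S \<union> {n + 1..n + Suc k}" by auto
    have split: "{1..n + k} = S \<union> (({1..n} - S) \<union> ?E)" using S1 by force
    have d1: "S \<inter> (({1..n} - S) \<union> ?E) = {}" using S1 by force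
    have d2: "({1..n} - S) \<inter> ?E = {}" by auto
    have t1: "toggle l (S \<union> ?E) = S - {l} \<union> ?E" if "l \<in> S" for l
      using that d1 by (auto simp: toggle_def)
    have t2: "toggle l (S \<union> ?E) = insert l S \<union> ?E" if "l \<in> {1..n} - S" for l
      using that by (auto simp: toggle_def)
    have t3: "toggle l (S \<union> ?E) = S \<union> (?E - {l})" if "l \<in> ?E" for l
      using that d1 by (auto simp: toggle_def)
    have "(\<Sum>l = 1..n + k. Q s (toggle l (S \<union> ?E))) =
      (\<Sum>l\<in>S. Q s (toggle l (S \<union> ?E))) + ((\<Sum>l\<in>{1..n} - S. Q s (toggle l (S \<union> ?E)))
        + (\<Sum>l\<in>?E. Q s (toggle l (S \<union> ?E))))"
      unfolding split by (subst sum.union_disjoint, use finS d1 in auto)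
        (subst sum.union_disjoint, use d2 in auto)
    also have "\<dots> = (\<Sum>l\<in>S. Q s (S - {l} \<union> ?E)) + ((\<Sum>l\<in>{1..n} - S. Q s (insert l S \<union> ?E))
      + (\<Sum>l\<in>?E. Q s (S \<union> (?E - {l}))))"
      by (intro arg_cong2[where f="(+)"] sum.cong refl arg_cong[where f="Q s"] t1 t2 t3)
    finally show ?thesis
      using add_replica[of "n + k" "S \<union> ?E" s] J unfolding ins by simp
  qed
  have 1: "(\<Sum>S\<in>subsets n j. \<Sum>l\<in>S. Q s (S - {l} \<union> ?E)) = lowered s j k"
  proof (cases j)
    case 0
    then show ?thesis by (simp add: lowered_def)
  next
    case (Suc i)
    show ?thesis
      unfolding Suc lowered_def q_def nat.case
      by (rule sum_subsets_remove[where G="\<lambda>S. Q s (S \<union> ?E)"])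
  qed
  have 2: "(\<Sum>S\<in>subsets n j. \<Sum>l\<in>{1..n} - S. Q s (insert l S \<union> ?E)) = (real j + 1) * q s (Suc j) k"
    unfolding q_def by (rule sum_subsets_insert[where G="\<lambda>S. Q s (S \<union> ?E)"])
  have 3: "(\<Sum>S\<in>subsets n j. \<Sum>l\<in>?E. Q s (S \<union> (?E - {l}))) = dropped s j k"
  proof (cases k)
    case 0
    then show ?thesis by (simp add: dropped_def)
  next
    case (Suc i)
    have "(\<Sum>l\<in>?E. Q s (S \<union> (?E - {l}))) = (real i + 1) * Q s (S \<union> {n + 1..n + i})"
      if "S \<in> subsets n j" for S
    proof -
      have "(\<Sum>l\<in>?E. Q s (S \<union> (?E - {l}))) = (\<Sum>l\<in>?E. Q s (S \<union> {n + 1..n + i}))"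
        unfolding Suc by (rule sum.cong[OF refl exchange]) (use that in \<open>auto simp: subsets_def\<close>)
      then show ?thesis using Suc by simp
    qed
    then show ?thesis unfolding q_def dropped_def by (simp add: Suc sum_distrib_left)
  qed
  have "(real n + real k) * q s j (Suc k) =
     (\<Sum>S\<in>subsets n j. (\<Sum>l\<in>S. Q s (S - {l} \<union> ?E)) + (\<Sum>l\<in>{1..n} - S. Q s (insert l S \<union> ?E))
      + (\<Sum>l\<in>?E. Q s (S \<union> (?E - {l})))
      + (1 - c) * (of_int (s - 1) * Q (s - 1) (S \<union> ?E) - of_int (s + 1) * Q (s + 1) (S \<union> ?E)))"
    unfolding q_def sum_distrib_left by (rule sum.cong[OF refl one])
  also have "\<dots> = lowered s j k + (real j + 1) * q s (Suc j) k + dropped s j k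
     + (1 - c) * (of_int (s - 1) * q (s - 1) j k - of_int (s + 1) * q (s + 1) j k)"
    unfolding 1[symmetric] 2[symmetric] 3[symmetric]
    by (simp add: q_def sum.distrib sum_subtractf sum_distrib_left algebra_simps)
  finally show ?thesis .
qed

text \<open>The Taylor coefficients of the n-th inverse power of the normalising factor 1 + x
  X.\<close>

definition b :: "nat \<Rightarrow> real" where "b k = (- real n) gchoose k"

lemma b_Suc: "(real k + 1) * b (Suc k) = - (real n + real k) * b k"
  unfolding b_def using gbinomial_mult_1[of "- real n" k] by (simp add: algebra_simps)

text \<open>The coefficient of x^m: the subset of the first n replicas contributes degree m - k and
  the k extra replicas contribute degree k.\<close>

definition coef :: "int \<Rightarrow> nat \<Rightarrow> real" where
  "coef s m = (\<Sum>k\<le>m. b k * q s (m - k) k)"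

text \<open>The operator L of the overview, applied to the m-th coefficient; it acts on the variable
  s only.\<close>

definition shifted :: "int \<Rightarrow> nat \<Rightarrow> real" where
  "shifted s m = (1 - c) * (of_int (s - 1) * coef (s - 1) m - of_int (s + 1) * coef (s + 1) m)"

text \<open>The factor m + 1 is split as k + (m + 1 - k). The part with k is rewritten by
  \<open>b_Suc\<close> and \<open>q_rec\<close>, and its terms that enlarge the subset cancel the
  part with m + 1 - k.\<close>

lemma coef_Suc:
  "(real m + 1) * coef s (Suc m) = - (\<Sum>k\<le>m. b k * (lowered s (m - k) k + dropped s (m - k) k)) - shifted s m"
proof -
  have "(real m + 1) * coef s (Suc m) =
    (\<Sum>k\<le>Suc m. real k * b k * q s (Suc m - k) k) + (\<Sum>k\<le>Suc m. real (Suc m - k) * (b k * q s (Suc m - k) k))"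
    unfolding coef_def sum_distrib_left sum.distrib[symmetric]
    by (rule sum.cong) (auto simp: of_nat_diff algebra_simps)
  also have "(\<Sum>k\<le>Suc m. real k * b k * q s (Suc m - k) k) = (\<Sum>k\<le>m. (real k + 1) * b (Suc k) * q s (m - k) (Suc k))"
    by (subst sum.atMost_Suc_shift) (simp add: add.commute)
  also have "\<dots> = (\<Sum>k\<le>m. - b k * ((real n + real k) * q s (m - k) (Suc k)))"
    unfolding b_Suc by (simp add: algebra_simps)
  also have "\<dots> = (\<Sum>k\<le>m. - b k * (lowered s (m - k) k + (real (m - k) + 1) * q s (Suc (m - k)) k + dropped s (m - k) k
     + (1 - c) * (of_int (s - 1) * q (s - 1) (m - k) k - of_int (s + 1) * q (s + 1) (m - k) k)))"
    unfolding q_rec ..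
  also have "\<dots> = - (\<Sum>k\<le>m. b k * (lowered s (m - k) k + dropped s (m - k) k))
      - (\<Sum>k\<le>m. real (Suc m - k) * (b k * q s (Suc m - k) k)) - shifted s m"
  proof -
    have "- b k * (lowered s (m - k) k + (real (m - k) + 1) * q s (Suc (m - k)) k + dropped s (m - k) k
     + (1 - c) * (of_int (s - 1) * q (s - 1) (m - k) k - of_int (s + 1) * q (s + 1) (m - k) k)) =
       - (b k * (lowered s (m - k) k + dropped s (m - k) k)) - real (Suc m - k) * (b k * q s (Suc m - k) k)
        - (1 - c) * (of_int (s - 1) * (b k * q (s - 1) (m - k) k) - of_int (s + 1) * (b k * q (s + 1) (m - k) k))"
      if "k \<le> m" for k
    proof -
      have "Suc m - k = Suc (m - k)" using that by (rule Suc_diff_le)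
      then show ?thesis by (simp add: algebra_simps)
    qed
    then show ?thesis
      unfolding shifted_def coef_def
      by (simp add: sum_subtractf sum_negf sum_distrib_left right_diff_distrib mult.assoc)
  qed
  also have "(\<Sum>k\<le>m. real (Suc m - k) * (b k * q s (Suc m - k) k)) = (\<Sum>k\<le>Suc m. real (Suc m - k) * (b k * q s (Suc m - k) k))"
    by simp
  finally show ?thesis by simp
qed

text \<open>In front of b_k, shrinking the subset yields n - (m - k), and removing an extra replica
  yields -(n + k) after \<open>b_Suc\<close>. The total -m does not depend on k, so it factors out
  and leaves the m-th coefficient.\<close>

lemma coef_rec:
  "(real m + 2) * coef s (Suc (Suc m)) = real m * coef s m - shifted s (Suc m)"
proof -
  have 1: "(\<Sum>k\<le>Suc m. b k * lowered s (Suc m - k) k) = (\<Sum>k\<le>m. b k * ((real n - real (m - k)) * q s (m - k) k))"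
  proof -
    have "(\<Sum>k\<le>Suc m. b k * lowered s (Suc m - k) k) = (\<Sum>k\<le>m. b k * lowered s (Suc m - k) k)"
      by (simp add: lowered_def)
    also have "\<dots> = (\<Sum>k\<le>m. b k * ((real n - real (m - k)) * q s (m - k) k))"
      by (rule sum.cong) (auto simp: lowered_def Suc_diff_le)
    finally show ?thesis .
  qed
  have 2: "(\<Sum>k\<le>Suc m. b k * dropped s (Suc m - k) k) = - (\<Sum>k\<le>m. b k * ((real n + real k) * q s (m - k) k))"
  proof -
    have "(\<Sum>k\<le>Suc m. b k * dropped s (Suc m - k) k) = (\<Sum>k\<le>m. ((real k + 1) * b (Suc k)) * q s (m - k) k)"
      by (subst sum.atMost_Suc_shift) (simp add: dropped_def algebra_simps)
    then show ?thesis unfolding b_Suc by (simp add: sum_negf[symmetric] algebra_simps)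
  qed
  have "(\<Sum>k\<le>Suc m. b k * (lowered s (Suc m - k) k + dropped s (Suc m - k) k)) =
    (\<Sum>k\<le>m. b k * ((real n - real (m - k)) * q s (m - k) k)) - (\<Sum>k\<le>m. b k * ((real n + real k) * q s (m - k) k))"
    unfolding distrib_left sum.distrib 1 2 by simp
  also have "\<dots> = (\<Sum>k\<le>m. - real m * (b k * q s (m - k) k))"
    unfolding sum_subtractf[symmetric]
    by (rule sum.cong) (auto simp: of_nat_diff algebra_simps)
  also have "\<dots> = - real m * coef s m" unfolding coef_def by (simp add: sum_distrib_left)
  finally have "(\<Sum>k\<le>Suc m. b k * (lowered s (Suc m - k) k + dropped s (Suc m - k) k)) = - real m * coef s m" .
  from coef_Suc[of "Suc m" s, unfolded this] show ?thesis by (simp add: algebra_simps)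
qed

lemma coef_eq_0: "coef s (Suc m) = 0"
proof -
  have c0: "coef s 0 = 0" if "s \<noteq> 0" for s
    using Q_empty[OF that] by (simp add: coef_def q_def)
  have "shifted s 0 = 0" for s
    using c0[of "s - 1"] c0[of "s + 1"] by (cases "s = 1"; cases "s = -1") (auto simp: shifted_def)
  then have c1: "coef s (Suc 0) = 0" for s
    using coef_Suc[of 0 s] by (simp add: lowered_def dropped_def)
  \<comment> \<open>The induction carries the product with m, since the coefficient of order 0 may
    be nonzero at s = 0 but enters the recursion with the factor m = 0.\<close>
  have "(\<forall>s. real m * coef s m = 0) \<and> (\<forall>s. coef s (Suc m) = 0)" for m
  proof (induction m)
    case 0
    then show ?case using c1 by simp
  next
    case (Suc m)
    then have IH: "real m * coef s m = 0" "coef s (Suc m) = 0" for s by blast+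
    have z: "shifted s (Suc m) = 0" for s by (simp add: shifted_def IH(2))
    have "(real m + 2) * coef s (Suc (Suc m)) = 0" for s
      using coef_rec[of m s] IH(1)[of s] z[of s] by linarith
    moreover have "real m + 2 \<noteq> 0" by linarith
    ultimately have "coef s (Suc (Suc m)) = 0" for s by (metis mult_eq_0_iff)
    then show ?case using IH(2) by simp
  qed
  then show ?thesis by blast
qed

end

section \<open>Configurations of odd multiplicity\<close>

definition odd_set :: "nat set \<Rightarrow> (nat \<Rightarrow> 'a) \<Rightarrow> 'a set" where
  "odd_set J r = {a. odd (card {i \<in> J. r i = a})}"

lemma odd_set_empty [simp]: "odd_set {} r = {}"
  by (simp add: odd_set_def)

lemma odd_set_subset: "odd_set J r \<subseteq> r ` J"
proof
  fix a assume "a \<in> odd_set J r"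
  then have "{i \<in> J. r i = a} \<noteq> {}" unfolding odd_set_def by force
  then show "a \<in> r ` J" by blast
qed

lemma finite_odd_set [simp]: "finite J \<Longrightarrow> finite (odd_set J r)"
  by (rule finite_subset[OF odd_set_subset]) simp

lemma odd_set_cong: "(\<And>i. i \<in> J \<Longrightarrow> r i = \<tau> i) \<Longrightarrow> odd_set J r = odd_set J \<tau>"
proof -
  assume eq: "\<And>i. i \<in> J \<Longrightarrow> r i = \<tau> i"
  have "{i \<in> J. r i = a} = {i \<in> J. \<tau> i = a}" for a
    by (rule Collect_cong) (simp add: eq cong: conj_cong)
  then show ?thesis by (simp add: odd_set_def)
qed

text \<open>Only the multiplicity of \<open>r l\<close> changes, and it changes by one.\<close>

lemma odd_set_toggle:
  assumes J: "finite J"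
  shows "odd_set (toggle l J) r = toggle (r l) (odd_set J r)"
proof -
  have other: "{i \<in> toggle l J. r i = a} = {i \<in> J. r i = a}" if "a \<noteq> r l" for a
    using that by (auto simp: toggle_def)
  have same: "odd (card {i \<in> toggle l J. r i = r l}) \<longleftrightarrow> even (card {i \<in> J. r i = r l})"
  proof (cases "l \<in> J")
    case True
    have "{i \<in> toggle l J. r i = r l} = {i \<in> J. r i = r l} - {l}"
      using True by (auto simp: toggle_def)
    moreover have "card {i \<in> J. r i = r l} = Suc (card ({i \<in> J. r i = r l} - {l}))"
      by (rule card.remove) (use J True in auto)
    ultimately show ?thesis by simp
  next
    case False
    have "{i \<in> toggle l J. r i = r l} = insert l {i \<in> J. r i = r l}"
      using False by (auto simp: toggle_def)
    then show ?thesis using J False by simp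
  qed
  show ?thesis
  proof (rule set_eqI)
    fix a
    show "a \<in> odd_set (toggle l J) r \<longleftrightarrow> a \<in> toggle (r l) (odd_set J r)"
    proof (cases "a = r l")
      case True
      then show ?thesis using same by (simp add: odd_set_def toggle_def)
    next
      case False
      then show ?thesis using other[OF False] by (simp add: odd_set_def toggle_def)
    qed
  qed
qed

lemma card_toggle:
  "finite S \<Longrightarrow> int (card (toggle a S)) = int (card S) + (if a \<in> S then -1 else 1)"
proof (cases "a \<in> S")
  case True
  assume "finite S"
  then have "card S = Suc (card (S - {a}))" using True by (rule card.remove)
  then show ?thesis using True by (simp add: toggle_def)
qed (simp add: toggle_def)

definition odd_is :: "nat set \<Rightarrow> int \<Rightarrow> (nat \<Rightarrow> 'a) \<Rightarrow> real" where
  "odd_is J s r = of_bool (int (card (odd_set J r)) = s)"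

text \<open>Splitting by whether replica l hits a configuration of odd multiplicity is what couples
  s to its two neighbours.\<close>

lemma odd_is_toggle:
  assumes "finite J"
  shows "odd_is (toggle l J) s r = odd_is J (s - 1) r * (1 - of_bool (r l \<in> odd_set J r))
    + odd_is J (s + 1) r * of_bool (r l \<in> odd_set J r)"
  using card_toggle[OF finite_odd_set[OF assms], of "r l" r]
  by (cases "r l \<in> odd_set J r") (auto simp: odd_is_def odd_set_toggle[OF assms])

definition block_size :: "nat \<Rightarrow> nat \<Rightarrow> (nat \<Rightarrow> 'a) \<Rightarrow> nat" where
  "block_size N j r = card {i \<in> {1..N}. r i = r j}"

text \<open>Dividing by the block size turns a sum over replicas into a sum over configurations.\<close>

definition odd_weight :: "nat \<Rightarrow> nat set \<Rightarrow> nat \<Rightarrow> (nat \<Rightarrow> 'a) \<Rightarrow> real" where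
  "odd_weight N J j r = of_bool (r j \<in> odd_set J r) / real (block_size N j r)"

lemma block_size_pos: "j \<in> {1..N} \<Longrightarrow> 0 < block_size N j r"
  unfolding block_size_def by (subst card_gt_0_iff) auto

lemma sum_odd_weight_block:
  "j \<in> {1..N} \<Longrightarrow> (\<Sum>l = 1..N. odd_weight N J j r * of_bool (r j = r l)) = of_bool (r j \<in> odd_set J r)"
proof -
  assume j: "j \<in> {1..N}"
  have "(\<Sum>l = 1..N. of_bool (r j = r l) :: real) = real (block_size N j r)"
  proof -
    have "{1..N} \<inter> {l. r j = r l} = {i \<in> {1..N}. r i = r j}" by auto
    then show ?thesis by (simp add: block_size_def)
  qed
  moreover have "(\<Sum>l = 1..N. odd_weight N J j r * of_bool (r j = r l)) =
    odd_weight N J j r * (\<Sum>l = 1..N. of_bool (r j = r l))"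
    by (simp only: sum_distrib_left)
  ultimately show ?thesis
    using block_size_pos[OF j, of r] by (simp add: odd_weight_def)
qed

text \<open>All replicas at \<open>a\<close> share one block, so their weights add up to 1 if
  \<open>a\<close> is odd; such an \<open>a\<close> is occupied by a replica of \<open>J\<close>,
  hence by one of the first N, and the block is not empty.\<close>

lemma sum_odd_weight_at:
  assumes "J \<subseteq> {1..N}"
  shows "(\<Sum>j = 1..N. odd_weight N J j r * of_bool (r j = a)) = of_bool (a \<in> odd_set J r)"
proof -
  let ?D = "{j \<in> {1..N}. r j = a}"
  have "(\<Sum>j = 1..N. odd_weight N J j r * of_bool (r j = a)) = (\<Sum>j\<in>?D. odd_weight N J j r)"
    by (rule sum.mono_neutral_cong_right) auto
  also have "\<dots> = (\<Sum>j\<in>?D. of_bool (a \<in> odd_set J r) / real (card ?D))"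
    by (rule sum.cong) (auto simp: odd_weight_def block_size_def)
  also have "\<dots> = of_bool (a \<in> odd_set J r)"
  proof (cases "a \<in> odd_set J r")
    case True
    then have "a \<in> r ` J" using odd_set_subset[of J r] by (rule subsetD[rotated])
    then obtain i where "i \<in> J" "r i = a" by (rule imageE) simp
    then have "i \<in> ?D" using assms by auto
    then have "0 < card ?D" by (subst card_gt_0_iff) auto
    then have "real (card ?D) \<noteq> 0" by linarith
    then show ?thesis
      by (simp only: sum_constant times_divide_eq_right nonzero_mult_div_cancel_left not_False_eq_True)
  qed simp
  finally show ?thesis .
qed

text \<open>On the event selected by \<open>odd_is\<close> the total weight is s; the factor s in
  \<open>Q_hit\<close>, and with it the factors in L, come from here.\<close>

lemma sum_odd_weight:
  assumes "J \<subseteq> {1..N}"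
  shows "(\<Sum>j = 1..N. odd_weight N J j r) = real (card (odd_set J r))"
proof -
  have "(\<Sum>j = 1..N. odd_weight N J j r) = (\<Sum>a\<in>r ` {1..N}. \<Sum>j\<in>{x \<in> {1..N}. r x = a}. odd_weight N J j r)"
    by (rule sum.image_gen) simp
  also have "\<dots> = (\<Sum>a\<in>r ` {1..N}. \<Sum>j = 1..N. odd_weight N J j r * of_bool (r j = a))"
    by (intro sum.cong refl sum.mono_neutral_cong_left) auto
  also have "\<dots> = (\<Sum>a\<in>r ` {1..N}. of_bool (a \<in> odd_set J r))"
    by (intro sum.cong refl sum_odd_weight_at assms)
  also have "\<dots> = real (card (r ` {1..N} \<inter> odd_set J r))" by simp
  also have "r ` {1..N} \<inter> odd_set J r = odd_set J r"
    using odd_set_subset[of J r] assms by blast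
  finally show ?thesis .
qed

text \<open>Both images are copies of the quotient of \<open>I\<close> by the same equivalence
  relation.\<close>

lemma card_image_eq:
  assumes "\<And>i j. i \<in> I \<Longrightarrow> j \<in> I \<Longrightarrow> f i = f j \<longleftrightarrow> g i = g j"
  shows "card (f ` I) = card (g ` I)"
proof (rule bij_betw_same_card)
  let ?h = "\<lambda>x. g (inv_into I f x)"
  have h: "?h (f i) = g i" if "i \<in> I" for i
  proof -
    have "inv_into I f (f i) \<in> I" "f (inv_into I f (f i)) = f i"
      using that by (auto intro: inv_into_into f_inv_into_f)
    then show ?thesis using assms that by blast
  qed
  show "bij_betw ?h (f ` I) (g ` I)"
    unfolding bij_betw_def
  proof
    show "inj_on ?h (f ` I)"
      by (rule inj_onI) (use h assms in auto)
    show "?h ` f ` I = g ` I" using h by (force simp: image_iff)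
  qed
qed

lemma pattern_eqD:
  assumes "pattern N r = pattern N \<tau>" "i \<in> {1..N}" "j \<in> {1..N}"
  shows "r i = r j \<longleftrightarrow> \<tau> i = \<tau> j"
proof -
  have "(i, j) \<in> pattern N r \<longleftrightarrow> (i, j) \<in> pattern N \<tau>" using assms(1) by simp
  then show ?thesis using assms(2,3) by (simp add: pattern_def)
qed

lemma pattern_odd_set:
  assumes p: "pattern N r = pattern N \<tau>" and J: "J \<subseteq> {1..N}" and j: "j \<in> {1..N}"
  shows "r j \<in> odd_set J r \<longleftrightarrow> \<tau> j \<in> odd_set J \<tau>"
proof -
  have "{i \<in> J. r i = r j} = {i \<in> J. \<tau> i = \<tau> j}"
    using pattern_eqD[OF p _ j] J by blast
  then show ?thesis by (simp add: odd_set_def)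
qed

text \<open>The pattern determines which replicas of \<open>J\<close> sit at odd configurations; the
  odd set is the image of these replicas, and its size is the number of groups they form.\<close>

lemma pattern_fun_odd_is:
  assumes J: "J \<subseteq> {1..N}"
  shows "pattern_fun A N (odd_is J s)"
  unfolding pattern_fun_def
proof (intro ballI impI)
  fix r \<tau> :: "nat \<Rightarrow> 'a" assume p: "pattern N r = pattern N \<tau>"
  let ?I = "{j \<in> J. r j \<in> odd_set J r}"
  have I: "?I = {j \<in> J. \<tau> j \<in> odd_set J \<tau>}"
    using pattern_odd_set[OF p J] J by blast
  have "odd_set J r = r ` ?I" using odd_set_subset[of J r] by blast
  moreover have "odd_set J \<tau> = \<tau> ` ?I" unfolding I using odd_set_subset[of J \<tau>] by blast
  moreover have "card (r ` ?I) = card (\<tau> ` ?I)"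
    by (rule card_image_eq, rule pattern_eqD[OF p]) (use J in auto)
  ultimately show "odd_is J s r = odd_is J s \<tau>" by (simp add: odd_is_def)
qed

lemma pattern_fun_odd_weight:
  assumes J: "J \<subseteq> {1..N}" and j: "j \<in> {1..N}"
  shows "pattern_fun A N (odd_weight N J j)"
  unfolding pattern_fun_def
proof (intro ballI impI)
  fix r \<tau> :: "nat \<Rightarrow> 'a" assume p: "pattern N r = pattern N \<tau>"
  have "{i \<in> {1..N}. r i = r j} = {i \<in> {1..N}. \<tau> i = \<tau> j}"
    using pattern_eqD[OF p _ j] by blast
  then show "odd_weight N J j r = odd_weight N J j \<tau>"
    unfolding odd_weight_def block_size_def using pattern_odd_set[OF p J j] by simp
qed

lemma odd_is_reindex_id:
  assumes "J \<subseteq> {1..K}"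
  shows "odd_is J s (reindex id K r) = odd_is J s r"
proof -
  have "odd_set J (reindex id K r) = odd_set J r"
    by (rule odd_set_cong) (use assms in auto)
  then show ?thesis by (simp add: odd_is_def)
qed

lemma odd_weight_reindex_id:
  assumes J: "J \<subseteq> {1..N}" and j: "j \<in> {1..N}"
  shows "odd_weight N J j (reindex id N r) = odd_weight N J j r"
proof -
  have "odd_set J (reindex id N r) = odd_set J r"
    by (rule odd_set_cong) (use assms in auto)
  moreover have "{i \<in> {1..N}. reindex id N r i = reindex id N r j} = {i \<in> {1..N}. r i = r j}"
    using j by auto
  ultimately show ?thesis using j by (simp add: odd_weight_def block_size_def)
qed

lemma odd_set_image:
  assumes "inj_on \<pi> J"
  shows "odd_set (\<pi> ` J) r = odd_set J (\<lambda>i. r (\<pi> i))"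
proof -
  have "card {i \<in> \<pi> ` J. r i = a} = card {i \<in> J. r (\<pi> i) = a}" for a
  proof -
    have "{i \<in> \<pi> ` J. r i = a} = \<pi> ` {i \<in> J. r (\<pi> i) = a}" by auto
    moreover have "inj_on \<pi> {i \<in> J. r (\<pi> i) = a}" by (rule inj_on_subset[OF assms]) auto
    ultimately show ?thesis by (simp add: card_image)
  qed
  then show ?thesis by (simp add: odd_set_def)
qed

section \<open>The recursion for averages of a function of the overlaps\<close>

locale gg_overlap_fun = gg_random_measure M A w \<xi>
  for M :: "'o measure" and A :: "'a set" and w :: "'a \<Rightarrow> 'o \<Rightarrow> real"
    and \<xi> :: "'a \<Rightarrow> 'o \<Rightarrow> 'h :: {real_inner, banach, second_countable_topology}" +
  fixes n :: nat and F :: "(nat \<times> nat \<Rightarrow> real) \<Rightarrow> real"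
  assumes n: "2 \<le> n" and F: "overlap_fun n F"
begin

abbreviation obs :: "nat set \<Rightarrow> int \<Rightarrow> 'o \<Rightarrow> (nat \<Rightarrow> 'a) \<Rightarrow> real" where
  "obs J s \<omega> r \<equiv> ov n F \<omega> r * odd_is J s r"

text \<open>The recursion wants a quantity that depends on \<open>J\<close> alone, so a number of
  replicas is fixed that suffices for both \<open>F\<close> and \<open>J\<close>; the inserted 0
  covers the empty set. By \<open>Q_eq\<close>, every sufficient number gives the same
  value.\<close>

definition Q :: "int \<Rightarrow> nat set \<Rightarrow> real" where
  "Q s J = EE (n + Max (insert 0 J)) (obs J s)"

lemma ov_observable_odd_is:
  assumes "n \<le> N" "J \<subseteq> {1..N}"
  shows "ov_observable N (obs J s)"
  using ov_observable_mult[OF ov_observable_ov[OF F assms(1)]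
      ov_observable_pattern_fun[OF pattern_fun_odd_is[OF assms(2)]]] .

lemma ov_observable_bounded: "ov_observable N g \<Longrightarrow> observable N g"
  by (simp add: ov_observable_def)

lemma EE_odd_is_restrict:
  assumes N: "n \<le> N" "J \<subseteq> {1..N}" and L: "N \<le> L"
  shows "EE L (obs J s) = EE N (obs J s)"
  using EE_restrict[OF ov_observable_bounded[OF ov_observable_odd_is[OF N, of s]] L]
  by (simp add: ov_restrict[OF N(1)] odd_is_reindex_id[OF N(2)])

lemma Q_eq:
  assumes N: "n \<le> N" "J \<subseteq> {1..N}"
  shows "Q s J = EE N (obs J s)"
proof -
  have fin: "finite J" using N(2) finite_subset by blast
  let ?m = "n + Max (insert 0 J)"
  have Jm: "J \<subseteq> {1..?m}"
  proof
    fix i assume "i \<in> J"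
    then have "i \<le> Max (insert 0 J)" "1 \<le> i" using fin N(2) by auto
    then show "i \<in> {1..?m}" by simp
  qed
  have "EE (N + ?m) (obs J s) = Q s J"
    unfolding Q_def by (rule EE_odd_is_restrict) (use Jm in auto)
  moreover have "EE (N + ?m) (obs J s) =
     EE N (obs J s)"
    by (rule EE_odd_is_restrict) (use N in auto)
  ultimately show ?thesis by simp
qed

text \<open>Hitting the odd set means hitting one of its configurations, and
  \<open>odd_weight\<close> spreads that event over the replicas sitting there.
  \<open>gg_coincide\<close> is applied to each of them and summed; the corrections add up to the
  last term because the total weight is s.\<close>

lemma Q_hit:
  assumes N: "n \<le> N" and J: "J \<subseteq> {1..N}"
  shows "real N * EE (N + 1) (\<lambda>\<omega> r. ov n F \<omega> r * odd_is J s r * of_bool (r (N + 1) \<in> odd_set J r)) =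
    EE N (\<lambda>\<omega> r. ov n F \<omega> r * odd_is J s r * (\<Sum>j = 1..N. of_bool (r j \<in> odd_set J r)))
     - (1 - coincidence) * of_int s * Q s J"
proof -
  let ?f = "obs J s"
  let ?h = "odd_weight N J"
  have N2: "2 \<le> N" using N n by simp
  have obs: "ov_observable N (\<lambda>\<omega> r. ?f \<omega> r * ?h j r)" if "j \<in> {1..N}" for j
    using ov_observable_mult[OF ov_observable_odd_is[OF N J]
        ov_observable_pattern_fun[OF pattern_fun_odd_weight[OF J that]]] .
  note bobs = ov_observable_bounded[OF obs]
  have bf: "observable K ?f" if "N \<le> K" for K
    by (rule ov_observable_bounded[OF ov_observable_odd_is]) (use that N J in auto)
  have restr: "?f \<omega> (reindex id N r) * ?h j (reindex id N r) = ?f \<omega> r * ?h j r" if "j \<in> {1..N}" for j \<omega> r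
    by (simp add: ov_restrict[OF N] odd_is_reindex_id[OF J] odd_weight_reindex_id[OF J that])
  have bh: "observable (N + 1) (\<lambda>\<omega> r. ?f \<omega> r * ?h j r * of_bool (r j = r (N + 1)))"
    if "j \<in> {1..N}" for j
  proof (rule observable_mult[OF _ observable_coincide])
    show "observable (N + 1) (\<lambda>\<omega> r. ?f \<omega> r * ?h j r)"
      using observable_restrict[OF bobs[OF that], of "N + 1"] unfolding restr[OF that] by simp
  qed
  have "EE (N + 1) (\<lambda>\<omega> r. ?f \<omega> r * of_bool (r (N + 1) \<in> odd_set J r)) =
    EE (N + 1) (\<lambda>\<omega> r. \<Sum>j = 1..N. ?f \<omega> r * ?h j r * of_bool (r j = r (N + 1)))"
    by (rule EE_cong) (simp only: sum_odd_weight_at[OF J, symmetric] sum_distrib_left mult.assoc)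
  also have "\<dots> = (\<Sum>j = 1..N. EE (N + 1) (\<lambda>\<omega> r. ?f \<omega> r * ?h j r * of_bool (r j = r (N + 1))))"
    by (rule EE_sum) (rule bh)
  finally have "real N * EE (N + 1) (\<lambda>\<omega> r. ?f \<omega> r * of_bool (r (N + 1) \<in> odd_set J r)) =
     (\<Sum>j = 1..N. real N * EE (N + 1) (\<lambda>\<omega> r. ?f \<omega> r * ?h j r * of_bool (r j = r (N + 1))))"
    by (simp add: sum_distrib_left)
  also have "\<dots> = (\<Sum>j = 1..N. (\<Sum>l = 1..N. EE N (\<lambda>\<omega> r. ?f \<omega> r * ?h j r * of_bool (r j = r l)))
      - (1 - coincidence) * EE N (\<lambda>\<omega> r. ?f \<omega> r * ?h j r))"
  proof (rule sum.cong[OF refl])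
    fix j assume j: "j \<in> {1..N}"
    show "real N * EE (N + 1) (\<lambda>\<omega> r. ?f \<omega> r * ?h j r * of_bool (r j = r (N + 1))) =
      (\<Sum>l = 1..N. EE N (\<lambda>\<omega> r. ?f \<omega> r * ?h j r * of_bool (r j = r l)))
      - (1 - coincidence) * EE N (\<lambda>\<omega> r. ?f \<omega> r * ?h j r)"
      using gg_coincide[OF obs[OF j] N2 j] unfolding restr[OF j] .
  qed
  also have "\<dots> = (\<Sum>j = 1..N. \<Sum>l = 1..N. EE N (\<lambda>\<omega> r. ?f \<omega> r * ?h j r * of_bool (r j = r l)))
      - (1 - coincidence) * (\<Sum>j = 1..N. EE N (\<lambda>\<omega> r. ?f \<omega> r * ?h j r))"
    by (simp only: sum_subtractf sum_distrib_left)
  also have "(\<Sum>j = 1..N. EE N (\<lambda>\<omega> r. ?f \<omega> r * ?h j r)) = of_int s * Q s J"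
  proof -
    have "(\<Sum>j = 1..N. EE N (\<lambda>\<omega> r. ?f \<omega> r * ?h j r)) = EE N (\<lambda>\<omega> r. \<Sum>j = 1..N. ?f \<omega> r * ?h j r)"
      by (rule EE_sum[symmetric]) (rule bobs)
    also have "\<dots> = EE N (\<lambda>\<omega> r. of_int s * ?f \<omega> r)"
    proof (rule EE_cong)
      fix \<omega> r
      have "(\<Sum>j = 1..N. ?f \<omega> r * ?h j r) = ?f \<omega> r * real (card (odd_set J r))"
        by (simp only: sum_distrib_left[symmetric] sum_odd_weight[OF J])
      also have "\<dots> = of_int s * ?f \<omega> r" by (simp add: odd_is_def)
      finally show "(\<Sum>j = 1..N. ?f \<omega> r * ?h j r) = of_int s * ?f \<omega> r" .
    qed
    finally show ?thesis unfolding EE_cmult Q_eq[OF N J] .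
  qed
  also have "(\<Sum>j = 1..N. \<Sum>l = 1..N. EE N (\<lambda>\<omega> r. ?f \<omega> r * ?h j r * of_bool (r j = r l))) =
    EE N (\<lambda>\<omega> r. ?f \<omega> r * (\<Sum>j = 1..N. of_bool (r j \<in> odd_set J r)))"
  proof -
    have bb: "observable N (\<lambda>\<omega> r. ?f \<omega> r * ?h j r * of_bool (r j = r l))" if "j \<in> {1..N}" for j l
      by (rule observable_mult[OF bobs[OF that] observable_coincide])
    have "(\<Sum>j = 1..N. \<Sum>l = 1..N. EE N (\<lambda>\<omega> r. ?f \<omega> r * ?h j r * of_bool (r j = r l))) =
      (\<Sum>j = 1..N. EE N (\<lambda>\<omega> r. \<Sum>l = 1..N. ?f \<omega> r * ?h j r * of_bool (r j = r l)))"
      by (intro sum.cong refl EE_sum[symmetric] bb)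
    also have "\<dots> = EE N (\<lambda>\<omega> r. \<Sum>j = 1..N. \<Sum>l = 1..N. ?f \<omega> r * ?h j r * of_bool (r j = r l))"
      by (intro EE_sum[symmetric] observable_sum bb)
    also have "\<dots> = EE N (\<lambda>\<omega> r. ?f \<omega> r * (\<Sum>j = 1..N. of_bool (r j \<in> odd_set J r)))"
    proof (rule EE_cong)
      fix \<omega> r
      have "(\<Sum>j = 1..N. \<Sum>l = 1..N. ?f \<omega> r * ?h j r * of_bool (r j = r l)) =
        (\<Sum>j = 1..N. ?f \<omega> r * (\<Sum>l = 1..N. ?h j r * of_bool (r j = r l)))"
        by (simp only: mult.assoc sum_distrib_left)
      also have "\<dots> = (\<Sum>j = 1..N. ?f \<omega> r * of_bool (r j \<in> odd_set J r))"
        by (intro sum.cong refl) (simp only: sum_odd_weight_block)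
      finally show "(\<Sum>j = 1..N. \<Sum>l = 1..N. ?f \<omega> r * ?h j r * of_bool (r j = r l)) =
        ?f \<omega> r * (\<Sum>j = 1..N. of_bool (r j \<in> odd_set J r))"
        by (simp only: sum_distrib_left)
    qed
    finally show ?thesis .
  qed
  finally show ?thesis by (simp only: mult.assoc)
qed

lemma observable_hit:
  assumes "observable N f"
  shows "observable N (\<lambda>\<omega> r. f \<omega> r * of_bool (r j \<in> odd_set J r))"
  by (rule observable_mult[OF assms]) (auto simp: observable_def intro!: exI[of _ 1])

text \<open>Adding replica N + 1 is a toggle, split by whether it hits the odd set, and the toggles
  at the old replicas are split alike. Both sides then have the same leading term and the same sums
  over hits, so only the corrections from \<open>Q_hit\<close> at s - 1 and s + 1 remain.\<close>

lemma Q_add_replica: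
  assumes N: "n \<le> N" and J: "J \<subseteq> {1..N}"
  shows "real N * Q s (insert (N + 1) J) = (\<Sum>l = 1..N. Q s (toggle l J))
    + (1 - coincidence) * (of_int (s - 1) * Q (s - 1) J - of_int (s + 1) * Q (s + 1) J)"
proof -
  have fin: "finite J" using J finite_subset by blast
  let ?f = "\<lambda>d. obs J d"
  let ?hit = "\<lambda>j r. of_bool (r j \<in> odd_set J r) :: real"
  let ?T = "\<lambda>r. \<Sum>j = 1..N. ?hit j r"
  have bf: "observable K (?f d)" if "N \<le> K" for K d
    by (rule ov_observable_bounded[OF ov_observable_odd_is]) (use that N J in auto)
  have bh: "observable K (\<lambda>\<omega> r. ?f d \<omega> r * ?hit j r)" if "N \<le> K" for K d j
    by (rule observable_hit[OF bf[OF that]])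
  have expand: "EE K (obs (toggle l J) s) =
     EE K (?f (s - 1)) - EE K (\<lambda>\<omega> r. ?f (s - 1) \<omega> r * ?hit l r) + EE K (\<lambda>\<omega> r. ?f (s + 1) \<omega> r * ?hit l r)"
    if K: "N \<le> K" for K l
  proof -
    have "EE K (obs (toggle l J) s) =
      EE K (\<lambda>\<omega> r. (?f (s - 1) \<omega> r + (- 1) * (?f (s - 1) \<omega> r * ?hit l r)) + ?f (s + 1) \<omega> r * ?hit l r)"
      by (rule EE_cong) (simp add: odd_is_toggle[OF fin] algebra_simps)
    also have "\<dots> = EE K (?f (s - 1)) + (- 1) * EE K (\<lambda>\<omega> r. ?f (s - 1) \<omega> r * ?hit l r) + EE K (\<lambda>\<omega> r. ?f (s + 1) \<omega> r * ?hit l r)"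
      by (simp only: EE_add observable_add observable_mult[OF observable_const] bf bh K EE_cmult)
    finally show ?thesis by simp
  qed
  have sumT: "(\<Sum>l = 1..N. EE N (\<lambda>\<omega> r. ?f d \<omega> r * ?hit l r)) = EE N (\<lambda>\<omega> r. ?f d \<omega> r * ?T r)" for d
  proof -
    have "(\<Sum>l = 1..N. EE N (\<lambda>\<omega> r. ?f d \<omega> r * ?hit l r)) = EE N (\<lambda>\<omega> r. \<Sum>l = 1..N. ?f d \<omega> r * ?hit l r)"
      by (rule EE_sum[symmetric]) (rule bh, simp)
    then show ?thesis by (simp only: sum_distrib_left)
  qed
  have ins: "insert (N + 1) J \<subseteq> {1..N + 1}" using J by auto
  have "toggle (N + 1) J = insert (N + 1) J" using J by (auto simp: toggle_def)
  then have "Q s (insert (N + 1) J) = EE (N + 1) (\<lambda>\<omega> r. ov n F \<omega> r * odd_is (toggle (N + 1) J) s r)"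
    using Q_eq[OF _ ins, of s] N by simp
  also have "\<dots> = Q (s - 1) J - EE (N + 1) (\<lambda>\<omega> r. ?f (s - 1) \<omega> r * ?hit (N + 1) r)
      + EE (N + 1) (\<lambda>\<omega> r. ?f (s + 1) \<omega> r * ?hit (N + 1) r)"
  proof -
    have "Q (s - 1) J = EE (N + 1) (?f (s - 1))" by (rule Q_eq) (use N J in auto)
    then show ?thesis using expand[of "N + 1" "N + 1"] by simp
  qed
  finally have "real N * Q s (insert (N + 1) J) = real N * Q (s - 1) J
     - real N * EE (N + 1) (\<lambda>\<omega> r. ?f (s - 1) \<omega> r * ?hit (N + 1) r)
     + real N * EE (N + 1) (\<lambda>\<omega> r. ?f (s + 1) \<omega> r * ?hit (N + 1) r)"
    by (simp only: distrib_left right_diff_distrib)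
  then have lhs: "real N * Q s (insert (N + 1) J) = real N * Q (s - 1) J
     - (EE N (\<lambda>\<omega> r. ?f (s - 1) \<omega> r * ?T r) - (1 - coincidence) * of_int (s - 1) * Q (s - 1) J)
     + (EE N (\<lambda>\<omega> r. ?f (s + 1) \<omega> r * ?T r) - (1 - coincidence) * of_int (s + 1) * Q (s + 1) J)"
    unfolding Q_hit[OF N J] .
  have "Q s (toggle l J) = Q (s - 1) J - EE N (\<lambda>\<omega> r. ?f (s - 1) \<omega> r * ?hit l r) + EE N (\<lambda>\<omega> r. ?f (s + 1) \<omega> r * ?hit l r)"
    if l: "l \<in> {1..N}" for l
  proof -
    have "toggle l J \<subseteq> {1..N}" using J l by (auto simp: toggle_def)
    then have "Q s (toggle l J) = EE N (obs (toggle l J) s)"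
      by (rule Q_eq[OF N])
    also have "\<dots> = EE N (?f (s - 1)) - EE N (\<lambda>\<omega> r. ?f (s - 1) \<omega> r * ?hit l r) + EE N (\<lambda>\<omega> r. ?f (s + 1) \<omega> r * ?hit l r)"
      by (rule expand) simp
    finally show ?thesis unfolding Q_eq[OF N J] .
  qed
  then have "(\<Sum>l = 1..N. Q s (toggle l J)) = (\<Sum>l = 1..N. Q (s - 1) J
      - EE N (\<lambda>\<omega> r. ?f (s - 1) \<omega> r * ?hit l r) + EE N (\<lambda>\<omega> r. ?f (s + 1) \<omega> r * ?hit l r))"
    by (rule sum.cong[OF refl])
  also have "\<dots> = real N * Q (s - 1) J - EE N (\<lambda>\<omega> r. ?f (s - 1) \<omega> r * ?T r) + EE N (\<lambda>\<omega> r. ?f (s + 1) \<omega> r * ?T r)"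
    unfolding sumT[symmetric] by (simp add: sum.distrib sum_subtractf)
  finally show ?thesis unfolding lhs by (simp add: algebra_simps)
qed

text \<open>Transposing l with the last extra replica fixes the first n replicas, hence
  \<open>F\<close> and \<open>S\<close>, and carries the first k extra indices to all extra indices
  but l.\<close>

lemma Q_exchange:
  assumes S: "S \<subseteq> {1..n}" and l: "l \<in> {n + 1..n + Suc k}"
  shows "Q s (S \<union> ({n + 1..n + Suc k} - {l})) = Q s (S \<union> {n + 1..n + k})"
proof -
  let ?N = "n + Suc k"
  let ?J = "S \<union> {n + 1..n + k}"
  define \<tau> where "\<tau> = Transposition.transpose l ?N"
  have inj: "inj_on \<tau> X" for X unfolding \<tau>_def by (rule inj_on_subset[OF inj_transpose]) simp
  have fix_n: "\<tau> i = i" if "i \<in> {1..n}" for i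
    using that l by (auto simp: \<tau>_def Transposition.transpose_def)
  have img: "\<tau> ` {1..?N} \<subseteq> {1..?N}"
    using l by (auto simp: \<tau>_def Transposition.transpose_def)
  have image: "\<tau> ` ?J = S \<union> ({n + 1..n + Suc k} - {l})"
  proof -
    have 1: "\<tau> ` S = S" using fix_n S by force
    have "\<tau> ` {n + 1..n + k} = \<tau> ` ({n + 1..?N} - {?N})"
      by (rule arg_cong[where f="(`) \<tau>"]) auto
    also have "\<dots> = \<tau> ` {n + 1..?N} - {\<tau> ?N}"
      by (subst inj_on_image_set_diff[OF inj]) auto
    also have "\<tau> ` {n + 1..?N} = {n + 1..?N}"
      by (rule endo_inj_surj[OF _ _ inj]) (use l in \<open>auto simp: \<tau>_def Transposition.transpose_def\<close>)
    also have "\<tau> ?N = l" by (simp add: \<tau>_def)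
    finally show ?thesis using 1 by (simp add: image_Un)
  qed
  have JN: "?J \<subseteq> {1..?N}" "\<tau> ` ?J \<subseteq> {1..?N}" proof -
    show "?J \<subseteq> {1..?N}" using S by auto
    then show "\<tau> ` ?J \<subseteq> {1..?N}" using img by blast
  qed
  have b: "observable ?N (obs ?J s)"
    by (rule ov_observable_bounded[OF ov_observable_odd_is]) (use JN in auto)
  have e: "ov n F \<omega> (reindex \<tau> ?N r) * odd_is ?J s (reindex \<tau> ?N r) =
     ov n F \<omega> r * odd_is (\<tau> ` ?J) s r" for \<omega> r
  proof -
    have "overlap_array n (\<lambda>\<alpha>. \<xi> \<alpha> \<omega>) (reindex \<tau> ?N r) = overlap_array n (\<lambda>\<alpha>. \<xi> \<alpha> \<omega>) r"
      using fix_n by (auto simp: overlap_array_def overlap_def reindex_def restrict_def fun_eq_iff)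
    moreover have "odd_set ?J (reindex \<tau> ?N r) = odd_set ?J (\<lambda>i. r (\<tau> i))"
      by (rule odd_set_cong) (use JN in auto)
    ultimately show ?thesis by (simp add: odd_is_def odd_set_image[OF inj])
  qed
  have "Q s (\<tau> ` ?J) = EE ?N (obs (\<tau> ` ?J) s)"
    by (rule Q_eq) (use JN in auto)
  also have "\<dots> = EE ?N (obs ?J s)"
    using EE_reindex[OF b inj img] unfolding e .
  also have "\<dots> = Q s ?J"
    by (rule Q_eq[symmetric]) (use JN in auto)
  finally show ?thesis unfolding image .
qed

sublocale rec: replica_recursion n coincidence Q
proof
  show "Q s {} = 0" if "s \<noteq> 0" for s
    using that Q_eq[of n "{}" s] by (simp add: odd_is_def)
qed (use Q_add_replica Q_exchange in auto)

end

section \<open>Expansion of the tilted average\<close>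

context replica_recursion begin

lemma q_eq_0: "n < j \<Longrightarrow> q s j k = 0"
proof -
  assume j: "n < j"
  have "card S \<le> n" if "S \<subseteq> {1..n}" for S :: "nat set"
    using card_mono[OF _ that] by simp
  then have "subsets n j = {}"
    unfolding subsets_def using j by (auto simp: not_le[symmetric])
  then show ?thesis by (simp add: q_def)
qed

lemma sum_Pow_Q:
  "(\<Sum>S\<in>Pow {1..n}. x ^ card S * Q s (S \<union> {n + 1..n + k})) = (\<Sum>j\<le>n. x ^ j * q s j k)"
proof -
  have "(\<Sum>S\<in>Pow {1..n}. x ^ card S * Q s (S \<union> {n + 1..n + k})) =
    (\<Sum>j\<le>n. \<Sum>S\<in>{S \<in> Pow {1..n}. card S = j}. x ^ card S * Q s (S \<union> {n + 1..n + k}))"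
    by (rule sum.group[symmetric]) (use card_mono[of "{1..n}"] in auto)
  also have "\<dots> = (\<Sum>j\<le>n. x ^ j * q s j k)"
  proof (rule sum.cong[OF refl])
    fix j
    have "{S \<in> Pow {1..n}. card S = j} = subsets n j" by (auto simp: subsets_def)
    moreover have "(\<Sum>S\<in>subsets n j. x ^ card S * Q s (S \<union> {n + 1..n + k})) =
      (\<Sum>S\<in>subsets n j. x ^ j * Q s (S \<union> {n + 1..n + k}))"
      by (rule sum.cong) (auto simp: subsets_def)
    ultimately show "(\<Sum>S\<in>{S \<in> Pow {1..n}. card S = j}. x ^ card S * Q s (S \<union> {n + 1..n + k})) = x ^ j * q s j k"
      by (simp add: q_def sum_distrib_left)
  qed
  finally show ?thesis .
qed

text \<open>Only j \<le> n occurs, so ordering by total degree amounts to a finite sum of shifted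
  series. The coefficient of x^m is then \<open>coef s m\<close>, which vanishes except at m =
  0.\<close>

lemma expansion_sums:
  assumes summable: "\<And>j. summable (\<lambda>k. b k * x ^ k * q s j k)"
  shows "(\<lambda>k. b k * x ^ k * (\<Sum>j\<le>n. x ^ j * q s j k)) sums Q s {}"
proof -
  define S where "S j = (\<Sum>k. x ^ j * (b k * x ^ k * q s j k))" for j
  have S: "(\<lambda>k. x ^ j * (b k * x ^ k * q s j k)) sums S j" for j
    unfolding S_def by (intro summable_sums summable_mult summable)
  \<comment> \<open>The j-th series moved j places to the right, so that position m holds the terms
    of total degree m.\<close>
  define g where "g j m = (if m < j then 0 else b (m - j) * x ^ m * q s j (m - j))" for j m
  have "g j sums S j" for j
  proof -
    have "(\<lambda>i. g j (i + j)) sums S j"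
      using S[of j] by (simp add: g_def power_add mult_ac)
    then show ?thesis by (subst (asm) sums_zero_iff_shift) (simp_all add: g_def)
  qed
  then have "(\<lambda>m. \<Sum>j\<le>n. g j m) sums (\<Sum>j\<le>n. S j)" by (intro sums_sum) auto
  moreover have "(\<Sum>j\<le>n. g j m) = x ^ m * coef s m" for m
  proof -
    have "(\<Sum>j\<le>n. g j m) = (\<Sum>j\<le>m. b (m - j) * x ^ m * q s j (m - j))"
      by (rule sum.mono_neutral_cong) (auto simp: g_def q_eq_0)
    also have "\<dots> = (\<Sum>k\<le>m. b k * x ^ m * q s (m - k) k)"
      by (rule sum.reindex_bij_witness[of _ "\<lambda>k. m - k" "\<lambda>k. m - k"]) auto
    finally show ?thesis by (simp add: coef_def sum_distrib_left mult_ac)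
  qed
  moreover have "x ^ m * coef s m = (if m = 0 then Q s {} else 0)" for m
  proof (cases m)
    case 0
    then show ?thesis by (simp add: coef_def q_def b_def)
  next
    case (Suc i)
    then show ?thesis using coef_eq_0[of s i] by simp
  qed
  moreover have "(\<lambda>m. if m = 0 then Q s {} else 0) sums Q s {}"
    using sums_single[of 0 "\<lambda>_. Q s {}"] by simp
  ultimately have "(\<Sum>j\<le>n. S j) = Q s {}" by (simp add: sums_unique2)
  moreover have "(\<lambda>k. \<Sum>j\<le>n. x ^ j * (b k * x ^ k * q s j k)) sums (\<Sum>j\<le>n. S j)"
    by (intro sums_sum S)
  ultimately show ?thesis by (simp add: sum_distrib_left mult_ac)
qed

lemma b_summable:
  assumes "\<bar>x\<bar> < 1"
  shows "summable (\<lambda>k. \<bar>b k * x ^ k\<bar>)"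
proof -
  have "(1::ereal) \<le> conv_radius (\<lambda>k. (- real n) gchoose k)" by (subst conv_radius_gchoose) auto
  then have "ereal (norm x) < conv_radius (\<lambda>k. (- real n) gchoose k)"
    using assms by (metis ereal_less(3) less_le_trans real_norm_def)
  from abs_summable_in_conv_radius[OF this] show ?thesis by (simp add: b_def)
qed

lemma b_sums:
  assumes "\<bar>x\<bar> < 1"
  shows "(\<lambda>k. b k * x ^ k) sums (1 / (1 + x) ^ n)"
proof -
  have "0 < 1 + x" using assms by linarith
  then have "(1 + x) powr (- real n) = 1 / (1 + x) ^ n"
    by (simp add: powr_minus powr_realpow divide_inverse)
  then show ?thesis using gen_binomial_real[OF assms, of "- real n"] by (simp add: b_def)
qed

end

section \<open>Averages for one realisation of the weights\<close>

lemma AE_config_pmf: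
  fixes v :: "'a \<Rightarrow> real" and K :: nat
  assumes "\<And>a. a \<in> A \<Longrightarrow> 0 \<le> v a" "(v has_sum 1) A"
  shows "AE r in measure_pmf (config_pmf A v K). r \<in> tuples A K"
  by (rule AE_pmfI) (rule subsetD[OF set_config_pmf[OF assms]])

lemma abs_prod_signs:
  fixes e :: "'a \<Rightarrow> real"
  assumes "\<And>i. i \<in> J \<Longrightarrow> e (r i) = 1 \<or> e (r i) = -1"
  shows "\<bar>\<Prod>i\<in>J. e (r i)\<bar> = 1"
proof -
  have "\<bar>e (r i)\<bar> = 1" if "i \<in> J" for i using assms[OF that] by auto
  then show ?thesis by (simp add: abs_prod)
qed

lemma abs_config_avg_le:
  fixes v :: "'a \<Rightarrow> real" and K :: nat
  assumes v: "\<And>a. a \<in> A \<Longrightarrow> 0 \<le> v a" "(v has_sum 1) A"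
    and B: "\<And>r. r \<in> tuples A K \<Longrightarrow> \<bar>g r\<bar> \<le> B"
  shows "\<bar>config_avg A v K g\<bar> \<le> B"
proof -
  have ae: "AE r in measure_pmf (config_pmf A v K). norm (g r) \<le> B"
    by (rule eventually_mono[OF AE_config_pmf[OF v]], assumption, simp add: B)
  have int: "integrable (measure_pmf (config_pmf A v K)) g"
    by (rule measure_pmf.integrable_const_bound[OF ae]) simp
  have "norm (measure_pmf.expectation (config_pmf A v K) g) \<le> measure_pmf.expectation (config_pmf A v K) (\<lambda>r. norm (g r))"
    by (rule integral_norm_bound)
  also have "\<dots> \<le> measure_pmf.expectation (config_pmf A v K) (\<lambda>r. B)"
    by (rule integral_mono_AE) (use int ae in auto)
  finally show ?thesis by (simp add: config_avg_eq_expectation[OF v B])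
qed

lemma config_avg_linear:
  fixes v :: "'a \<Rightarrow> real" and K :: nat
  assumes v: "\<And>a. a \<in> A \<Longrightarrow> 0 \<le> v a" "(v has_sum 1) A" and I: "finite I"
    and B: "\<And>i r. i \<in> I \<Longrightarrow> r \<in> tuples A K \<Longrightarrow> \<bar>g i r\<bar> \<le> B"
  shows "config_avg A v K (\<lambda>r. \<Sum>i\<in>I. c i * g i r) = (\<Sum>i\<in>I. c i * config_avg A v K (g i))"
proof -
  have ae: "AE r in measure_pmf (config_pmf A v K). norm (g i r) \<le> B" if "i \<in> I" for i
    by (rule eventually_mono[OF AE_config_pmf[OF v]], assumption, simp add: B[OF that])
  have int: "integrable (measure_pmf (config_pmf A v K)) (g i)" if "i \<in> I" for i
    by (rule measure_pmf.integrable_const_bound[OF ae[OF that]]) simp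
  have bd: "\<bar>\<Sum>i\<in>I. c i * g i r\<bar> \<le> (\<Sum>i\<in>I. \<bar>c i\<bar> * B)" if "r \<in> tuples A K" for r
    by (rule order_trans[OF sum_abs sum_mono]) (use B that in \<open>auto simp: abs_mult intro!: mult_left_mono\<close>)
  have "config_avg A v K (\<lambda>r. \<Sum>i\<in>I. c i * g i r) =
    measure_pmf.expectation (config_pmf A v K) (\<lambda>r. \<Sum>i\<in>I. c i * g i r)"
    by (rule config_avg_eq_expectation[OF v bd])
  also have "\<dots> = (\<Sum>i\<in>I. c i * measure_pmf.expectation (config_pmf A v K) (g i))"
    using int by (subst Bochner_Integration.integral_sum) auto
  also have "\<dots> = (\<Sum>i\<in>I. c i * config_avg A v K (g i))"
    by (intro sum.cong refl arg_cong2[where f="(*)"] config_avg_eq_expectation[OF v B, symmetric])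
  finally show ?thesis .
qed

text \<open>A tuple of N + 1 replicas is a tuple of N and one more configuration, so the absolutely
  convergent sum factorises.\<close>

lemma config_avg_Suc:
  fixes v :: "'a \<Rightarrow> real" and N :: nat
  assumes A: "countable A" and v: "\<And>a. a \<in> A \<Longrightarrow> 0 \<le> v a" "(v has_sum 1) A"
    and B: "\<And>r. r \<in> tuples A N \<Longrightarrow> \<bar>g r\<bar> \<le> B"
    and e: "\<And>a. a \<in> A \<Longrightarrow> \<bar>e a\<bar> \<le> C"
  shows "config_avg A v (Suc N) (\<lambda>r. g (reindex id N r) * e (r (Suc N))) =
    config_avg A v N g * (\<Sum>\<^sub>\<infinity>a\<in>A. v a * e a)"
proof -
  let ?C = "\<lambda>N. tuples A N"
  let ?f = "\<lambda>r. (\<Prod>i\<in>{1..N}. v (r i)) * g r" and ?h = "\<lambda>a. v a * e a"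
  let ?G = "\<lambda>r. (\<Prod>i\<in>{1..Suc N}. v (r i)) * (g (reindex id N r) * e (r (Suc N)))"
  have cC: "countable (?C N)" by (intro countable_PiE A) auto
  have sf: "abs_summable ?f (?C N)" by (rule config_avg_summable[OF v B])
  have sh: "abs_summable ?h A"
  proof (rule abs_summable_on_comparison_test)
    show "abs_summable (\<lambda>a. C * pmf (weight_pmf A v) a) A"
      by (intro abs_summable_on_cmult_right pmf_abs_summable)
    fix a assume a: "a \<in> A"
    have "norm (v a * e a) \<le> v a * C"
      using v(1)[OF a] e[OF a] by (auto simp: abs_mult intro!: mult_left_mono)
    also have "\<dots> = C * pmf (weight_pmf A v) a" using a by (simp add: pmf_weight_pmf[OF v])
    also have "\<dots> \<le> norm (C * pmf (weight_pmf A v) a)" by simp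
    finally show "norm (v a * e a) \<le> norm (C * pmf (weight_pmf A v) a)" .
  qed
  have gr: "\<bar>g (reindex id N r) * e (r (Suc N))\<bar> \<le> \<bar>B\<bar> * \<bar>C\<bar>" if s: "r \<in> ?C (Suc N)" for r
  proof -
    have "reindex id N r \<in> ?C N" by (rule reindex_in[OF s]) auto
    from B[OF this] have 1: "\<bar>g (reindex id N r)\<bar> \<le> \<bar>B\<bar>" by linarith
    have "r (Suc N) \<in> A" using s by (auto simp: PiE_iff)
    from e[OF this] have 2: "\<bar>e (r (Suc N))\<bar> \<le> \<bar>C\<bar>" by linarith
    show ?thesis unfolding abs_mult by (rule mult_mono[OF 1 2]) auto
  qed
  let ?j = "\<lambda>p. (fst p)(Suc N := snd p)"
  have bij: "bij_betw ?j (?C N \<times> A) (?C (Suc N))"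
  proof (rule bij_betw_byWitness[where f'="\<lambda>r. (reindex id N r, r (Suc N))"])
    show "\<forall>p\<in>?C N \<times> A. (reindex id N (?j p), ?j p (Suc N)) = p"
    proof
      fix p assume "p \<in> ?C N \<times> A"
      then have "fst p i = undefined" if "i \<notin> {1..N}" for i using that by (auto simp: PiE_iff extensional_def)
      then show "(reindex id N (?j p), ?j p (Suc N)) = p"
        by (cases p) (simp add: reindex_def restrict_def fun_eq_iff)
    qed
    show "\<forall>r\<in>?C (Suc N). ?j (reindex id N r, r (Suc N)) = r"
    proof
      fix r assume "r \<in> ?C (Suc N)"
      then have out: "r i = undefined" if "i \<notin> {1..N}" "i \<noteq> Suc N" for i
        using that by (auto simp: PiE_iff extensional_def le_Suc_eq)
      show "?j (reindex id N r, r (Suc N)) = r"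
        by (rule ext) (simp add: reindex_def restrict_def out del: atLeastAtMost_iff)
    qed
    show "?j ` (?C N \<times> A) \<subseteq> ?C (Suc N)"
    proof (rule image_subsetI)
      fix p assume p: "p \<in> ?C N \<times> A"
      have "?j p \<in> insert (Suc N) {1..N} \<rightarrow>\<^sub>E A"
        by (rule PiE_fun_upd) (use p in auto)
      moreover have "insert (Suc N) {1..N} = {1..Suc N}" by auto
      ultimately show "?j p \<in> ?C (Suc N)" by simp
    qed
    show "(\<lambda>r. (reindex id N r, r (Suc N))) ` ?C (Suc N) \<subseteq> ?C N \<times> A"
    proof (rule image_subsetI)
      fix r assume s: "r \<in> ?C (Suc N)"
      have "reindex id N r \<in> ?C N" by (rule reindex_in[OF s]) auto
      moreover have "r (Suc N) \<in> A" using s by (auto simp: PiE_iff)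
      ultimately show "(reindex id N r, r (Suc N)) \<in> ?C N \<times> A" by simp
    qed
  qed
  have "config_avg A v (Suc N) (\<lambda>r. g (reindex id N r) * e (r (Suc N))) = infsetsum ?G (?C (Suc N))"
    unfolding config_avg_def
    by (rule infsetsum_infsum[symmetric], rule config_avg_summable[OF v gr])
  also have "\<dots> = infsetsum (\<lambda>p. ?G (?j p)) (?C N \<times> A)"
    by (rule infsetsum_reindex_bij_betw[OF bij, symmetric])
  also have "\<dots> = infsetsum (\<lambda>(\<tau>, a). ?f \<tau> * ?h a) (?C N \<times> A)"
  proof (rule infsetsum_cong[OF _ refl])
    fix p assume "p \<in> ?C N \<times> A"
    then obtain \<tau> a where p: "p = (\<tau>, a)" and t: "\<tau> \<in> ?C N" and a: "a \<in> A" by auto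
    have "reindex id N (?j p) = \<tau>"
      unfolding p using t by (auto simp: reindex_def restrict_def fun_eq_iff PiE_iff extensional_def)
    moreover have "(\<Prod>i\<in>{1..Suc N}. v (?j p i)) = (\<Prod>i\<in>{1..N}. v (\<tau> i)) * v a"
    proof -
      have "{1..Suc N} = insert (Suc N) {1..N}" by auto
      moreover have "(\<Prod>i\<in>{1..N}. v (?j p i)) = (\<Prod>i\<in>{1..N}. v (\<tau> i))"
        by (rule prod.cong) (auto simp: p)
      ultimately show ?thesis by (simp add: p)
    qed
    ultimately show "?G (?j p) = (case p of (\<tau>, a) \<Rightarrow> ?f \<tau> * ?h a)" by (simp add: p)
  qed
  also have "\<dots> = infsetsum ?f (?C N) * infsetsum ?h A"
    by (rule infsetsum_product[OF cC A sf sh])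
  also have "\<dots> = config_avg A v N g * (\<Sum>\<^sub>\<infinity>a\<in>A. v a * e a)"
    unfolding config_avg_def infsetsum_infsum[OF sf] infsetsum_infsum[OF sh] ..
  finally show ?thesis .
qed

text \<open>Signs square to one, so configurations of even multiplicity drop out.\<close>

lemma prod_signs_eq_odd_set:
  fixes e :: "'a \<Rightarrow> real"
  assumes J: "finite J" and e: "\<And>i. i \<in> J \<Longrightarrow> e (r i) = 1 \<or> e (r i) = -1"
  shows "(\<Prod>i\<in>J. e (r i)) = (\<Prod>a\<in>odd_set J r. e a)"
proof -
  have "(\<Prod>i\<in>J. e (r i)) = (\<Prod>a\<in>r ` J. \<Prod>i\<in>{x \<in> J. r x = a}. e (r i))"
    by (rule prod.image_gen[OF J])
  also have "\<dots> = (\<Prod>a\<in>r ` J. if a \<in> odd_set J r then e a else 1)"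
  proof (rule prod.cong[OF refl])
    fix a assume "a \<in> r ` J"
    then have ea: "e a = 1 \<or> e a = -1" using e by auto
    have "(\<Prod>i\<in>{x \<in> J. r x = a}. e (r i)) = e a ^ card {x \<in> J. r x = a}" by simp
    then show "(\<Prod>i\<in>{x \<in> J. r x = a}. e (r i)) = (if a \<in> odd_set J r then e a else 1)"
      using ea by (auto simp: odd_set_def)
  qed
  also have "\<dots> = (\<Prod>a\<in>odd_set J r. e a)"
    using odd_set_subset[of J r] J by (intro prod.mono_neutral_cong_right) auto
  finally show ?thesis .
qed

text \<open>Each extra replica contributes the mean sign as a factor. Read backwards, powers of X
  become averages over more replicas, which the identities can treat.\<close>

lemma config_avg_signs:
  fixes v :: "'a \<Rightarrow> real" and N :: nat
  assumes A: "countable A" and v: "\<And>a. a \<in> A \<Longrightarrow> 0 \<le> v a" "(v has_sum 1) A"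
    and B: "\<And>r. r \<in> tuples A N \<Longrightarrow> \<bar>g r\<bar> \<le> B"
    and e: "\<And>a. a \<in> A \<Longrightarrow> e a = 1 \<or> e a = -1"
  shows "config_avg A v (N + k) (\<lambda>r. g (reindex id N r) * (\<Prod>j\<in>{N + 1..N + k}. e (r j))) =
    config_avg A v N g * (\<Sum>\<^sub>\<infinity>a\<in>A. v a * e a) ^ k"
proof (induction k)
  case 0
  have "config_avg A v N (\<lambda>r. g (reindex id N r)) = config_avg A v N g"
    by (rule config_avg_reindex[OF v B]) auto
  then show ?case by (simp add: id_def)
next
  case (Suc k)
  let ?g = "\<lambda>r. g (reindex id N r) * (\<Prod>j\<in>{N + 1..N + k}. e (r j))"
  have gB: "\<bar>?g r\<bar> \<le> B" if s: "r \<in> tuples A (N + k)" for r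
  proof -
    have "\<bar>\<Prod>j\<in>{N + 1..N + k}. e (r j)\<bar> = 1"
      by (intro abs_prod_signs e) (use s in \<open>auto simp: PiE_iff\<close>)
    moreover have "reindex id N r \<in> tuples A N" by (rule reindex_in[OF s]) auto
    ultimately show ?thesis using B by (simp add: abs_mult)
  qed
  have step: "config_avg A v (Suc (N + k)) (\<lambda>r. ?g (reindex id (N + k) r) * e (r (Suc (N + k)))) =
    config_avg A v (N + k) ?g * (\<Sum>\<^sub>\<infinity>a\<in>A. v a * e a)"
    by (rule config_avg_Suc[OF A v gB, where C=1]) (use e in force)+
  have split: "?g (reindex id (N + k) r) * e (r (Suc (N + k))) =
     g (reindex id N r) * (\<Prod>j\<in>{N + 1..N + Suc k}. e (r j))" for r
  proof -
    have "reindex id N (reindex id (N + k) r) = reindex id N r"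
      by (auto simp: reindex_def restrict_def fun_eq_iff)
    moreover have "(\<Prod>j\<in>{N + 1..N + k}. e (reindex id (N + k) r j)) = (\<Prod>j\<in>{N + 1..N + k}. e (r j))"
      by (rule prod.cong) auto
    moreover have "{N + 1..N + Suc k} = insert (Suc (N + k)) {N + 1..N + k}" by auto
    ultimately show ?thesis by (simp add: mult_ac)
  qed
  from step[unfolded split]
  have "config_avg A v (N + Suc k) (\<lambda>r. g (reindex id N r) * (\<Prod>j\<in>{N + 1..N + Suc k}. e (r j))) =
    config_avg A v (N + k) ?g * (\<Sum>\<^sub>\<infinity>a\<in>A. v a * e a)"
    by (simp only: add_Suc_right)
  then show ?case unfolding Suc.IH by (simp only: power_Suc mult_ac)
qed

text \<open>The product of the factors 1 + x e is expanded over the set S of replicas where the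
  summand x e is chosen.\<close>

lemma config_avg_tilt:
  fixes v :: "'a \<Rightarrow> real" and N :: nat
  assumes v: "\<And>a. a \<in> A \<Longrightarrow> 0 \<le> v a" "(v has_sum 1) A"
    and B: "\<And>r. r \<in> tuples A N \<Longrightarrow> \<bar>g r\<bar> \<le> B"
    and e: "\<And>a. a \<in> A \<Longrightarrow> e a = 1 \<or> e a = -1"
  shows "config_avg A (\<lambda>a. v a * (1 + x * e a) / D) N g =
    (\<Sum>S\<in>Pow {1..N}. x ^ card S * config_avg A v N (\<lambda>r. g r * (\<Prod>i\<in>S. e (r i)))) / D ^ N"
proof -
  have gB: "\<bar>g r * (\<Prod>i\<in>S. e (r i))\<bar> \<le> B" if S: "S \<in> Pow {1..N}" and s: "r \<in> tuples A N" for S r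
  proof -
    have "\<bar>\<Prod>i\<in>S. e (r i)\<bar> = 1"
      by (intro abs_prod_signs e) (use s S in \<open>auto simp: PiE_iff\<close>)
    then show ?thesis using B[OF s] by (simp add: abs_mult)
  qed
  have "config_avg A (\<lambda>a. v a * (1 + x * e a) / D) N g =
    (\<Sum>\<^sub>\<infinity>r\<in>tuples A N. ((\<Prod>i\<in>{1..N}. v (r i)) *
       (\<Sum>S\<in>Pow {1..N}. x ^ card S * (g r * (\<Prod>i\<in>S. e (r i))))) * inverse (D ^ N))"
    unfolding config_avg_def
  proof (rule infsum_cong)
    fix r :: "nat \<Rightarrow> 'a"
    have "(\<Prod>i\<in>{1..N}. x * e (r i) + 1) = (\<Sum>S\<in>Pow {1..N}. x ^ card S * (\<Prod>i\<in>S. e (r i)))"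
      by (subst prod_add) (simp_all add: prod.distrib)
    then have "g r * (\<Prod>i\<in>{1..N}. 1 + x * e (r i)) = (\<Sum>S\<in>Pow {1..N}. x ^ card S * (g r * (\<Prod>i\<in>S. e (r i))))"
      by (simp add: add.commute sum_distrib_left mult_ac)
    moreover have "(\<Prod>i\<in>{1..N}. v (r i) * (1 + x * e (r i)) / D) =
      (\<Prod>i\<in>{1..N}. v (r i)) * (\<Prod>i\<in>{1..N}. 1 + x * e (r i)) * inverse (D ^ N)"
      by (simp add: prod_dividef prod.distrib divide_inverse power_inverse)
    ultimately show "(\<Prod>i\<in>{1..N}. v (r i) * (1 + x * e (r i)) / D) * g r =
      ((\<Prod>i\<in>{1..N}. v (r i)) * (\<Sum>S\<in>Pow {1..N}. x ^ card S * (g r * (\<Prod>i\<in>S. e (r i))))) * inverse (D ^ N)"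
      by (simp add: mult_ac)
  qed
  also have "\<dots> = config_avg A v N (\<lambda>r. \<Sum>S\<in>Pow {1..N}. x ^ card S * (g r * (\<Prod>i\<in>S. e (r i)))) * inverse (D ^ N)"
    unfolding config_avg_def by (rule infsum_cmult_left')
  also have "config_avg A v N (\<lambda>r. \<Sum>S\<in>Pow {1..N}. x ^ card S * (g r * (\<Prod>i\<in>S. e (r i)))) =
    (\<Sum>S\<in>Pow {1..N}. x ^ card S * config_avg A v N (\<lambda>r. g r * (\<Prod>i\<in>S. e (r i))))"
    by (rule config_avg_linear[OF v _ gB]) auto
  finally show ?thesis by (simp add: divide_inverse)
qed

text \<open>Independence is assumed for the sigma-algebras generated by two whole families; random
  variables measurable for them generate smaller sigma-algebras and inherit it.\<close>

lemma (in prob_space) indep_var_indep_set: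
  assumes indep: "indep_set (sets V) (sets W)"
    and meas: "X \<in> measurable V S" "Y \<in> measurable W T" "random_variable S X" "random_variable T Y"
    and space: "space V = space M" "space W = space M"
  shows "indep_var S X T Y"
  unfolding indep_var_eq
proof (intro conjI)
  have "sigma_sets (space M) {X -` B \<inter> space M | B. B \<in> sets S} \<subseteq> sets V"
    unfolding space(1)[symmetric] by (rule sets.sigma_sets_subset) (use meas(1) in \<open>auto intro: measurable_sets\<close>)
  moreover have "sigma_sets (space M) {Y -` B \<inter> space M | B. B \<in> sets T} \<subseteq> sets W"
    unfolding space(2)[symmetric] by (rule sets.sigma_sets_subset) (use meas(2) in \<open>auto intro: measurable_sets\<close>)
  ultimately show "indep_set (sigma_sets (space M) {X -` B \<inter> space M | B. B \<in> sets S})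
      (sigma_sets (space M) {Y -` B \<inter> space M | B. B \<in> sets T})"
    using indep unfolding indep_set_def
    by (elim indep_sets_mono_sets) (auto split: bool.split)
qed (fact meas)+

section \<open>Averaging out the signs\<close>

locale gg_signs = gg_overlap_fun M A w \<xi> n F
  for M :: "'o measure" and A :: "'a set" and w :: "'a \<Rightarrow> 'o \<Rightarrow> real"
    and \<xi> :: "'a \<Rightarrow> 'o \<Rightarrow> 'h :: {real_inner, banach, second_countable_topology}"
    and n :: nat and F :: "(nat \<times> nat \<Rightarrow> real) \<Rightarrow> real" +
  fixes \<epsilon> :: "'a \<Rightarrow> 'o \<Rightarrow> real"
  assumes signs_indep: "indep_vars (\<lambda>_. borel) \<epsilon> A"
    and prob_plus: "\<And>\<alpha>. \<alpha> \<in> A \<Longrightarrow> measure M {\<omega> \<in> space M. \<epsilon> \<alpha> \<omega> = 1} = 1 / 2"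
    and prob_minus: "\<And>\<alpha>. \<alpha> \<in> A \<Longrightarrow> measure M {\<omega> \<in> space M. \<epsilon> \<alpha> \<omega> = -1} = 1 / 2"
    and signs_indep_measure: "indep_set
           (sets (vimage_algebra (space M) (\<lambda>\<omega>. \<lambda>\<alpha>\<in>A. (w \<alpha> \<omega>, \<xi> \<alpha> \<omega>))
                    (PiM A (\<lambda>_. borel \<Otimes>\<^sub>M borel))))
           (sets (vimage_algebra (space M) (\<lambda>\<omega>. \<lambda>\<alpha>\<in>A. \<epsilon> \<alpha> \<omega>)
                    (PiM A (\<lambda>_. borel))))"
begin

text \<open>The variables \<open>\<epsilon>\<close> take the values \<open>1\<close> and \<open>-1\<close> only almost surely; this version is bounded
  everywhere.\<close>

definition sg :: "'a \<Rightarrow> 'o \<Rightarrow> real" where "sg \<alpha> \<omega> = (if \<epsilon> \<alpha> \<omega> = 1 then 1 else -1)"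

lemma sg_cases: "sg \<alpha> \<omega> = 1 \<or> sg \<alpha> \<omega> = -1"
  by (simp add: sg_def)

lemma abs_sg_prod: "\<bar>\<Prod>i\<in>J. sg (r i) \<omega>\<bar> = 1"
  by (rule abs_prod_signs[where e="\<lambda>\<alpha>. sg \<alpha> \<omega>"]) (rule sg_cases)

lemma \<epsilon>_measurable: "\<alpha> \<in> A \<Longrightarrow> random_variable borel (\<epsilon> \<alpha>)"
  using signs_indep unfolding indep_vars_def by blast

lemma sg_measurable: "\<alpha> \<in> A \<Longrightarrow> random_variable borel (sg \<alpha>)"
proof -
  assume "\<alpha> \<in> A"
  note [measurable] = \<epsilon>_measurable[OF this]
  show ?thesis unfolding sg_def by measurable
qed

text \<open>The values 1 and -1 together have probability one, and countability of \<open>A\<close>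
  allows one exceptional null set for all signs.\<close>

lemma \<epsilon>_eq_sg: "AE \<omega> in M. \<forall>\<alpha>\<in>A. \<epsilon> \<alpha> \<omega> = sg \<alpha> \<omega>"
proof (subst AE_ball_countable[OF countable_index], intro ballI)
  fix \<alpha> assume a: "\<alpha> \<in> A"
  note [measurable] = \<epsilon>_measurable[OF a]
  let ?P = "{\<omega> \<in> space M. \<epsilon> \<alpha> \<omega> = 1}" and ?N = "{\<omega> \<in> space M. \<epsilon> \<alpha> \<omega> = -1}"
  have "prob (?P \<union> ?N) = prob ?P + prob ?N"
    by (rule finite_measure_Union) auto
  then have "prob (?P \<union> ?N) = 1" using prob_plus[OF a] prob_minus[OF a] by simp
  from AE_prob_1[OF this] show "AE \<omega> in M. \<epsilon> \<alpha> \<omega> = sg \<alpha> \<omega>"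
    by eventually_elim (auto simp: sg_def)
qed

lemma AE_\<epsilon>_bounded: "\<alpha> \<in> A \<Longrightarrow> AE \<omega> in M. norm (\<epsilon> \<alpha> \<omega>) \<le> 1"
proof -
  assume a: "\<alpha> \<in> A"
  from \<epsilon>_eq_sg show ?thesis
  proof eventually_elim
    case (elim \<omega>)
    then have "\<epsilon> \<alpha> \<omega> = sg \<alpha> \<omega>" using a by blast
    then show ?case using sg_cases[of \<alpha> \<omega>] by auto
  qed
qed

lemma expectation_\<epsilon>: "\<alpha> \<in> A \<Longrightarrow> expectation (\<epsilon> \<alpha>) = 0"
proof -
  assume a: "\<alpha> \<in> A"
  note [measurable] = \<epsilon>_measurable[OF a]
  let ?P = "{\<omega> \<in> space M. \<epsilon> \<alpha> \<omega> = 1}" and ?N = "{\<omega> \<in> space M. \<epsilon> \<alpha> \<omega> = -1}"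
  have "expectation (\<epsilon> \<alpha>) = expectation (\<lambda>\<omega>. indicat_real ?P \<omega> - indicat_real ?N \<omega>)"
  proof (rule integral_cong_AE)
    show "AE \<omega> in M. \<epsilon> \<alpha> \<omega> = indicat_real ?P \<omega> - indicat_real ?N \<omega>"
      using \<epsilon>_eq_sg AE_space
    proof eventually_elim
      case (elim \<omega>)
      then have "\<epsilon> \<alpha> \<omega> = sg \<alpha> \<omega>" using a by blast
      then show ?case using elim(2) by (auto simp: sg_def indicator_def split: if_splits)
    qed
  qed measurable
  also have "\<dots> = prob ?P - prob ?N"
    by (subst Bochner_Integration.integral_diff) (auto intro!: integrable_real_indicator simp: less_top[symmetric])
  finally show ?thesis using prob_plus[OF a] prob_minus[OF a] by simp
qed

lemma expectation_prod_\<epsilon>: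
  assumes T: "finite T" "T \<subseteq> A"
  shows "expectation (\<lambda>\<omega>. \<Prod>a\<in>T. \<epsilon> a \<omega>) = of_bool (T = {})"
proof -
  have "expectation (\<lambda>\<omega>. \<Prod>a\<in>T. \<epsilon> a \<omega>) = (\<Prod>a\<in>T. expectation (\<epsilon> a))"
  proof (rule indep_vars_lebesgue_integral[OF T(1) indep_vars_subset[OF signs_indep T(2)]])
    show "integrable M (\<epsilon> a)" if "a \<in> T" for a
      by (rule integrable_const_bound[OF AE_\<epsilon>_bounded \<epsilon>_measurable]) (use that T in auto)
  qed
  also have "\<dots> = of_bool (T = {})"
  proof (cases "T = {}")
    case False
    then obtain a where "a \<in> T" by blast
    then show ?thesis using T False expectation_\<epsilon> by (auto intro!: prod_zero)
  qed simp
  finally show ?thesis .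
qed

text \<open>The product reduces to one over the distinct configurations of odd multiplicity, and a
  nonempty product of independent centred signs has mean zero.\<close>

lemma expectation_prod_\<epsilon>_config:
  assumes r: "r \<in> configs K" and J: "J \<subseteq> {1..K}"
  shows "expectation (\<lambda>\<omega>. \<Prod>i\<in>J. \<epsilon> (r i) \<omega>) = odd_is J 0 r"
proof -
  have fin: "finite J" using J finite_subset by blast
  have sA: "r i \<in> A" if "i \<in> J" for i using that r J by (auto simp: PiE_iff)
  have oA: "odd_set J r \<subseteq> A" using odd_set_subset[of J r] sA by blast
  have "expectation (\<lambda>\<omega>. \<Prod>i\<in>J. \<epsilon> (r i) \<omega>) = expectation (\<lambda>\<omega>. \<Prod>a\<in>odd_set J r. \<epsilon> a \<omega>)"
  proof (rule integral_cong_AE)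
    show "AE \<omega> in M. (\<Prod>i\<in>J. \<epsilon> (r i) \<omega>) = (\<Prod>a\<in>odd_set J r. \<epsilon> a \<omega>)"
      using \<epsilon>_eq_sg
    proof eventually_elim
      case (elim \<omega>)
      show ?case
        by (rule prod_signs_eq_odd_set[OF fin, where e="\<lambda>a. \<epsilon> a \<omega>"]) (use elim sA sg_cases in metis)
    qed
  qed (intro borel_measurable_prod \<epsilon>_measurable sA; use oA in \<open>auto intro: \<epsilon>_measurable\<close>)+
  also have "\<dots> = of_bool (odd_set J r = {})"
    by (rule expectation_prod_\<epsilon>) (use fin oA in auto)
  also have "\<dots> = odd_is J 0 r" using fin by (simp add: odd_is_def)
  finally show ?thesis .
qed

lemma weight_le_1: "\<omega> \<in> space M \<Longrightarrow> \<alpha> \<in> A \<Longrightarrow> w \<alpha> \<omega> \<le> 1"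
  using pmf_weight_pmf[of A "\<lambda>\<alpha>. w \<alpha> \<omega>" \<alpha>] weight_nonneg[of _ \<omega>] weight_total[of \<omega>]
    pmf_le_1[of "weight_pmf A (\<lambda>\<alpha>. w \<alpha> \<omega>)" \<alpha>] by simp

lemma weighted_observable_integrable:
  assumes r: "r \<in> configs K" and g: "observable K g"
  shows "integrable M (\<lambda>\<omega>. weights K r \<omega> * g \<omega> r)"
proof -
  obtain B where B: "\<And>\<omega> r. \<omega> \<in> space M \<Longrightarrow> r \<in> configs K \<Longrightarrow> \<bar>g \<omega> r\<bar> \<le> B"
    using g unfolding observable_def by meson
  have sA: "r i \<in> A" if "i \<in> {1..K}" for i using r that by (auto simp: PiE_iff)
  show ?thesis
  proof (rule integrable_const_bound)
    show "AE \<omega> in M. norm (weights K r \<omega> * g \<omega> r) \<le> B"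
    proof (rule AE_I2)
      fix \<omega> assume o: "\<omega> \<in> space M"
      have p: "0 \<le> weights K r \<omega>" "weights K r \<omega> \<le> 1"
        using weight_nonneg[OF sA o] weight_le_1[OF o sA] by (auto intro!: prod_nonneg prod_le_1)
      have "norm (weights K r \<omega> * g \<omega> r) = weights K r \<omega> * \<bar>g \<omega> r\<bar>"
        using p by (simp add: abs_mult)
      also have "\<dots> \<le> 1 * \<bar>g \<omega> r\<bar>" by (rule mult_right_mono[OF p(2)]) simp
      finally show "norm (weights K r \<omega> * g \<omega> r) \<le> B" using B[OF o r] by simp
    qed
    show "(\<lambda>\<omega>. weights K r \<omega> * g \<omega> r) \<in> borel_measurable M"
      using g r by (intro borel_measurable_times weight_prod_measurable) (simp_all add: observable_def)
  qed
qed

lemma expectation_signs_factor: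
  assumes r: "r \<in> configs K" and K: "n \<le> K" and J: "J \<subseteq> {1..K}"
  shows "expectation (\<lambda>\<omega>. weights K r \<omega> * (ov n F \<omega> r * (\<Prod>i\<in>J. sg (r i) \<omega>))) =
    expectation (\<lambda>\<omega>. weights K r \<omega> * (ov n F \<omega> r * odd_is J 0 r))"
proof -
  have fin: "finite J" using J finite_subset by blast
  have sA: "r i \<in> A" if "i \<in> {1..K}" for i using r that by (auto simp: PiE_iff)
  let ?X = "\<lambda>\<omega>. weights K r \<omega> * ov n F \<omega> r"
  \<comment> \<open>Independence is assumed for \<open>\<epsilon>\<close> itself, so the
    factorisation is carried out with it and \<open>sg\<close> is replaced almost surely.\<close>
  let ?Y = "\<lambda>\<omega>. \<Prod>i\<in>J. \<epsilon> (r i) \<omega>"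
  let ?S = "PiM A (\<lambda>_. borel \<Otimes>\<^sub>M borel) :: ('a \<Rightarrow> real \<times> 'h) measure"
  \<comment> \<open>Weights and overlaps of the fixed tuple as a measurable function of the whole
    family of weights and points, so that composition gives measurability for the sigma-algebra
    generated by that family.\<close>
  define f where "f p = (\<Prod>i\<in>{1..K}. fst (p (r i))) *
    F (\<lambda>q\<in>{1..n} \<times> {1..n}. snd (p (r (fst q))) \<bullet> snd (p (r (snd q))))" for p :: "'a \<Rightarrow> real \<times> 'h"
  define h where "h p = (\<Prod>i\<in>J. p (r i))" for p :: "'a \<Rightarrow> real"
  have c: "(\<lambda>p. p (r i)) \<in> measurable ?S (borel \<Otimes>\<^sub>M borel)" if "i \<in> {1..K}" for i
    by (rule measurable_component_singleton[OF sA[OF that]])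
  have c1: "(\<lambda>p. fst (p (r i))) \<in> borel_measurable ?S" if "i \<in> {1..K}" for i
    by (rule measurable_compose[OF c[OF that] measurable_fst])
  have c2: "(\<lambda>p. snd (p (r i))) \<in> borel_measurable ?S" if "i \<in> {1..K}" for i
    by (rule measurable_compose[OF c[OF that] measurable_snd])
  have f: "f \<in> borel_measurable ?S"
    unfolding f_def
  proof (rule borel_measurable_times)
    show "(\<lambda>p. \<Prod>i\<in>{1..K}. fst (p (r i))) \<in> borel_measurable ?S"
      by (intro borel_measurable_prod c1)
    have "(\<lambda>p. \<lambda>q\<in>{1..n} \<times> {1..n}. snd (p (r (fst q))) \<bullet> snd (p (r (snd q)))) \<in> measurable ?S (overlap_space n)"
      by (intro measurable_restrict borel_measurable_inner c2) (use K in auto)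
    then show "(\<lambda>p. F (\<lambda>q\<in>{1..n} \<times> {1..n}. snd (p (r (fst q))) \<bullet> snd (p (r (snd q))))) \<in> borel_measurable ?S"
      by (rule measurable_compose) (use F in \<open>simp add: bounded_measurable_overlap_fun_def\<close>)
  qed
  have h: "h \<in> borel_measurable (PiM A (\<lambda>_. borel))"
    unfolding h_def by (intro borel_measurable_prod measurable_component_singleton sA) (use J in auto)
  have X: "f (\<lambda>\<alpha>\<in>A. (w \<alpha> \<omega>, \<xi> \<alpha> \<omega>)) = ?X \<omega>" for \<omega>
  proof -
    have "(\<lambda>q\<in>{1..n} \<times> {1..n}. snd ((\<lambda>\<alpha>\<in>A. (w \<alpha> \<omega>, \<xi> \<alpha> \<omega>)) (r (fst q))) \<bullet> snd ((\<lambda>\<alpha>\<in>A. (w \<alpha> \<omega>, \<xi> \<alpha> \<omega>)) (r (snd q))))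
      = overlap_array n (\<lambda>\<alpha>. \<xi> \<alpha> \<omega>) r"
      unfolding overlap_array_def case_prod_beta' overlap_def
      by (rule restrict_ext) (use sA K in auto)
    moreover have "(\<Prod>i\<in>{1..K}. fst ((\<lambda>\<alpha>\<in>A. (w \<alpha> \<omega>, \<xi> \<alpha> \<omega>)) (r i))) = weights K r \<omega>"
      by (rule prod.cong) (use sA in auto)
    ultimately show ?thesis by (simp add: f_def)
  qed
  have Y: "h (\<lambda>\<alpha>\<in>A. \<epsilon> \<alpha> \<omega>) = ?Y \<omega>" for \<omega>
    unfolding h_def by (rule prod.cong) (use sA J in auto)
  have intX: "integrable M ?X"
    by (rule weighted_observable_integrable[OF r observable_ov[OF F K]])
  have Xm: "?X \<in> borel_measurable M" using intX by (rule borel_measurable_integrable)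
  have Ym: "?Y \<in> borel_measurable M" by (intro borel_measurable_prod \<epsilon>_measurable sA) (use J in auto)
  have indep: "indep_var borel ?X borel ?Y"
  proof (rule indep_var_indep_set[OF signs_indep_measure])
    show "?X \<in> borel_measurable (vimage_algebra (space M) (\<lambda>\<omega>. \<lambda>\<alpha>\<in>A. (w \<alpha> \<omega>, \<xi> \<alpha> \<omega>)) ?S)"
      using measurable_compose[OF measurable_vimage_algebra1 f, of "\<lambda>\<omega>. \<lambda>\<alpha>\<in>A. (w \<alpha> \<omega>, \<xi> \<alpha> \<omega>)" "space M"]
      by (simp add: X space_PiM space_pair_measure)
    show "?Y \<in> borel_measurable (vimage_algebra (space M) (\<lambda>\<omega>. \<lambda>\<alpha>\<in>A. \<epsilon> \<alpha> \<omega>) (PiM A (\<lambda>_. borel)))"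
      using measurable_compose[OF measurable_vimage_algebra1 h, of "\<lambda>\<omega>. \<lambda>\<alpha>\<in>A. \<epsilon> \<alpha> \<omega>" "space M"]
      by (simp add: Y space_PiM)
  qed (fact Xm, fact Ym, simp_all)
  have Ys: "AE \<omega> in M. ?Y \<omega> = (\<Prod>i\<in>J. sg (r i) \<omega>)"
    using \<epsilon>_eq_sg by eventually_elim (use sA J in \<open>auto intro!: prod.cong\<close>)
  have intY: "integrable M ?Y"
  proof (rule integrable_const_bound[OF _ Ym])
    show "AE \<omega> in M. norm (?Y \<omega>) \<le> 1"
      using Ys
      by eventually_elim (simp add: abs_sg_prod)
  qed
  have "expectation (\<lambda>\<omega>. weights K r \<omega> * (ov n F \<omega> r * (\<Prod>i\<in>J. sg (r i) \<omega>))) =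
    expectation (\<lambda>\<omega>. ?X \<omega> * ?Y \<omega>)"
  proof (rule integral_cong_AE)
    show "(\<lambda>\<omega>. weights K r \<omega> * (ov n F \<omega> r * (\<Prod>i\<in>J. sg (r i) \<omega>))) \<in> borel_measurable M"
      using observable_ov[OF F K] r sA J
      by (intro borel_measurable_times weight_prod_measurable borel_measurable_prod sg_measurable)
         (auto simp: observable_def)
    show "(\<lambda>\<omega>. ?X \<omega> * ?Y \<omega>) \<in> borel_measurable M"
      using intX intY by (intro borel_measurable_times borel_measurable_integrable)
    show "AE \<omega> in M. weights K r \<omega> * (ov n F \<omega> r * (\<Prod>i\<in>J. sg (r i) \<omega>)) = ?X \<omega> * ?Y \<omega>"
      using Ys by eventually_elim (simp add: mult.assoc)
  qed
  also have "\<dots> = expectation ?X * expectation ?Y"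
    by (rule indep_var_lebesgue_integral[OF indep intX intY])
  also have "\<dots> = expectation ?X * odd_is J 0 r"
    by (simp only: expectation_prod_\<epsilon>_config[OF r J])
  also have "\<dots> = expectation (\<lambda>\<omega>. ?X \<omega> * odd_is J 0 r)" by simp
  finally show ?thesis by (simp only: mult.assoc)
qed

lemma observable_sg_prod:
  assumes J: "J \<subseteq> {1..K}"
  shows "observable K (\<lambda>\<omega> r. \<Prod>i\<in>J. sg (r i) \<omega>)"
  unfolding observable_def
proof (intro conjI ballI exI)
  show "(\<lambda>\<omega>. \<Prod>i\<in>J. sg (r i) \<omega>) \<in> borel_measurable M" if "r \<in> configs K" for r
    by (intro borel_measurable_prod sg_measurable) (use that J in \<open>auto simp: PiE_iff\<close>)
  show "\<bar>\<Prod>i\<in>J. sg (r i) \<omega>\<bar> \<le> 1" for r :: "nat \<Rightarrow> 'a" and \<omega>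
    by (simp add: abs_sg_prod)
qed

text \<open>Under \<open>EE\<close> the tuple is random as well. \<open>EE_swap\<close> puts the sum
  over tuples outside, and for a fixed tuple the signs are independent of weights and
  overlaps.\<close>

lemma EE_signs:
  assumes K: "n \<le> K" and J: "J \<subseteq> {1..K}"
  shows "EE K (\<lambda>\<omega> r. ov n F \<omega> r * (\<Prod>i\<in>J. sg (r i) \<omega>)) = Q 0 J"
proof -
  have b1: "observable K (\<lambda>\<omega> r. ov n F \<omega> r * (\<Prod>i\<in>J. sg (r i) \<omega>))"
    by (rule observable_mult[OF observable_ov[OF F K] observable_sg_prod[OF J]])
  have b2: "observable K (obs J 0)"
    by (rule ov_observable_bounded[OF ov_observable_odd_is[OF K J]])
  show ?thesis
    unfolding Q_eq[OF K J] EE_swap[OF b1] EE_swap[OF b2]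
    by (rule Bochner_Integration.integral_cong[OF refl]) (simp add: expectation_signs_factor[OF _ K J])
qed

end

text \<open>For real families summability is absolute, and otherwise both sides take the default
  value 0. Measurability of infinite sums thus follows from that of parametrised integrals.\<close>

lemma infsum_eq_integral_count_space:
  fixes f :: "'a \<Rightarrow> real"
  shows "infsum f I = (\<integral>i. f i \<partial>count_space I)"
proof (cases "abs_summable f I")
  case True
  then show ?thesis using infsetsum_infsum[OF True] by (simp add: infsetsum_def)
next
  case False
  then have "\<not> f summable_on I"
    using abs_summable_equivalent[of f I] summable_on_iff_abs_summable_on_real[of f I] by simp
  then have "infsum f I = 0" by (rule infsum_not_exists)
  moreover have "(\<integral>i. f i \<partial>count_space I) = 0"
    using False unfolding abs_summable_on_def by (rule not_integrable_integral_eq)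
  ultimately show ?thesis by simp
qed

lemma borel_measurable_infsum:
  fixes f :: "'a \<Rightarrow> 'o \<Rightarrow> real"
  assumes I: "countable I" and f: "\<And>i. i \<in> I \<Longrightarrow> f i \<in> borel_measurable M"
  shows "(\<lambda>\<omega>. \<Sum>\<^sub>\<infinity>i\<in>I. f i \<omega>) \<in> borel_measurable M"
proof -
  interpret sigma_finite_measure "count_space I" by (rule sigma_finite_measure_count_space_countable[OF I])
  have "(\<lambda>z. f (snd z) (fst z)) \<in> borel_measurable (M \<Otimes>\<^sub>M count_space I)"
    by (rule measurable_compose_countable'[where f="\<lambda>i z. f i (fst z)" and g=snd and I=I])
       (use f I in \<open>auto intro: measurable_compose[OF measurable_fst]\<close>)
  then show ?thesis
    unfolding infsum_eq_integral_count_space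
    by (intro borel_measurable_lebesgue_integral) (simp add: case_prod_beta')
qed

section \<open>Expansion of the tilted average and termwise integration\<close>

context gg_signs begin

text \<open>The k-th term of the binomial series for the tilted average, with X^k written through k
  extra replicas and the tilting factors of the first n replicas expanded over S.\<close>

definition tilt_term :: "real \<Rightarrow> nat \<Rightarrow> 'o \<Rightarrow> real" where
  "tilt_term x k \<omega> = rec.b k * x ^ k * (\<Sum>S\<in>Pow {1..n}. x ^ card S *
     gibbs \<omega> (n + k) (\<lambda>r. ov n F \<omega> r * (\<Prod>i\<in>S \<union> {n + 1..n + k}. sg (r i) \<omega>)))"

lemma extended_subset: "S \<in> Pow {1..n} \<Longrightarrow> S \<union> {n + 1..n + k} \<subseteq> {1..n + k}"
  by force

lemma observable_tilt:
  assumes "S \<in> Pow {1..n}"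
  shows "observable (n + k) (\<lambda>\<omega> r. ov n F \<omega> r * (\<Prod>i\<in>S \<union> {n + 1..n + k}. sg (r i) \<omega>))"
  by (rule observable_mult[OF observable_ov[OF F le_add1]
        observable_sg_prod[OF extended_subset[OF assms]]])

lemma ov_bound:
  "\<exists>B\<ge>0. \<forall>\<omega> r. \<bar>ov n F \<omega> r\<bar> \<le> B"
proof -
  have "bounded (F ` space (overlap_space n))" using F by (simp add: bounded_measurable_overlap_fun_def)
  then obtain B where B: "\<And>a. a \<in> space (overlap_space n) \<Longrightarrow> \<bar>F a\<bar> \<le> B"
    unfolding bounded_iff by auto
  have "\<bar>ov n F \<omega> r\<bar> \<le> \<bar>B\<bar>" for \<omega> r
    using B[OF overlap_array_in_space, of "\<lambda>\<alpha>. \<xi> \<alpha> \<omega>" r] by linarith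
  then show ?thesis by (intro exI[of _ "\<bar>B\<bar>"]) auto
qed

text \<open>The bound does not grow with the number of replicas, which makes the series in
  \<open>expansion_sums_Q\<close> converge for |x| < 1.\<close>

lemma abs_Q_le:
  assumes "0 \<le> B" "\<And>\<omega> r. \<bar>ov n F \<omega> r\<bar> \<le> B" and J: "J \<subseteq> {1..N}" and N: "n \<le> N"
  shows "\<bar>Q s J\<bar> \<le> B"
proof -
  have b: "observable N (obs J s)"
    by (rule ov_observable_bounded[OF ov_observable_odd_is[OF N J]])
  have "\<bar>ov n F \<omega> r * odd_is J s r\<bar> \<le> B" for \<omega> r
    using assms(1,2) by (simp add: odd_is_def)
  then have le: "ov n F \<omega> r * odd_is J s r \<le> B" "- B \<le> ov n F \<omega> r * odd_is J s r" for \<omega> r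
    by (simp_all add: abs_le_iff minus_le_iff)
  have "EE N (obs J s) \<le> EE N (\<lambda>\<omega> r. B)"
    by (rule EE_mono[OF b observable_const]) (rule le)
  moreover have "EE N (\<lambda>\<omega> r. - B) \<le> EE N (obs J s)"
    by (rule EE_mono[OF observable_const b]) (rule le)
  ultimately show ?thesis unfolding Q_eq[OF N J] by simp
qed

lemma expansion_sums_Q:
  assumes x: "\<bar>x\<bar> < 1"
  shows "(\<lambda>k. rec.b k * x ^ k * (\<Sum>S\<in>Pow {1..n}. x ^ card S * Q s (S \<union> {n + 1..n + k}))) sums Q s {}"
  unfolding rec.sum_Pow_Q
proof (rule rec.expansion_sums)
  fix j
  obtain B where B: "0 \<le> B" "\<And>\<omega> r. \<bar>ov n F \<omega> r\<bar> \<le> B" using ov_bound by blast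
  let ?c = "real (card (subsets n j))"
  have qb: "\<bar>rec.q s j k\<bar> \<le> ?c * B" for k
  proof -
    have "\<bar>rec.q s j k\<bar> \<le> (\<Sum>S\<in>subsets n j. \<bar>Q s (S \<union> {n + 1..n + k})\<bar>)"
      unfolding rec.q_def by (rule sum_abs)
    also have "\<dots> \<le> (\<Sum>S\<in>subsets n j. B)"
    proof (rule sum_mono)
      fix S assume "S \<in> subsets n j"
      then have "S \<union> {n + 1..n + k} \<subseteq> {1..n + k}" by (intro extended_subset) (simp add: subsets_def)
      then show "\<bar>Q s (S \<union> {n + 1..n + k})\<bar> \<le> B" by (rule abs_Q_le[OF B]) simp
    qed
    finally show ?thesis by simp
  qed
  have "summable (\<lambda>k. \<bar>rec.b k * x ^ k\<bar> * (?c * B))"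
    by (rule summable_mult2[OF rec.b_summable[OF x]])
  then show "summable (\<lambda>k. rec.b k * x ^ k * rec.q s j k)"
    by (rule summable_comparison_test') (auto simp: abs_mult intro!: mult_mono qb)
qed

lemma tilt_term_measurable: "tilt_term x k \<in> borel_measurable M"
  unfolding tilt_term_def
  by (intro borel_measurable_times borel_measurable_const borel_measurable_sum
      config_avg_measurable observable_tilt)

text \<open>2^n counts the subsets S, each contributing at most \<open>B\<close>. Being uniform in
  \<open>\<omega>\<close>, the bound supplies the dominating series.\<close>

lemma abs_tilt_term_le:
  assumes x: "\<bar>x\<bar> < 1" and B: "0 \<le> B" "\<And>\<omega> r. \<bar>ov n F \<omega> r\<bar> \<le> B" and o: "\<omega> \<in> space M"
  shows "\<bar>tilt_term x k \<omega>\<bar> \<le> \<bar>rec.b k * x ^ k\<bar> * (2 ^ n * B)"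
proof -
  let ?t = "\<lambda>S. x ^ card S * gibbs \<omega> (n + k) (\<lambda>r. ov n F \<omega> r * (\<Prod>i\<in>S \<union> {n + 1..n + k}. sg (r i) \<omega>))"
  have t: "\<bar>?t S\<bar> \<le> 1 * B" for S
    unfolding abs_mult power_abs
  proof (rule mult_mono)
    show "\<bar>x\<bar> ^ card S \<le> 1" using x by (intro power_le_one) auto
    show "\<bar>gibbs \<omega> (n + k) (\<lambda>r. ov n F \<omega> r * (\<Prod>i\<in>S \<union> {n + 1..n + k}. sg (r i) \<omega>))\<bar> \<le> B"
      by (rule abs_config_avg_le)
         (use weight_nonneg weight_total o B in \<open>auto simp: abs_mult abs_sg_prod\<close>)
  qed auto
  have "\<bar>\<Sum>S\<in>Pow {1..n}. ?t S\<bar> \<le> (\<Sum>S\<in>Pow {1..n}. 1 * B)"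
    by (rule order_trans[OF sum_abs sum_mono]) (rule t)
  also have "\<dots> = 2 ^ n * B" by (simp add: card_Pow)
  finally show ?thesis
    unfolding tilt_term_def abs_mult[of "rec.b k * x ^ k"] by (intro mult_left_mono) auto
qed

lemma expectation_tilt_term:
  assumes x: "\<bar>x\<bar> < 1"
  shows "expectation (tilt_term x k) = rec.b k * x ^ k * (\<Sum>S\<in>Pow {1..n}. x ^ card S * Q 0 (S \<union> {n + 1..n + k}))"
proof -
  let ?a = "\<lambda>S \<omega>. gibbs \<omega> (n + k) (\<lambda>r. ov n F \<omega> r * (\<Prod>i\<in>S \<union> {n + 1..n + k}. sg (r i) \<omega>))"
  obtain B where B: "0 \<le> B" "\<And>\<omega> r. \<bar>ov n F \<omega> r\<bar> \<le> B" using ov_bound by blast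
  have int: "integrable M (?a S)" if S: "S \<in> Pow {1..n}" for S
  proof (rule integrable_const_bound[where B=B])
    show "?a S \<in> borel_measurable M" by (rule config_avg_measurable[OF observable_tilt[OF S]])
    show "AE \<omega> in M. norm (?a S \<omega>) \<le> B"
      unfolding real_norm_def
      by (intro AE_I2 abs_config_avg_le)
         (use weight_nonneg weight_total B in \<open>auto simp: abs_mult abs_sg_prod\<close>)
  qed
  have ex: "expectation (?a S) = Q 0 (S \<union> {n + 1..n + k})" if S: "S \<in> Pow {1..n}" for S
    using EE_signs[OF le_add1 extended_subset[OF S]] unfolding EE_eq_config_avg[OF observable_tilt[OF S]] .
  have "expectation (tilt_term x k) = rec.b k * x ^ k * expectation (\<lambda>\<omega>. \<Sum>S\<in>Pow {1..n}. x ^ card S * ?a S \<omega>)"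
    unfolding tilt_term_def by simp
  also have "expectation (\<lambda>\<omega>. \<Sum>S\<in>Pow {1..n}. x ^ card S * ?a S \<omega>) = (\<Sum>S\<in>Pow {1..n}. x ^ card S * expectation (?a S))"
    using int by (subst Bochner_Integration.integral_sum) auto
  also have "\<dots> = (\<Sum>S\<in>Pow {1..n}. x ^ card S * Q 0 (S \<union> {n + 1..n + k}))"
    by (rule sum.cong[OF refl]) (simp only: ex)
  finally show ?thesis .
qed

lemma exp_sign: "s = 1 \<or> s = -1 \<Longrightarrow> exp (t * s) = cosh t * (1 + tanh t * s)" for s t :: real
proof -
  assume s: "s = 1 \<or> s = -1"
  have "cosh t * tanh t = sinh t" using cosh_real_pos[of t] by (simp add: tanh_def)
  then have "cosh t * (1 + tanh t * s) = cosh t + sinh t * s"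
    by (simp add: distrib_left mult.assoc[symmetric])
  then show ?thesis using s cosh_plus_sinh[of t] cosh_minus_sinh[of t] by auto
qed

lemma tilted_avg_sums:
  assumes o: "\<omega> \<in> space M" and eq: "\<forall>\<alpha>\<in>A. \<epsilon> \<alpha> \<omega> = sg \<alpha> \<omega>"
  shows "(\<lambda>k. tilt_term (tanh t) k \<omega>) sums
    config_avg A (\<lambda>\<alpha>. tilted_weight A w \<epsilon> t \<alpha> \<omega>) n (\<lambda>r. ov n F \<omega> r)"
proof -
  let ?v = "\<lambda>\<alpha>. w \<alpha> \<omega>" and ?e = "\<lambda>\<alpha>. sg \<alpha> \<omega>" and ?x = "tanh t"
  have v: "\<And>a. a \<in> A \<Longrightarrow> 0 \<le> ?v a" "(?v has_sum 1) A" using weight_nonneg weight_total o by auto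
  have e: "?e a = 1 \<or> ?e a = -1" for a by (rule sg_cases)
  obtain B where B: "0 \<le> B" "\<And>\<omega> r. \<bar>ov n F \<omega> r\<bar> \<le> B" using ov_bound by blast
  define X where "X = (\<Sum>\<^sub>\<infinity>a\<in>A. ?v a * ?e a)"
  have abs_eq: "\<bar>?v a * ?e a\<bar> = ?v a" if "a \<in> A" for a using v(1)[OF that] e[of a] by (auto simp: abs_mult)
  have sm: "(\<lambda>a. norm (?v a * ?e a)) summable_on A"
  proof -
    have "(\<lambda>a. norm (?v a * ?e a)) summable_on A \<longleftrightarrow> ?v summable_on A"
      by (rule summable_on_cong) (simp only: real_norm_def abs_eq)
    then show ?thesis using v(2) by (blast intro: has_sum_imp_summable)
  qed
  have X1: "\<bar>X\<bar> \<le> 1"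
  proof -
    have "\<bar>X\<bar> \<le> (\<Sum>\<^sub>\<infinity>a\<in>A. norm (?v a * ?e a))"
      using norm_infsum_bound[OF sm] by (simp add: X_def)
    also have "\<dots> = (\<Sum>\<^sub>\<infinity>a\<in>A. ?v a)" by (rule infsum_cong) (simp only: real_norm_def abs_eq)
    also have "\<dots> = 1" using v(2) by (rule infsumI)
    finally show ?thesis .
  qed
  have x: "\<bar>?x\<bar> < 1" using tanh_real_bounds[of t] by (auto simp: abs_less_iff)
  \<comment> \<open>Strictness comes from \<open>tanh t\<close>: the weighted mean X of signs is
    only bounded by 1.\<close>
  have xX: "\<bar>?x * X\<bar> < 1"
    using mult_mono[OF order_refl X1, of "\<bar>?x\<bar>"] x by (simp add: abs_mult)
  have "((\<lambda>a. ?v a * ?e a) has_sum X) A"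
    unfolding X_def by (rule has_sum_infsum[OF abs_summable_summable[OF sm]])
  then have hs: "((\<lambda>a. cosh t * (?v a + ?x * (?v a * ?e a))) has_sum cosh t * (1 + ?x * X)) A"
    by (intro has_sum_cmult_right has_sum_add v(2))
  have exp: "w a \<omega> * exp (t * \<epsilon> a \<omega>) = cosh t * (?v a + ?x * (?v a * ?e a))" if "a \<in> A" for a
    using eq that exp_sign[OF e[of a], of t] by (simp add: algebra_simps)
  have den: "(\<Sum>\<^sub>\<infinity>\<gamma>\<in>A. w \<gamma> \<omega> * exp (t * \<epsilon> \<gamma> \<omega>)) = cosh t * (1 + ?x * X)"
  proof -
    have "(\<Sum>\<^sub>\<infinity>\<gamma>\<in>A. w \<gamma> \<omega> * exp (t * \<epsilon> \<gamma> \<omega>)) = (\<Sum>\<^sub>\<infinity>a\<in>A. cosh t * (?v a + ?x * (?v a * ?e a)))"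
      by (rule infsum_cong) (rule exp)
    then show ?thesis using infsumI[OF hs] by simp
  qed
  have tw: "tilted_weight A w \<epsilon> t a \<omega> = ?v a * (1 + ?x * ?e a) / (1 + ?x * X)" if "a \<in> A" for a
  proof -
    have "cosh t \<noteq> 0" using cosh_real_pos[of t] by simp
    then have "tilted_weight A w \<epsilon> t a \<omega> = (?v a + ?x * (?v a * ?e a)) / (1 + ?x * X)"
      unfolding tilted_weight_def den exp[OF that] by (rule mult_divide_mult_cancel_left)
    then show ?thesis by (simp add: algebra_simps)
  qed
  have "config_avg A (\<lambda>\<alpha>. tilted_weight A w \<epsilon> t \<alpha> \<omega>) n (ov n F \<omega>) =
    config_avg A (\<lambda>a. ?v a * (1 + ?x * ?e a) / (1 + ?x * X)) n (ov n F \<omega>)"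
    unfolding config_avg_def
    by (intro infsum_cong arg_cong2[where f="(*)"] refl prod.cong tw) (auto simp: PiE_iff)
  also have "\<dots> = (\<Sum>S\<in>Pow {1..n}. ?x ^ card S * config_avg A ?v n (\<lambda>r. ov n F \<omega> r * (\<Prod>i\<in>S. ?e (r i))))
      / (1 + ?x * X) ^ n"
    by (rule config_avg_tilt[OF v B(2) e])
  finally have tilted: "config_avg A (\<lambda>\<alpha>. tilted_weight A w \<epsilon> t \<alpha> \<omega>) n (ov n F \<omega>) =
     1 / (1 + ?x * X) ^ n * (\<Sum>S\<in>Pow {1..n}. ?x ^ card S * config_avg A ?v n (\<lambda>r. ov n F \<omega> r * (\<Prod>i\<in>S. ?e (r i))))"
    by simp
  have ext: "config_avg A ?v (n + k) (\<lambda>r. ov n F \<omega> r * (\<Prod>i\<in>S \<union> {n + 1..n + k}. ?e (r i))) =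
    config_avg A ?v n (\<lambda>r. ov n F \<omega> r * (\<Prod>i\<in>S. ?e (r i))) * X ^ k"
    if S: "S \<in> Pow {1..n}" for S k
  proof -
    let ?g = "\<lambda>r. ov n F \<omega> r * (\<Prod>i\<in>S. ?e (r i))"
    have gB: "\<bar>?g r\<bar> \<le> B" for r using B(2) by (simp add: abs_mult abs_sg_prod)
    have split: "?g (reindex id n r) * (\<Prod>i\<in>{n + 1..n + k}. ?e (r i)) =
       ov n F \<omega> r * (\<Prod>i\<in>S \<union> {n + 1..n + k}. ?e (r i))" for r
    proof -
      have "(\<Prod>i\<in>S. ?e (reindex id n r i)) = (\<Prod>i\<in>S. ?e (r i))"
        by (rule prod.cong) (use S in auto)
      moreover have "(\<Prod>i\<in>S \<union> {n + 1..n + k}. ?e (r i)) = (\<Prod>i\<in>S. ?e (r i)) * (\<Prod>i\<in>{n + 1..n + k}. ?e (r i))"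
        by (rule prod.union_disjoint) (use S finite_subset[of S "{1..n}"] in auto)
      ultimately show ?thesis by (simp only: ov_restrict[OF order_refl] mult.assoc)
    qed
    have "config_avg A ?v (n + k) (\<lambda>r. ?g (reindex id n r) * (\<Prod>i\<in>{n + 1..n + k}. ?e (r i))) =
      config_avg A ?v n ?g * X ^ k"
      unfolding X_def by (rule config_avg_signs[OF countable_index v gB e])
    then show ?thesis unfolding split .
  qed
  have "tilt_term ?x k \<omega> = rec.b k * (?x * X) ^ k *
     (\<Sum>S\<in>Pow {1..n}. ?x ^ card S * config_avg A ?v n (\<lambda>r. ov n F \<omega> r * (\<Prod>i\<in>S. ?e (r i))))" for k
  proof -
    have "(\<Sum>S\<in>Pow {1..n}. ?x ^ card S * config_avg A ?v (n + k) (\<lambda>r. ov n F \<omega> r * (\<Prod>i\<in>S \<union> {n + 1..n + k}. ?e (r i)))) =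
      (\<Sum>S\<in>Pow {1..n}. X ^ k * (?x ^ card S * config_avg A ?v n (\<lambda>r. ov n F \<omega> r * (\<Prod>i\<in>S. ?e (r i)))))"
      by (rule sum.cong[OF refl]) (simp only: ext mult_ac)
    then show ?thesis
      unfolding tilt_term_def by (simp only: sum_distrib_left[symmetric] power_mult_distrib mult_ac)
  qed
  then show ?thesis
    unfolding tilted using sums_mult2[OF rec.b_sums[OF xX]] by simp
qed

text \<open>Equality with the series holds only almost surely, so measurability is derived from the
  infinite sums that define the tilted average.\<close>

lemma tilted_avg_measurable:
  "(\<lambda>\<omega>. config_avg A (\<lambda>\<alpha>. tilted_weight A w \<epsilon> t \<alpha> \<omega>) n (\<lambda>r. ov n F \<omega> r)) \<in> borel_measurable M"
proof -
  have ex: "(\<lambda>\<omega>. w \<alpha> \<omega> * exp (t * \<epsilon> \<alpha> \<omega>)) \<in> borel_measurable M" if "\<alpha> \<in> A" for \<alpha>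
  proof -
    note [measurable] = \<epsilon>_measurable[OF that] weight_measurable[OF that]
    show ?thesis by measurable
  qed
  have tw: "(\<lambda>\<omega>. tilted_weight A w \<epsilon> t \<alpha> \<omega>) \<in> borel_measurable M" if "\<alpha> \<in> A" for \<alpha>
    unfolding tilted_weight_def
    by (intro borel_measurable_divide ex that borel_measurable_infsum countable_index)
  have F': "(\<lambda>\<omega>. ov n F \<omega> r) \<in> borel_measurable M" if "r \<in> configs n" for r
    using observable_ov[OF F order_refl] that by (simp add: observable_def)
  show ?thesis
    unfolding config_avg_def
    by (intro borel_measurable_infsum countable_configs borel_measurable_times borel_measurable_prod tw F')
       (auto simp: PiE_iff)
qed

text \<open>The uniform bound permits termwise integration, and the expected terms sum to
  \<open>Q 0 {}\<close>. That is the untilted mean, since without chosen replicas no configuration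
  is odd.\<close>

lemma expectation_tilted:
  "expectation (\<lambda>\<omega>. config_avg A (\<lambda>\<alpha>. tilted_weight A w \<epsilon> t \<alpha> \<omega>) n (\<lambda>r. ov n F \<omega> r)) =
   expectation (\<lambda>\<omega>. gibbs \<omega> n (\<lambda>r. ov n F \<omega> r))"
proof -
  let ?x = "tanh t"
  let ?T = "\<lambda>\<omega>. config_avg A (\<lambda>\<alpha>. tilted_weight A w \<epsilon> t \<alpha> \<omega>) n (\<lambda>r. ov n F \<omega> r)"
  have x: "\<bar>?x\<bar> < 1" using tanh_real_bounds[of t] by (auto simp: abs_less_iff)
  obtain B where B: "0 \<le> B" "\<And>\<omega> r. \<bar>ov n F \<omega> r\<bar> \<le> B" using ov_bound by blast
  note bound = abs_tilt_term_le[OF x B]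
  have sumb: "summable (\<lambda>k. \<bar>rec.b k * ?x ^ k\<bar> * (2 ^ n * B))"
    by (rule summable_mult2[OF rec.b_summable[OF x]])
  have int: "integrable M (tilt_term ?x k)" for k
    by (rule integrable_const_bound[OF _ tilt_term_measurable], rule AE_I2) (use bound in simp)
  have "(\<lambda>k. expectation (tilt_term ?x k)) sums expectation (\<lambda>\<omega>. \<Sum>k. tilt_term ?x k \<omega>)"
  proof (rule sums_integral[OF int])
    show "AE \<omega> in M. summable (\<lambda>k. norm (tilt_term ?x k \<omega>))"
      by (rule AE_I2, rule summable_comparison_test'[OF sumb]) (use bound in simp)
    show "summable (\<lambda>k. expectation (\<lambda>\<omega>. norm (tilt_term ?x k \<omega>)))"
    proof (rule summable_comparison_test'[OF sumb])
      fix k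
      have "expectation (\<lambda>\<omega>. norm (tilt_term ?x k \<omega>)) \<le> expectation (\<lambda>\<omega>. \<bar>rec.b k * ?x ^ k\<bar> * (2 ^ n * B))"
        by (rule integral_mono) (use int bound in auto)
      moreover have "0 \<le> expectation (\<lambda>\<omega>. norm (tilt_term ?x k \<omega>))" by simp
      ultimately show "norm (expectation (\<lambda>\<omega>. norm (tilt_term ?x k \<omega>))) \<le> \<bar>rec.b k * ?x ^ k\<bar> * (2 ^ n * B)"
        by (simp add: prob_space)
    qed
  qed
  then have "expectation (\<lambda>\<omega>. \<Sum>k. tilt_term ?x k \<omega>) = Q 0 {}"
    using expansion_sums_Q[OF x, of 0] unfolding expectation_tilt_term[OF x] by (rule sums_unique2)
  moreover have "expectation ?T = expectation (\<lambda>\<omega>. \<Sum>k. tilt_term ?x k \<omega>)"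
  proof (rule integral_cong_AE)
    have ae: "AE \<omega> in M. ?T \<omega> = (\<Sum>k. tilt_term ?x k \<omega>)"
      using \<epsilon>_eq_sg AE_space by eventually_elim (rule sums_unique[OF tilted_avg_sums])
    show "AE \<omega> in M. ?T \<omega> = (\<Sum>k. tilt_term ?x k \<omega>)" by (rule ae)
    show "(\<lambda>\<omega>. \<Sum>k. tilt_term ?x k \<omega>) \<in> borel_measurable M"
      by (rule borel_measurable_suminf[OF tilt_term_measurable])
    show "?T \<in> borel_measurable M" by (rule tilted_avg_measurable)
  qed
  moreover have "Q 0 {} = expectation (\<lambda>\<omega>. gibbs \<omega> n (\<lambda>r. ov n F \<omega> r))"
    using EE_eq_config_avg[OF observable_ov[OF F order_refl]]
    by (simp add: Q_eq[OF order_refl] odd_is_def)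
  ultimately show ?thesis by simp
qed

end

theorem theorem1:
  fixes M :: "'o measure"
    and A :: "'a set"
    and w \<epsilon> :: "'a \<Rightarrow> 'o \<Rightarrow> real"
    and \<xi> :: "'a \<Rightarrow> 'o \<Rightarrow> 'h :: {real_inner, banach, second_countable_topology}"
    and t :: real
    and n :: nat
    and F :: "(nat \<times> nat \<Rightarrow> real) \<Rightarrow> real"
  assumes "discrete_random_measure M A w \<xi>"
    and "ghirlanda_guerra M A w \<xi>"
    and "prob_space.indep_vars M (\<lambda>_. borel) \<epsilon> A"
    and "\<And>\<alpha>. \<alpha> \<in> A \<Longrightarrow> measure M {\<omega> \<in> space M. \<epsilon> \<alpha> \<omega> = 1} = 1 / 2"
    and "\<And>\<alpha>. \<alpha> \<in> A \<Longrightarrow> measure M {\<omega> \<in> space M. \<epsilon> \<alpha> \<omega> = -1} = 1 / 2"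
    and "prob_space.indep_set M
           (sets (vimage_algebra (space M) (\<lambda>\<omega>. \<lambda>\<alpha>\<in>A. (w \<alpha> \<omega>, \<xi> \<alpha> \<omega>))
                    (PiM A (\<lambda>_. borel \<Otimes>\<^sub>M borel))))
           (sets (vimage_algebra (space M) (\<lambda>\<omega>. \<lambda>\<alpha>\<in>A. \<epsilon> \<alpha> \<omega>)
                    (PiM A (\<lambda>_. borel))))"
    and "2 \<le> n"
    and "bounded_measurable_overlap_fun n F"
  shows "(\<integral>\<omega>. config_avg A (\<lambda>\<alpha>. tilted_weight A w \<epsilon> t \<alpha> \<omega>) n
                 (\<lambda>\<sigma>. F (overlap_array n (\<lambda>\<alpha>. \<xi> \<alpha> \<omega>) \<sigma>)) \<partial>M)
       = (\<integral>\<omega>. config_avg A (\<lambda>\<alpha>. w \<alpha> \<omega>) n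
                 (\<lambda>\<sigma>. F (overlap_array n (\<lambda>\<alpha>. \<xi> \<alpha> \<omega>) \<sigma>)) \<partial>M)"
proof -
  interpret discrete_random_measure M A w \<xi> by fact
  interpret gg_signs M A w \<xi> n F \<epsilon>
    by unfold_locales (fact assms)+
  show ?thesis by (rule expectation_tilted)
qed

end
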